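(* Let $(M,g)$ be a closed Riemannian manifold of dimension $n\ge 3$, let $f$ be a proper isoparametric function on $(M,g)$ with focal submanifolds $M_0,M_1$, let $S=M_0\cup M_1$ and $d(x)=d_g(S,x)$. Let $s\in(0,2)$, $q>2$, and let $K$ be an $f$-invariant continuous function on $M$. If $u\in C^{0}(M)\cap C^{2}(M\setminus S)$ is a non-negative $f$-invariant function satisfying $$\Delta_g u(x)+K(x)u(x)=\frac{u^{q-1}(x)}{(d(x))^{s}}\qquad\text{for all }x\in M\setminus S,$$ then either $u\equiv 0$ on $M$ or $u>0$ everywhere on $M$.
   Context: Closed means compact without boundary; $M$ is connected. $\Delta_g=-\mathrm{div}_g(\nabla\,\cdot)$ is the non-negative Laplace–Beltrami operator, and $d_g$ is the Riemannian distance. A non-constant smooth function $f:M\to[t_0,t_1]$ (with $t_0=\min f$, $t_1=\max f$) is isoparametric if there are smooth functions $a,b$ with $\|\nabla f\|^2=b\circ f$ and $\Delta_g f=a\circ f$. The sets $M_i=f^{-1}(t_i)$, $i=0,1$, are embedded submanifolds, called the focal submanifolds of $f$. $f$ is proper if both focal submanifolds have codimension greater than $1$. Let $\mathbf d:M\to[0,D]$ be the distance to $M_0$, where $D=d_g(M_0,M_1)$. A function $u$ is $f$-invariant if it is constant on the level sets of $f$, equivalently $u=\varphi\circ\mathbf d$ for some real function $\varphi$ on $[0,D]$. *)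

theory Defs
  imports "HOL-Analysis.Analysis"
begin

section \<open>Functions of class $C^k$\<close>

text \<open>Intended for open \<open>S\<close> and finite-dimensional \<open>'a\<close>, where continuity of all iterated directional
  derivatives of order at most \<open>k\<close> is the usual notion.\<close>

primrec Ck_on ::
  "nat \<Rightarrow> ('a::euclidean_space \<Rightarrow> 'b::real_normed_vector) \<Rightarrow> 'a set \<Rightarrow> bool" where
  "Ck_on 0 F S \<longleftrightarrow> continuous_on S F"
| "Ck_on (Suc k) F S \<longleftrightarrow>
     (\<forall>y\<in>S. F differentiable (at y)) \<and>
     (\<forall>v. Ck_on k (\<lambda>y. frechet_derivative F (at y) v) S)"

definition smooth_on :: "('a::euclidean_space \<Rightarrow> 'b::real_normed_vector) \<Rightarrow> 'a set \<Rightarrow> bool" where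
  "smooth_on F S \<longleftrightarrow> (\<forall>k. Ck_on k F S)"

section \<open>Smooth manifolds\<close>

text \<open>A manifold is a subset \<open>M\<close> of a Hausdorff space, with the subspace topology.  A chart is a
  pair of its domain and its coordinate map; the values of the latter outside the domain are
  irrelevant.\<close>

type_synonym ('m, 'n) chart = "'m set \<times> ('m \<Rightarrow> real^'n)"

abbreviation cdom :: "('m, 'n) chart \<Rightarrow> 'm set" where
  "cdom c \<equiv> fst c"

abbreviation coord :: "('m, 'n) chart \<Rightarrow> 'm \<Rightarrow> real^'n" where
  "coord c \<equiv> snd c"

abbreviation coord_inv :: "('m, 'n) chart \<Rightarrow> real^'n \<Rightarrow> 'm" where
  "coord_inv c \<equiv> inv_into (cdom c) (coord c)"

definition is_chart :: "'m::topological_space set \<Rightarrow> ('m, 'n::finite) chart \<Rightarrow> bool" where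
  "is_chart M c \<longleftrightarrow>
     openin (top_of_set M) (cdom c) \<and> open (coord c ` cdom c) \<and>
     homeomorphism (cdom c) (coord c ` cdom c) (coord c) (coord_inv c)"

definition smooth_transition :: "('m, 'n::finite) chart \<Rightarrow> ('m, 'n) chart \<Rightarrow> bool" where
  "smooth_transition c c' \<longleftrightarrow>
     smooth_on (coord c' \<circ> coord_inv c) (coord c ` (cdom c \<inter> cdom c'))"

definition compatible :: "('m, 'n::finite) chart \<Rightarrow> ('m, 'n) chart \<Rightarrow> bool" where
  "compatible c c' \<longleftrightarrow> smooth_transition c c' \<and> smooth_transition c' c"

text \<open>A smooth structure is a maximal smooth atlas.\<close>

definition smooth_structure ::
  "'m::topological_space set \<Rightarrow> ('m, 'n::finite) chart set \<Rightarrow> bool" where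
  "smooth_structure M A \<longleftrightarrow>
     (\<forall>c\<in>A. is_chart M c) \<and> (\<Union>c\<in>A. cdom c) = M \<and>
     (\<forall>c\<in>A. \<forall>c'\<in>A. compatible c c') \<and>
     (\<forall>c. is_chart M c \<and> (\<forall>c'\<in>A. compatible c c') \<longrightarrow> c \<in> A)"

definition Ck_fun ::
  "('m, 'n::finite) chart set \<Rightarrow> nat \<Rightarrow> ('m \<Rightarrow> real) \<Rightarrow> 'm set \<Rightarrow> bool" where
  "Ck_fun A k u W \<longleftrightarrow> (\<forall>c\<in>A. Ck_on k (u \<circ> coord_inv c) (coord c ` (cdom c \<inter> W)))"

definition smooth_fun :: "('m, 'n::finite) chart set \<Rightarrow> ('m \<Rightarrow> real) \<Rightarrow> 'm set \<Rightarrow> bool" where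
  "smooth_fun A u W \<longleftrightarrow> (\<forall>k. Ck_fun A k u W)"

text \<open>Existence of a slice chart at \<open>p\<close>.  Stated pointwise since different components of a
  submanifold may have different codimensions.\<close>

definition submanifold_codim_at ::
  "('m, 'n::finite) chart set \<Rightarrow> 'm set \<Rightarrow> 'm \<Rightarrow> nat \<Rightarrow> bool" where
  "submanifold_codim_at A N p k \<longleftrightarrow>
     (\<exists>c\<in>A. p \<in> cdom c \<and>
       (\<exists>I. card I = k \<and>
          coord c ` (cdom c \<inter> N) = {y \<in> coord c ` cdom c. \<forall>i\<in>I. y $ i = 0}))"

section \<open>Riemannian metrics\<close>

text \<open>A metric is given by its components: \<open>g c y\<close> is the matrix of the metric with respect to the
  coordinate frame of the chart \<open>c\<close> at the point with coordinates \<open>y\<close>.\<close>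

type_synonym ('m, 'n) metric_field = "('m, 'n) chart \<Rightarrow> real^'n \<Rightarrow> real^'n^'n"

definition jacobian ::
  "('m, 'n::finite) chart \<Rightarrow> ('m, 'n) chart \<Rightarrow> 'm \<Rightarrow> real^'n^'n" where
  "jacobian c c' p = matrix (frechet_derivative (coord c' \<circ> coord_inv c) (at (coord c p)))"

definition riemannian_metric ::
  "('m, 'n::finite) chart set \<Rightarrow> ('m, 'n) metric_field \<Rightarrow> bool" where
  "riemannian_metric A g \<longleftrightarrow>
     (\<forall>c\<in>A. smooth_on (g c) (coord c ` cdom c) \<and>
        (\<forall>y\<in>coord c ` cdom c.
           transpose (g c y) = g c y \<and> (\<forall>v. v \<noteq> 0 \<longrightarrow> v \<bullet> (g c y *v v) > 0))) \<and>
     (\<forall>c\<in>A. \<forall>c'\<in>A. \<forall>p\<in>cdom c \<inter> cdom c'.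
        g c (coord c p)
          = transpose (jacobian c c' p) ** g c' (coord c' p) ** jacobian c c' p)"

definition closed_riemannian_manifold ::
  "'m::t2_space set \<Rightarrow> ('m, 'n::finite) chart set \<Rightarrow> ('m, 'n) metric_field \<Rightarrow> bool" where
  "closed_riemannian_manifold M A g \<longleftrightarrow>
     compact M \<and> connected M \<and> smooth_structure M A \<and> riemannian_metric A g"

text \<open>Geometric quantities at a point are computed in an arbitrarily chosen chart around it; by the
  transformation law of the metric they do not depend on this choice.\<close>

definition chart_at :: "('m, 'n) chart set \<Rightarrow> 'm \<Rightarrow> ('m, 'n) chart" where
  "chart_at A p = (SOME c. c \<in> A \<and> p \<in> cdom c)"

definition partial_deriv :: "'n::finite \<Rightarrow> (real^'n \<Rightarrow> real) \<Rightarrow> real^'n \<Rightarrow> real" where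
  "partial_deriv i F y = frechet_derivative F (at y) (axis i 1)"

definition grad_coord ::
  "('m, 'n::finite) metric_field \<Rightarrow> ('m, 'n) chart \<Rightarrow> ('m \<Rightarrow> real) \<Rightarrow> real^'n \<Rightarrow> real^'n" where
  "grad_coord g c u y = matrix_inv (g c y) *v (\<chi> i. partial_deriv i (u \<circ> coord_inv c) y)"

definition div_coord ::
  "('m, 'n::finite) metric_field \<Rightarrow> ('m, 'n) chart \<Rightarrow> (real^'n \<Rightarrow> real^'n) \<Rightarrow> real^'n \<Rightarrow> real" where
  "div_coord g c X y =
     (\<Sum>i\<in>UNIV. partial_deriv i (\<lambda>z. sqrt (det (g c z)) * X z $ i) y) / sqrt (det (g c y))"

definition grad_norm_sq ::
  "('m, 'n::finite) chart set \<Rightarrow> ('m, 'n) metric_field \<Rightarrow> ('m \<Rightarrow> real) \<Rightarrow> 'm \<Rightarrow> real" where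
  "grad_norm_sq A g u p =
     (let c = chart_at A p; y = coord c p; X = grad_coord g c u y in X \<bullet> (g c y *v X))"

definition laplace_beltrami ::
  "('m, 'n::finite) chart set \<Rightarrow> ('m, 'n) metric_field \<Rightarrow> ('m \<Rightarrow> real) \<Rightarrow> 'm \<Rightarrow> real" where
  "laplace_beltrami A g u p =
     (let c = chart_at A p in - div_coord g c (grad_coord g c u) (coord c p))"

section \<open>Riemannian distance\<close>

text \<open>Derivatives are taken within \<open>{a..b}\<close>, hence one-sided at the end points, and are continuous
  up to the end points.\<close>

definition C1_curve ::
  "'m::topological_space set \<Rightarrow> ('m, 'n::finite) chart set \<Rightarrow> real \<Rightarrow> real \<Rightarrow> (real \<Rightarrow> 'm) \<Rightarrow> bool"
  where
  "C1_curve M A a b \<gamma> \<longleftrightarrow>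
     continuous_on {a..b} \<gamma> \<and> \<gamma> ` {a..b} \<subseteq> M \<and>
     (\<forall>c\<in>A. let T = {t\<in>{a..b}. \<gamma> t \<in> cdom c} in
        (\<forall>t\<in>T. (coord c \<circ> \<gamma>) differentiable (at t within {a..b})) \<and>
        continuous_on T (\<lambda>t. vector_derivative (coord c \<circ> \<gamma>) (at t within {a..b})))"

definition curve_speed ::
  "('m, 'n::finite) chart set \<Rightarrow> ('m, 'n) metric_field \<Rightarrow> real \<Rightarrow> real \<Rightarrow> (real \<Rightarrow> 'm) \<Rightarrow> real \<Rightarrow> real"
  where
  "curve_speed A g a b \<gamma> t =
     (let c = chart_at A (\<gamma> t); v = vector_derivative (coord c \<circ> \<gamma>) (at t within {a..b})
      in sqrt (v \<bullet> (g c (coord c (\<gamma> t)) *v v)))"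

text \<open>A piecewise $C^1$ curve has break points \<open>\<tau> 0 < \<dots> < \<tau> m\<close>.\<close>

definition piecewise_C1_curve ::
  "'m::topological_space set \<Rightarrow> ('m, 'n::finite) chart set \<Rightarrow> nat \<Rightarrow> (nat \<Rightarrow> real) \<Rightarrow> (real \<Rightarrow> 'm) \<Rightarrow> bool"
  where
  "piecewise_C1_curve M A m \<tau> \<gamma> \<longleftrightarrow>
     (\<forall>i<m. \<tau> i < \<tau> (Suc i) \<and> C1_curve M A (\<tau> i) (\<tau> (Suc i)) \<gamma>)"

definition curve_length ::
  "('m, 'n::finite) chart set \<Rightarrow> ('m, 'n) metric_field \<Rightarrow> nat \<Rightarrow> (nat \<Rightarrow> real) \<Rightarrow> (real \<Rightarrow> 'm) \<Rightarrow> real"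
  where
  "curve_length A g m \<tau> \<gamma> =
     (\<Sum>i<m. integral {\<tau> i..\<tau> (Suc i)} (curve_speed A g (\<tau> i) (\<tau> (Suc i)) \<gamma>))"

definition riem_dist ::
  "'m::topological_space set \<Rightarrow> ('m, 'n::finite) chart set \<Rightarrow> ('m, 'n) metric_field \<Rightarrow> 'm \<Rightarrow> 'm \<Rightarrow> real"
  where
  "riem_dist M A g p q =
     Inf {curve_length A g m \<tau> \<gamma> |m \<tau> \<gamma>.
            piecewise_C1_curve M A m \<tau> \<gamma> \<and> \<gamma> (\<tau> 0) = p \<and> \<gamma> (\<tau> m) = q}"

definition riem_setdist ::
  "'m::topological_space set \<Rightarrow> ('m, 'n::finite) chart set \<Rightarrow> ('m, 'n) metric_field \<Rightarrow>
     'm set \<Rightarrow> 'm \<Rightarrow> real"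
  where
  "riem_setdist M A g S x = (INF p\<in>S. riem_dist M A g p x)"

section \<open>Isoparametric functions\<close>

text \<open>Smoothness of \<open>a\<close> and \<open>b\<close> on the compact interval \<open>[min f, max f]\<close> is expressed, as usual, by
  smoothness of an extension to the real line.\<close>

definition isoparametric ::
  "'m::topological_space set \<Rightarrow> ('m, 'n::finite) chart set \<Rightarrow> ('m, 'n) metric_field \<Rightarrow>
     ('m \<Rightarrow> real) \<Rightarrow> bool"
  where
  "isoparametric M A g f \<longleftrightarrow>
     smooth_fun A f M \<and> (\<exists>x\<in>M. \<exists>y\<in>M. f x \<noteq> f y) \<and>
     (\<exists>a b :: real \<Rightarrow> real. smooth_on a UNIV \<and> smooth_on b UNIV \<and>
        (\<forall>x\<in>M. grad_norm_sq A g f x = b (f x)) \<and>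
        (\<forall>x\<in>M. laplace_beltrami A g f x = a (f x)))"

text \<open>\<open>Inf\<close> and \<open>Sup\<close> are attained when \<open>M\<close> is compact and \<open>f\<close> is continuous.\<close>

definition focal_min :: "'m set \<Rightarrow> ('m \<Rightarrow> real) \<Rightarrow> 'm set" where
  "focal_min M f = {x\<in>M. f x = Inf (f ` M)}"

definition focal_max :: "'m set \<Rightarrow> ('m \<Rightarrow> real) \<Rightarrow> 'm set" where
  "focal_max M f = {x\<in>M. f x = Sup (f ` M)}"

definition proper_isoparametric ::
  "'m::topological_space set \<Rightarrow> ('m, 'n::finite) chart set \<Rightarrow> ('m, 'n) metric_field \<Rightarrow>
     ('m \<Rightarrow> real) \<Rightarrow> bool"
  where
  "proper_isoparametric M A g f \<longleftrightarrow>
     isoparametric M A g f \<and>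
     (\<forall>N\<in>{focal_min M f, focal_max M f}. \<forall>p\<in>N. \<exists>k>1. submanifold_codim_at A N p k)"

definition level_invariant :: "'m set \<Rightarrow> ('m \<Rightarrow> real) \<Rightarrow> ('m \<Rightarrow> real) \<Rightarrow> bool" where
  "level_invariant M f u \<longleftrightarrow> (\<forall>x\<in>M. \<forall>y\<in>M. f x = f y \<longrightarrow> u x = u y)"

end

theory Submission
  imports Defs
begin

text \<open>The equation is used through one inequality.  Its right-hand side is non-negative, so with a bound
\<open>C\<close> for \<open>\<bar>K\<bar>\<close> the function \<open>u \<ge> 0\<close> satisfies \<open>\<Delta> u + C u \<ge> 0\<close> off the focal set: it is a
supersolution, and the claim is a strong minimum principle that has to cope with the singular set.

Since \<open>u\<close> is constant on level sets, \<open>u = \<phi> \<circ> f\<close> with \<open>\<phi>\<close> defined on the range \<open>[t0, t1]\<close> of \<open>f\<close>.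
If \<open>\<parallel>\<nabla>f\<parallel>\<^sup>2 = b(f)\<close> and \<open>\<Delta> f = a(f)\<close>, then \<open>\<Delta> u = a \<phi>' - b \<phi>''\<close>, so that on \<open>(t0, t1)\<close>
  \<open>b \<phi>'' - a \<phi>' \<le> C \<phi>\<close>,  \<open>\<phi> \<ge> 0\<close>.
Two facts about \<open>a\<close> and \<open>b\<close> make the minimum principle work.

Interior.  At a zero of \<open>b\<close> inside \<open>(t0, t1)\<close> also \<open>b'\<close> vanishes, because \<open>b \<ge> 0\<close>.  But if
\<open>b(t) = b'(t) = 0\<close>, then \<open>\<parallel>\<nabla>f\<parallel> \<le> c \<bar>f - t\<bar>\<close> near the level set \<open>f = t\<close>, which by Gronwall makes the
level set open; as it is closed and \<open>M\<close> is connected, \<open>f\<close> would be constant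
(\<open>no_degenerate_level\<close>).  Thus \<open>b > 0\<close> in the interior, the inequality is uniformly elliptic on
compact subintervals, and a zero of \<open>\<phi>\<close> spreads over \<open>(t0, t1)\<close> by Hopf's barrier
(\<open>interior_zero_propagates\<close>).

End points.  At \<open>t0\<close> we have \<open>b = 0\<close>, and \<open>\<beta> = b'(t0) > 0\<close> by the same argument.  Near \<open>t0\<close> the
operator looks like \<open>\<beta> ((t - t0) \<phi>'' + \<alpha> \<phi>')\<close> with \<open>\<alpha> = -a(t0) / \<beta>\<close>, whose second solution
\<open>(t - t0) powr (1 - \<alpha>)\<close>, or \<open>ln (t - t0)\<close>, is unbounded exactly if \<open>\<alpha> \<ge> 1\<close>.  In this case a
logarithmic barrier shows that a positive \<open>\<phi>\<close> cannot tend to \<open>0\<close> at \<open>t0\<close>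
(\<open>singular_endpoint_positive\<close>).  The inequality \<open>\<alpha> \<ge> 1\<close> is where the codimension enters: in fact
\<open>\<alpha> = k / 2\<close> for a focal set of codimension \<open>k\<close>.  To see \<open>\<alpha> \<ge> k / 2\<close>, let \<open>H\<close> be the Hessian of \<open>f\<close>
in a chart at a focal point and \<open>B\<close> the inverse of the matrix of the metric there.  Comparing second
order terms in \<open>\<parallel>\<nabla>f\<parallel>\<^sup>2 = b(f)\<close> gives \<open>H B H = (\<beta> / 2) H\<close>, so \<open>P = (2 / \<beta>) B H\<close> is idempotent and
\<open>-a(t0) = trace (B H) = (\<beta> / 2) rank P\<close>.  The rank is at least \<open>k\<close> because null vectors of \<open>H\<close> are
tangent to the focal set: \<open>sqrt (f - t0)\<close> has gradient bounded below, so a variational argument (in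
place of the gradient flow) puts a point of the focal set within distance \<open>O(sqrt (f(y) - t0))\<close> of
each nearby point \<open>y\<close> (\<open>zero_set_within_gradient_distance\<close>, \<open>trace_hessian_ge_codimension\<close>).  The
end point \<open>t1\<close> is the same after reflecting \<open>f\<close> and \<open>t\<close>.\<close>

section \<open>Matrices\<close>

lemma matrix_inv_works:
  fixes A :: "real^'n^'n"
  assumes "det A \<noteq> 0"
  shows "A ** matrix_inv A = mat 1" "matrix_inv A ** A = mat 1"
proof -
  have "\<exists>B. A ** B = mat 1 \<and> B ** A = mat 1"
    using assms invertible_det_nz[of A] by (simp add: invertible_def)
  from someI_ex[OF this] show "A ** matrix_inv A = mat 1" "matrix_inv A ** A = mat 1"
    by (simp_all add: matrix_inv_def)
qed

lemma matrix_inv_unique: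
  fixes A B :: "real^'n^'n"
  assumes "det A \<noteq> 0" "A ** B = mat 1"
  shows "matrix_inv A = B"
  by (metis assms matrix_inv_works(2) matrix_mul_assoc matrix_mul_lid matrix_mul_rid)

text \<open>Cramer's rule; it is what makes the inverse of a differentiable matrix field differentiable.\<close>

lemma matrix_inv_entry:
  fixes A :: "real^'n^'n"
  assumes "det A \<noteq> 0"
  shows "matrix_inv A $ i $ k = det (\<chi> r c. if c = i then axis k 1 $ r else A $ r $ c) / det A"
proof -
  have "A *v (matrix_inv A *v axis k 1) = axis k 1"
    using matrix_inv_works(1)[OF assms] by (simp add: matrix_vector_mul_assoc)
  hence "matrix_inv A *v axis k 1 = (\<chi> c. det (\<chi> r j. if j = c then axis k 1 $ r else A $ r $ j) / det A)"
    using cramer[OF assms, of "matrix_inv A *v axis k 1" "axis k 1"] by simp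
  hence "(matrix_inv A *v axis k 1) $ i = det (\<chi> r j. if j = i then axis k 1 $ r else A $ r $ j) / det A"
    by simp
  thus ?thesis by (simp add: matrix_vector_mul_component column_def matrix_vector_mult_basis)
qed

lemma posdef_det_nonzero:
  fixes A :: "real^'n^'n"
  assumes "\<And>v. v \<noteq> 0 \<Longrightarrow> v \<bullet> (A *v v) > 0"
  shows "det A \<noteq> 0"
proof -
  have "inj ((*v) A)"
    by (rule linear_injective_0[THEN iffD2, OF matrix_vector_mul_linear]) (use assms in force)
  thus ?thesis
    using invertible_det_nz invertible_left_inverse matrix_left_invertible_injective by blast
qed

lemma matrix_inv_symmetric:
  fixes A :: "real^'n^'n"
  assumes "det A \<noteq> 0" "transpose A = A"
  shows "transpose (matrix_inv A) = matrix_inv A"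
proof -
  have "transpose (matrix_inv A ** A) = mat 1" using matrix_inv_works(2)[OF assms(1)] by simp
  hence "A ** transpose (matrix_inv A) = mat 1" by (simp add: matrix_transpose_mul assms)
  from matrix_inv_unique[OF assms(1) this] show ?thesis ..
qed

lemma matrix_inv_posdef:
  fixes A :: "real^'n^'n"
  assumes pd: "\<And>v. v \<noteq> 0 \<Longrightarrow> v \<bullet> (A *v v) > 0" and w: "w \<noteq> 0"
  shows "w \<bullet> (matrix_inv A *v w) > 0"
proof -
  let ?v = "matrix_inv A *v w"
  have Av: "A *v ?v = w" using matrix_inv_works(1)[OF posdef_det_nonzero[OF pd]]
    by (simp add: matrix_vector_mul_assoc)
  hence "?v \<noteq> 0" using w by auto
  from pd[OF this] show ?thesis by (simp add: Av inner_commute)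
qed

text \<open>The space splits into the range, on which \<open>P\<close> is the identity, and the kernel.  In a basis adapted
to this splitting \<open>P\<close> becomes a diagonal matrix of ones and zeros, and the trace does not depend on the
basis.  So the right-hand side is the rank of \<open>P\<close>.\<close>

lemma trace_idempotent:
  fixes P :: "real^'n^'n"
  assumes PP: "P ** P = P"
  shows "trace P = real (CARD('n) - dim {v. P *v v = 0})"
proof -
  define W where "W = {v. P *v v = v}"
  define K where "K = {v. P *v v = 0}"
  have PPv: "P *v (P *v v) = P *v v" for v by (simp add: matrix_vector_mul_assoc PP)
  have sW: "subspace W" and sK: "subspace K"
    by (auto simp: subspace_def W_def K_def matrix_vector_right_distrib matrix_vector_mult_scaleR)
  have "W \<inter> K = {0}" by (auto simp: W_def K_def)
  moreover have sum: "{x + y |x y. x \<in> W \<and> y \<in> K} = UNIV"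
  proof safe
    fix v :: "real^'n"
    have "v = P *v v + (v - P *v v)" by simp
    moreover have "P *v v \<in> W" "v - P *v v \<in> K"
      by (auto simp: W_def K_def PPv matrix_vector_mult_diff_distrib)
    ultimately show "\<exists>x y. v = x + y \<and> x \<in> W \<and> y \<in> K" by blast
  qed auto
  ultimately have dims: "dim W + dim K = CARD('n)"
    using dim_sums_Int[OF sW sK] by simp
  obtain BW where BW: "BW \<subseteq> W" "independent BW" "W \<subseteq> span BW" "card BW = dim W" using basis_exists by blast
  obtain BK where BK: "BK \<subseteq> K" "independent BK" "K \<subseteq> span BK" "card BK = dim K" using basis_exists by blast
  have fin: "finite BW" "finite BK" using BW BK by (auto intro: finiteI_independent)
  define C where "C = BW \<union> BK"
  have spanC: "span C = UNIV"
  proof -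
    have "x + y \<in> span C" if "x \<in> W" "y \<in> K" for x y
      using that BW(3) BK(3) span_mono[of BW C] span_mono[of BK C] by (auto simp: C_def intro!: span_add)
    hence "{x + y |x y. x \<in> W \<and> y \<in> K} \<subseteq> span C" by auto
    thus ?thesis using sum by (simp add: top.extremum_unique)
  qed
  have "card C \<le> CARD('n)" using card_Un_le[of BW BK] BW BK dims by (simp add: C_def)
  moreover have finC: "finite C" using fin by (simp add: C_def)
  ultimately have indC: "independent C"
    using card_le_dim_spanning[of C UNIV] spanC by simp
  have cardC: "card C = CARD('n)" using dim_span_eq_card_independent[OF indC] spanC by simp
  have "BW \<inter> BK = {}"
  proof -
    have "card (BW \<union> BK) + card (BW \<inter> BK) = card BW + card BK" using card_Un_Int[OF fin] by simp
    hence "card (BW \<inter> BK) = 0" using cardC BW BK dims by (simp add: C_def)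
    thus ?thesis using fin by simp
  qed
  obtain e where e: "bij_betw e (UNIV::'n set) C"
    using finite_same_card_bij[of "UNIV::'n set" C] finC cardC by auto
  define S :: "real^'n^'n" where "S = (\<chi> i j. e j $ i)"
  have Scol: "S *v axis j 1 = e j" for j
    by (simp add: S_def matrix_vector_mult_basis column_def vec_eq_iff)
  have "columns S = C"
  proof -
    have "column j S = e j" for j by (simp add: S_def column_def vec_eq_iff)
    thus ?thesis using e by (auto simp: columns_def bij_betw_def)
  qed
  hence "surj ((*v) S)"
    using matrix_right_invertible_span_columns[of S] matrix_right_invertible_surjective[of S] spanC
    by (simp add: span_vec_eq)
  then obtain R where R: "S ** R = mat 1" using matrix_right_invertible_surjective[of S] by auto
  have R': "R ** S = mat 1" using R matrix_left_right_inverse by blast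
  \<comment> \<open>the matrix of \<open>P\<close> in the adapted basis formed by the columns of \<open>S\<close>\<close>
  define \<Delta> :: "real^'n^'n" where "\<Delta> = (\<chi> i j. if i = j \<and> e j \<in> BW then 1 else 0)"
  have Dcol: "\<Delta> *v axis j 1 = (if e j \<in> BW then axis j 1 else 0)" for j
    unfolding matrix_vector_mult_basis by (auto simp: \<Delta>_def column_def vec_eq_iff axis_def)
  have "P ** S = S ** \<Delta>"
  proof (rule matrix_eq[THEN iffD2], rule allI)
    fix x :: "real^'n"
    have ax: "P *v (S *v axis j 1) = S *v (\<Delta> *v axis j 1)" for j
    proof (cases "e j \<in> BW")
      case True
      thus ?thesis using BW(1) by (auto simp: Scol W_def Dcol)
    next
      case False
      hence "e j \<in> BK" using e False by (auto simp: bij_betw_def C_def)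
      thus ?thesis using BK(1) False by (auto simp: Scol K_def Dcol)
    qed
    have x: "x = (\<Sum>j\<in>UNIV. x $ j *\<^sub>R axis j 1)" using basis_expansion[of x] by (simp add: scalar_mult_eq_scaleR)
    have "(P ** S) *v x = (\<Sum>j\<in>UNIV. x $ j *\<^sub>R (P *v (S *v axis j 1)))"
      by (subst x) (simp add: matrix_vector_mul_assoc[symmetric] vec.linear_sum linear_sum[OF matrix_vector_mul_linear] matrix_vector_mult_scaleR)
    also have "\<dots> = (S ** \<Delta>) *v x"
      unfolding ax
      by (subst (2) x) (simp add: matrix_vector_mul_assoc[symmetric] linear_sum[OF matrix_vector_mul_linear] matrix_vector_mult_scaleR)
    finally show "(P ** S) *v x = (S ** \<Delta>) *v x" .
  qed
  hence "P = S ** \<Delta> ** R" by (metis R matrix_mul_assoc matrix_mul_rid)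
  hence "trace P = trace (R ** (S ** \<Delta>))" by (metis trace_mul_sym)
  also have "\<dots> = trace \<Delta>" by (simp add: matrix_mul_assoc R')
  also have "\<dots> = real (card {j. e j \<in> BW})" by (simp add: trace_def \<Delta>_def sum.If_cases)
  also have "card {j. e j \<in> BW} = card BW"
  proof -
    have "e ` {j. e j \<in> BW} = BW" using e by (auto simp: bij_betw_def C_def)
    thus ?thesis using e by (metis bij_betw_def card_image inj_on_subset subset_UNIV)
  qed
  also have "card BW = CARD('n) - dim K" using BW dims by simp
  finally show ?thesis by (simp add: K_def)
qed

text \<open>The invertible matrix \<open>D\<close> stands for a change of coordinates: the kernel of \<open>P\<close> lies in
a subspace that, in the new coordinates, is cut out by the equations \<open>y $ i = 0\<close> for \<open>i \<in> I\<close>.\<close>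

lemma trace_idempotent_ge:
  fixes P D :: "real^'n^'n" and I :: "'n set"
  assumes PP: "P ** P = P" and D: "det D \<noteq> 0"
    and ker: "\<And>v i. P *v v = 0 \<Longrightarrow> i \<in> I \<Longrightarrow> (D *v v) $ i = 0"
  shows "real (card I) \<le> trace P"
proof -
  let ?K = "{v. P *v v = 0}"
  have "inj ((*v) D)" using D by (metis inj_matrix_vector_mult invertible_det_nz)
  hence "dim ?K = dim ((*v) D ` ?K)"
    by (metis (no_types, lifting) dim_image_eq inj_on_subset matrix_vector_mul_linear subset_UNIV)
  also have "\<dots> \<le> dim {x::real^'n. \<forall>b\<in>Basis. b \<notin> (\<lambda>i. axis i 1) ` (- I) \<longrightarrow> x \<bullet> b = 0}"
    using ker by (intro dim_subset) (auto simp: Basis_vec_def inner_axis axis_eq_axis)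
  also have "\<dots> = card ((\<lambda>i. axis i 1 :: real^'n) ` (- I))"
    by (intro dim_substandard) (auto simp: Basis_vec_def)
  also have "\<dots> = card (- I)" by (intro card_image) (auto simp: inj_on_def axis_eq_axis)
  also have "\<dots> = CARD('n) - card I" by (simp add: Compl_eq_Diff_UNIV card_Diff_subset)
  finally have "dim ?K \<le> CARD('n) - card I" .
  moreover have "card I \<le> CARD('n)" by (intro card_mono) auto
  ultimately have "card I \<le> CARD('n) - dim ?K" by simp
  thus ?thesis unfolding trace_idempotent[OF PP] by simp
qed

lemma quadratic_form_determines_matrix:
  fixes A B :: "real^'n^'n"
  assumes "transpose A = A" "transpose B = B" "\<And>v. v \<bullet> (A *v v) = v \<bullet> (B *v v)"
  shows "A = B"
proof -
  have s: "v \<bullet> (C *v w) = w \<bullet> (C *v v)" if "transpose C = C" for C :: "real^'n^'n" and v w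
    by (metis dot_lmul_matrix inner_commute that transpose_matrix_vector)
  have "v \<bullet> (A *v w) = v \<bullet> (B *v w)" for v w
    using assms(3)[of "v + w"] assms(3)[of v] assms(3)[of w] s[OF assms(1), of v w] s[OF assms(2), of v w]
    by (simp add: matrix_vector_right_distrib inner_add_left inner_add_right)
  hence "A *v w = B *v w" for w by (metis inner_commute vector_eq_ldot)
  thus ?thesis by (simp add: matrix_eq)
qed

section \<open>The Hessian of a solution of an eikonal equation on its zero set\<close>

text \<open>Taylor's formula at a critical point under the weak assumption that the gradient is
differentiable at that single point; it follows from l'Hopital's rule along a line.\<close>

lemma second_order_expansion:
  fixes F :: "'a::euclidean_space \<Rightarrow> real"
  assumes V: "open V" "p \<in> V"
    and F: "\<And>y. y \<in> V \<Longrightarrow> (F has_derivative (\<lambda>h. G y \<bullet> h)) (at y)"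
    and G: "(G has_derivative H) (at p)" and G0: "G p = 0"
  shows "((\<lambda>t. (F (p + t *\<^sub>R v) - F p) / t\<^sup>2) \<longlongrightarrow> (v \<bullet> H v) / 2) (at 0)"
proof -
  have lin: "((\<lambda>t. p + t *\<^sub>R v) \<longlongrightarrow> p) (at 0)" by (auto intro!: tendsto_eq_intros)
  have evV: "\<forall>\<^sub>F t in at 0. p + t *\<^sub>R v \<in> V" using topological_tendstoD[OF lin V] .
  have dF: "((\<lambda>t. F (p + t *\<^sub>R v) - F p) has_real_derivative G (p + t *\<^sub>R v) \<bullet> v) (at t)" if "p + t *\<^sub>R v \<in> V" for t
  proof -
    have "((\<lambda>t. p + t *\<^sub>R v) has_derivative (\<lambda>s. s *\<^sub>R v)) (at t)" by (auto intro!: derivative_eq_intros)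
    from has_derivative_compose[OF this F[OF that]]
    have "((\<lambda>t. F (p + t *\<^sub>R v) - F p) has_derivative (\<lambda>s. G (p + t *\<^sub>R v) \<bullet> (s *\<^sub>R v))) (at t)"
      by (auto intro!: derivative_eq_intros)
    thus ?thesis by (simp add: has_field_derivative_def mult_commute_abs)
  qed
  have dG: "((\<lambda>t. G (p + t *\<^sub>R v) \<bullet> v) has_real_derivative H v \<bullet> v) (at 0)"
  proof -
    have 1: "((\<lambda>t. p + t *\<^sub>R v) has_derivative (\<lambda>s. s *\<^sub>R v)) (at 0)" by (auto intro!: derivative_eq_intros)
    have "(G has_derivative H) (at (p + 0 *\<^sub>R v))" using G by simp
    from has_derivative_compose[OF 1 this]
    have "((\<lambda>t. G (p + t *\<^sub>R v) \<bullet> v) has_derivative (\<lambda>s. H (s *\<^sub>R v) \<bullet> v)) (at 0)"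
      by (auto intro!: derivative_eq_intros)
    moreover have "H (s *\<^sub>R v) = s *\<^sub>R H v" for s
      using has_derivative_linear[OF G] by (simp add: linear_scale)
    ultimately show ?thesis by (simp add: has_field_derivative_def mult_commute_abs)
  qed
  show ?thesis
  proof (rule lhopital[where f'="\<lambda>t. G (p + t *\<^sub>R v) \<bullet> v" and g'="\<lambda>t. 2 * t"])
    have "isCont (\<lambda>t. F (p + t *\<^sub>R v) - F p) 0" using dF[of 0] V by (auto intro: DERIV_isCont)
    thus "((\<lambda>t. F (p + t *\<^sub>R v) - F p) \<longlongrightarrow> 0) (at 0)" by (simp add: isCont_def)
    show "((\<lambda>t::real. t\<^sup>2) \<longlongrightarrow> 0) (at 0)" by (auto intro!: tendsto_eq_intros)
    show "\<forall>\<^sub>F t in at (0::real). t\<^sup>2 \<noteq> 0" "\<forall>\<^sub>F t in at (0::real). 2 * t \<noteq> 0"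
      by (auto simp: eventually_at_filter)
    show "\<forall>\<^sub>F t in at 0. ((\<lambda>t. F (p + t *\<^sub>R v) - F p) has_real_derivative G (p + t *\<^sub>R v) \<bullet> v) (at t)"
      using evV by eventually_elim (rule dF)
    show "\<forall>\<^sub>F t in at (0::real). ((\<lambda>t. t\<^sup>2) has_real_derivative 2 * t) (at t)"
      by (auto intro!: always_eventually derivative_eq_intros)
    have "((\<lambda>t. (G (p + t *\<^sub>R v) \<bullet> v) / t / 2) \<longlongrightarrow> (H v \<bullet> v) / 2) (at 0)"
      using dG by (intro tendsto_intros) (auto simp: DERIV_def G0)
    thus "((\<lambda>t. G (p + t *\<^sub>R v) \<bullet> v / (2 * t)) \<longlongrightarrow> (v \<bullet> H v) / 2) (at 0)"
      by (simp add: inner_commute mult.commute)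
  qed
qed

text \<open>Schwarz's theorem for a gradient that is differentiable at one point.  The difference
\<open>F(p + t(v + w)) - F(p + tv)\<close> is computed twice to order \<open>t\<^sup>2\<close>: by the second order expansion at \<open>p\<close>,
and by the mean value theorem, in which the unknown intermediate point only costs \<open>\<bar>w \<bullet> H w\<bar>\<close>.  Hence the
asymmetry \<open>v \<bullet> H w - w \<bullet> H v\<close> is bounded by a quantity that does not depend on \<open>v\<close>, and so it vanishes.\<close>

lemma hessian_symmetric:
  fixes F :: "'a::euclidean_space \<Rightarrow> real"
  assumes V: "open V" "p \<in> V"
    and F: "\<And>y. y \<in> V \<Longrightarrow> (F has_derivative (\<lambda>h. G y \<bullet> h)) (at y)"
    and G: "(G has_derivative H) (at p)" and G0: "G p = 0"
  shows "v \<bullet> H w = w \<bullet> H v"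
proof -
  have linH: "linear H" using has_derivative_linear[OF G] .
  have key: "\<bar>(v \<bullet> H w - w \<bullet> H v) / 2 + (w \<bullet> H w) / 2\<bar> \<le> \<bar>w \<bullet> H w\<bar>" for v w
  proof (rule field_le_epsilon)
    fix e :: real assume e: "e > 0"
    define c where "c = norm w * (norm v + norm w) + 1"
    have c: "c > 0" by (simp add: c_def add_nonneg_pos)
    define \<epsilon> where "\<epsilon> = e / c"
    have eps: "\<epsilon> > 0" using e c by (simp add: \<epsilon>_def)
    obtain d1 where d1: "d1 > 0" "\<And>y. norm (y - p) < d1 \<Longrightarrow> norm (G y - G p - H (y - p)) \<le> \<epsilon> * norm (y - p)"
      using G eps unfolding has_derivative_at_alt by blast
    obtain d2 where d2: "d2 > 0" "ball p d2 \<subseteq> V" using V open_contains_ball by blast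
    define d where "d = min d1 d2"
    have d: "d > 0" using d1 d2 by (simp add: d_def)
    \<comment> \<open>for \<open>t < t0\<close> the segment from \<open>p + t v\<close> to \<open>p + t (v + w)\<close> stays in the ball of radius \<open>d\<close>\<close>
    define t0 where "t0 = d / (norm v + norm w + 1)"
    have t0: "t0 > 0" using d by (simp add: t0_def add_nonneg_pos)
    have bound: "\<bar>(F (p + t *\<^sub>R (v + w)) - F (p + t *\<^sub>R v)) / t\<^sup>2 - w \<bullet> H v\<bar> \<le> \<bar>w \<bullet> H w\<bar> + e"
      if t: "0 < t" "t < t0" for t
    proof -
      let ?y = "\<lambda>s. p + t *\<^sub>R (v + s *\<^sub>R w)"
      have nrm: "norm (?y s - p) \<le> t * (norm v + norm w)" if "0 \<le> s" "s \<le> 1" for s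
      proof -
        have "norm (v + s *\<^sub>R w) \<le> norm v + s * norm w" using norm_triangle_ineq[of v "s *\<^sub>R w"] that by simp
        also have "\<dots> \<le> norm v + norm w" using that by (simp add: mult_left_le_one_le)
        finally show ?thesis using t by (simp add: mult_left_mono)
      qed
      have "t * (norm v + norm w) < d"
      proof -
        have "t * (norm v + norm w) \<le> t * (norm v + norm w + 1)" using t by (intro mult_left_mono) auto
        also have "\<dots> < t0 * (norm v + norm w + 1)" using t by (intro mult_strict_right_mono) (auto simp: add_nonneg_pos)
        also have "\<dots> = d" by (simp add: t0_def add_nonneg_pos add_nonneg_eq_0_iff)
        finally show ?thesis .
      qed
      hence small: "norm (?y s - p) < d" if "0 \<le> s" "s \<le> 1" for s using nrm[OF that] by linarith
      have inV: "?y s \<in> V" if "0 \<le> s" "s \<le> 1" for s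
        using small[OF that] d2 by (auto simp: d_def ball_def dist_norm norm_minus_commute)
      have der: "((\<lambda>s. F (?y s)) has_real_derivative t * (G (?y s) \<bullet> w)) (at s)" if "0 \<le> s" "s \<le> 1" for s
      proof -
        have "((\<lambda>s. ?y s) has_derivative (\<lambda>r. r *\<^sub>R (t *\<^sub>R w))) (at s)"
          by (auto intro!: derivative_eq_intros simp: mult.commute)
        from has_derivative_compose[OF this F[OF inV[OF that]]] show ?thesis
          by (simp add: has_field_derivative_def mult_commute_abs mult.assoc)
      qed
      obtain s where s: "0 < s" "s < 1" "F (?y 1) - F (?y 0) = (1 - 0) * (t * (G (?y s) \<bullet> w))"
        using MVT2[of 0 1 "\<lambda>s. F (?y s)", OF _ der] by auto
      let ?E = "G (?y s) - H (?y s - p)"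
      have E: "norm ?E \<le> \<epsilon> * (t * (norm v + norm w))"
      proof -
        have "norm ?E \<le> \<epsilon> * norm (?y s - p)" using d1(2)[of "?y s"] small[of s] s by (simp add: G0 d_def)
        also have "\<dots> \<le> \<epsilon> * (t * (norm v + norm w))" using eps nrm[of s] s by (intro mult_left_mono) auto
        finally show ?thesis .
      qed
      have Hy: "H (?y s - p) = t *\<^sub>R (H v + s *\<^sub>R H w)" using linH by (simp add: linear_add linear_scale)
      have "(F (?y 1) - F (?y 0)) / t\<^sup>2 = (G (?y s) \<bullet> w) / t" using s t by (simp add: power2_eq_square)
      also have "G (?y s) \<bullet> w = ?E \<bullet> w + H (?y s - p) \<bullet> w" by (simp only: inner_diff_left)
      also have "H (?y s - p) \<bullet> w = t * (w \<bullet> H v + s * (w \<bullet> H w))"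
        unfolding Hy by (simp add: inner_add_right inner_commute[of _ w])
      also have "(?E \<bullet> w + t * (w \<bullet> H v + s * (w \<bullet> H w))) / t = (?E \<bullet> w) / t + (w \<bullet> H v + s * (w \<bullet> H w))" using t by (simp add: add_divide_distrib)
      finally have eq: "(F (?y 1) - F (?y 0)) / t\<^sup>2 - w \<bullet> H v = (?E \<bullet> w) / t + s * (w \<bullet> H w)" by simp
      have "\<bar>?E \<bullet> w\<bar> \<le> norm ?E * norm w" by (rule Cauchy_Schwarz_ineq2)
      also have "\<dots> \<le> \<epsilon> * (t * (norm v + norm w)) * norm w" using E by (intro mult_right_mono) auto
      finally have "\<bar>?E \<bullet> w\<bar> / t \<le> \<epsilon> * (norm w * (norm v + norm w))" using t by (simp add: field_simps)
      also have "\<dots> \<le> \<epsilon> * c" using eps by (intro mult_left_mono) (auto simp: c_def)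
      also have "\<dots> = e" using c by (simp add: \<epsilon>_def)
      finally have "\<bar>(?E \<bullet> w) / t\<bar> \<le> e" using t by simp
      moreover have "\<bar>s * (w \<bullet> H w)\<bar> \<le> \<bar>w \<bullet> H w\<bar>" using s by (simp add: abs_mult mult_left_le_one_le)
      ultimately have "\<bar>(?E \<bullet> w) / t + s * (w \<bullet> H w)\<bar> \<le> \<bar>w \<bullet> H w\<bar> + e"
        using abs_triangle_ineq[of "(?E \<bullet> w) / t" "s * (w \<bullet> H w)"] by linarith
      thus ?thesis using eq by simp
    qed
    have L1: "((\<lambda>t. (F (p + t *\<^sub>R (v + w)) - F p) / t\<^sup>2) \<longlongrightarrow> ((v + w) \<bullet> H (v + w)) / 2) (at_right 0)"
      by (rule tendsto_within_subset[OF second_order_expansion[OF V F G G0]]) auto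
    have L2: "((\<lambda>t. (F (p + t *\<^sub>R v) - F p) / t\<^sup>2) \<longlongrightarrow> (v \<bullet> H v) / 2) (at_right 0)"
      by (rule tendsto_within_subset[OF second_order_expansion[OF V F G G0]]) auto
    have "((\<lambda>t. \<bar>(F (p + t *\<^sub>R (v + w)) - F p) / t\<^sup>2 - (F (p + t *\<^sub>R v) - F p) / t\<^sup>2 - w \<bullet> H v\<bar>)
      \<longlongrightarrow> \<bar>((v + w) \<bullet> H (v + w)) / 2 - (v \<bullet> H v) / 2 - w \<bullet> H v\<bar>) (at_right 0)"
      by (intro tendsto_intros L1 L2)
    moreover have "\<forall>\<^sub>F t in at_right 0. \<bar>(F (p + t *\<^sub>R (v + w)) - F p) / t\<^sup>2 - (F (p + t *\<^sub>R v) - F p) / t\<^sup>2 - w \<bullet> H v\<bar> \<le> \<bar>w \<bullet> H w\<bar> + e"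
      using eventually_at_right_real[OF t0]
    proof eventually_elim
      case (elim t)
      have "(F (p + t *\<^sub>R (v + w)) - F p) / t\<^sup>2 - (F (p + t *\<^sub>R v) - F p) / t\<^sup>2
         = (F (p + t *\<^sub>R (v + w)) - F (p + t *\<^sub>R v)) / t\<^sup>2" by (simp add: diff_divide_distrib)
      thus ?case using bound[of t] elim by simp
    qed
    ultimately have "\<bar>((v + w) \<bullet> H (v + w)) / 2 - (v \<bullet> H v) / 2 - w \<bullet> H v\<bar> \<le> \<bar>w \<bullet> H w\<bar> + e"
      by (rule tendsto_upperbound) simp
    moreover have "((v + w) \<bullet> H (v + w)) / 2 - (v \<bullet> H v) / 2 - w \<bullet> H v = (v \<bullet> H w - w \<bullet> H v) / 2 + (w \<bullet> H w) / 2"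
      using linH by (simp add: linear_add inner_add_left inner_add_right field_simps)
    ultimately show "\<bar>(v \<bullet> H w - w \<bullet> H v) / 2 + (w \<bullet> H w) / 2\<bar> \<le> \<bar>w \<bullet> H w\<bar> + e" by simp
  qed
  \<comment> \<open>the asymmetry is linear in \<open>v\<close>, while its bound does not depend on \<open>v\<close>\<close>
  let ?x = "v \<bullet> H w - w \<bullet> H v" and ?q = "w \<bullet> H w"
  have "\<bar>r * ?x\<bar> \<le> 3 * \<bar>?q\<bar>" for r :: real
  proof -
    have "(r *\<^sub>R v) \<bullet> H w - w \<bullet> H (r *\<^sub>R v) = r * ?x" using linH by (simp add: linear_scale algebra_simps)
    thus ?thesis using key[of "r *\<^sub>R v" w] by simp
  qed
  from this[of "(3 * \<bar>?q\<bar> + 1) / ?x"] show ?thesis by (cases "?x = 0") auto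
qed

text \<open>The hypothesis \<open>grad\<close> says that \<open>sqrt F\<close> has slope at least \<open>\<kappa>\<close> wherever it is positive.  Following
the gradient flow one would reach a zero within distance \<open>sqrt (F y) / \<kappa>\<close>.  Ekeland's variational
argument replaces the flow: a minimizer \<open>z\<close> of \<open>sqrt (F z) + (\<kappa> / 2) \<parallel>z - y\<parallel>\<close> must be a zero of \<open>F\<close>,
for otherwise a step against the gradient would decrease the first term faster than the second one
can grow.  The conditions on \<open>y\<close> keep the minimizer in the interior of the ball.\<close>

lemma zero_set_within_gradient_distance:
  fixes F :: "'a::euclidean_space \<Rightarrow> real"
  assumes r: "r > 0" "\<kappa> > 0"
    and F: "\<And>y. y \<in> cball p r \<Longrightarrow> (F has_derivative (\<lambda>h. G y \<bullet> h)) (at y)"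
    and nonneg: "\<And>y. y \<in> cball p r \<Longrightarrow> F y \<ge> 0"
    and grad: "\<And>y. y \<in> cball p r \<Longrightarrow> 4 * \<kappa>\<^sup>2 * F y \<le> (norm (G y))\<^sup>2"
    and y: "norm (y - p) < r / 2" "sqrt (F y) < \<kappa> * r / 4"
  shows "\<exists>z\<in>cball p r. F z = 0 \<and> \<kappa> / 2 * norm (z - y) \<le> sqrt (F y)"
proof -
  define \<Phi> where "\<Phi> z = sqrt (F z) + \<kappa> / 2 * norm (z - y)" for z
  have contF: "continuous_on (cball p r) F"
    by (intro continuous_at_imp_continuous_on ballI) (blast intro: has_derivative_continuous F)
  have "continuous_on (cball p r) \<Phi>" unfolding \<Phi>_def by (intro continuous_intros contF)
  then obtain z where z: "z \<in> cball p r" "\<And>x. x \<in> cball p r \<Longrightarrow> \<Phi> z \<le> \<Phi> x"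
    using continuous_attains_inf[of "cball p r" \<Phi>] r by auto
  have yc: "y \<in> cball p r" using y r by (simp add: dist_norm norm_minus_commute)
  have "\<Phi> z \<le> sqrt (F y)" using z(2)[OF yc] by (simp add: \<Phi>_def)
  moreover have "sqrt (F z) \<ge> 0" using nonneg[OF z(1)] by simp
  ultimately have zy: "\<kappa> / 2 * norm (z - y) \<le> sqrt (F y)" unfolding \<Phi>_def by linarith
  hence "\<kappa> / 2 * norm (z - y) < \<kappa> / 2 * (r / 2)" using y(2) by simp
  hence "norm (z - y) < r / 2" using r by (simp add: mult_less_cancel_left)
  hence zint: "norm (z - p) < r" using y(1) norm_triangle_ineq[of "z - y" "y - p"] by simp
  have "F z = 0"
  proof (rule ccontr)
    assume "F z \<noteq> 0"
    hence Fz: "F z > 0" using nonneg[OF z(1)] by simp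
    define e where "e = G z /\<^sub>R (2 * sqrt (F z))"
    have "(2 * \<kappa> * sqrt (F z))\<^sup>2 \<le> (norm (G z))\<^sup>2" using grad[OF z(1)] Fz by (simp add: power_mult_distrib)
    hence "2 * \<kappa> * sqrt (F z) \<le> norm (G z)" by (rule power2_le_imp_le) simp
    hence ne: "norm e \<ge> \<kappa>" using Fz by (simp add: e_def field_simps)
    have "((\<lambda>t. sqrt (F (z + t *\<^sub>R (- e)))) has_real_derivative - ((norm e)\<^sup>2)) (at 0)"
    proof -
      have 1: "((\<lambda>t. z + t *\<^sub>R (- e)) has_derivative (\<lambda>s. s *\<^sub>R (- e))) (at 0)" by (auto intro!: derivative_eq_intros)
      have "(F has_derivative (\<lambda>h. G z \<bullet> h)) (at (z + 0 *\<^sub>R (- e)))" using F[OF z(1)] by simp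
      from has_derivative_compose[OF 1 this]
      have 2: "((\<lambda>t. F (z + t *\<^sub>R (- e))) has_real_derivative - (G z \<bullet> e)) (at 0)"
        unfolding has_field_derivative_def by (rule has_derivative_eq_rhs) (auto simp: fun_eq_iff)
      have "((\<lambda>t. sqrt (F (z + t *\<^sub>R (- e)))) has_real_derivative (inverse (sqrt (F z)) / 2) * (- (G z \<bullet> e))) (at 0)"
        by (rule DERIV_chain2[OF _ 2]) (use DERIV_real_sqrt[OF Fz] in simp)
      moreover have "(inverse (sqrt (F z)) / 2) * (- (G z \<bullet> e)) = - ((norm e)\<^sup>2)"
        using Fz unfolding power2_norm_eq_inner by (simp add: e_def inverse_eq_divide)
      ultimately show ?thesis by simp
    qed
    moreover have "((\<lambda>t. \<kappa> / 2 * norm e * t) has_real_derivative \<kappa> / 2 * norm e) (at 0)"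
      by (auto intro!: derivative_eq_intros)
    ultimately have "((\<lambda>t. sqrt (F (z + t *\<^sub>R (- e))) + \<kappa> / 2 * norm e * t) has_real_derivative
        - ((norm e)\<^sup>2) + \<kappa> / 2 * norm e) (at 0)" by (rule DERIV_add)
    moreover have "- ((norm e)\<^sup>2) + \<kappa> / 2 * norm e < 0"
    proof -
      have pos: "norm e > 0" using ne r by linarith
      hence "\<kappa> * norm e \<le> norm e * norm e" using ne by (intro mult_right_mono) auto
      moreover have "\<kappa> * norm e > 0" using r pos by simp
      ultimately show ?thesis by (simp add: power2_eq_square)
    qed
    ultimately have "\<exists>d>0. \<forall>h>0. h < d \<longrightarrow>
        sqrt (F (z + (0 + h) *\<^sub>R (- e))) + \<kappa> / 2 * norm e * (0 + h) < sqrt (F (z + 0 *\<^sub>R (- e))) + \<kappa> / 2 * norm e * 0"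
      by (rule DERIV_neg_dec_right)
    then obtain d where d: "d > 0" "\<And>h. 0 < h \<Longrightarrow> h < d \<Longrightarrow>
        sqrt (F (z + h *\<^sub>R (- e))) + \<kappa> / 2 * norm e * h < sqrt (F z)" by auto
    define h where "h = min (d / 2) ((r - norm (z - p)) / (norm e + 1))"
    have h: "h > 0" "h < d" using d(1) zint by (auto simp: h_def min_less_iff_disj add_nonneg_pos)
    have "h * norm e \<le> h * (norm e + 1)" using h by (intro mult_left_mono) auto
    also have "\<dots> \<le> (r - norm (z - p)) / (norm e + 1) * (norm e + 1)"
      by (intro mult_right_mono) (auto simp: h_def)
    also have "\<dots> = r - norm (z - p)" by (simp add: add_nonneg_eq_0_iff)
    finally have hr: "h * norm e \<le> r - norm (z - p)" .
    have "norm (z + h *\<^sub>R (- e) - p) \<le> norm (z - p) + h * norm e"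
      using norm_triangle_ineq[of "z - p" "h *\<^sub>R (- e)"] h by (simp add: algebra_simps)
    hence "z + h *\<^sub>R (- e) \<in> cball p r" using hr by (simp add: dist_norm norm_minus_commute)
    from z(2)[OF this] have "\<Phi> z \<le> \<Phi> (z + h *\<^sub>R (- e))" .
    moreover have "norm (z + h *\<^sub>R (- e) - y) \<le> norm (z - y) + h * norm e"
      using norm_triangle_ineq[of "z - y" "h *\<^sub>R (- e)"] h by (simp add: algebra_simps)
    hence "\<kappa> / 2 * norm (z + h *\<^sub>R (- e) - y) \<le> \<kappa> / 2 * (norm (z - y) + h * norm e)"
      using r by (intro mult_left_mono) auto
    ultimately have "sqrt (F z) \<le> sqrt (F (z + h *\<^sub>R (- e))) + \<kappa> / 2 * norm e * h"
      by (simp add: \<Phi>_def algebra_simps)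
    with d(2)[OF h] show False by simp
  qed
  with z(1) zy show ?thesis by blast
qed

text \<open>If \<open>v \<bullet> H v = 0\<close>, then \<open>sqrt (F (p + t v)) = o(t)\<close>, so there are zeros of \<open>F\<close> at distance \<open>o(t)\<close> from
\<open>p + t v\<close>.  The function \<open>\<Psi>\<close>, a defining function of the zero set, vanishes at these points, hence its
derivative vanishes along \<open>v\<close>.\<close>

lemma hessian_null_direction_is_tangent:
  fixes F :: "'a::euclidean_space \<Rightarrow> real"
  assumes r: "r > 0" "\<kappa> > 0"
    and F: "\<And>y. y \<in> cball p r \<Longrightarrow> (F has_derivative (\<lambda>h. G y \<bullet> h)) (at y)"
    and G: "(G has_derivative H) (at p)" and G0: "G p = 0" and F0: "F p = 0"
    and nonneg: "\<And>y. y \<in> cball p r \<Longrightarrow> F y \<ge> 0"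
    and grad: "\<And>y. y \<in> cball p r \<Longrightarrow> 4 * \<kappa>\<^sup>2 * F y \<le> (norm (G y))\<^sup>2"
    and null: "v \<bullet> H v = 0"
    and \<Psi>: "(\<Psi> has_derivative \<Psi>') (at p)" and \<Psi>0: "\<And>z. z \<in> cball p r \<Longrightarrow> F z = 0 \<Longrightarrow> \<Psi> z = (0::real)"
  shows "\<Psi>' v = 0"
proof -
  have bl: "bounded_linear \<Psi>'" using \<Psi> by (rule has_derivative_bounded_linear)
  obtain B where B: "B > 0" "\<And>x. \<bar>\<Psi>' x\<bar> \<le> norm x * B"
    using bounded_linear.pos_bounded[OF bl] by auto
  have "\<bar>\<Psi>' v\<bar> \<le> 0"
  proof (rule field_le_epsilon)
    fix e0 :: real assume e0: "e0 > 0"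
    define e where "e = min 1 (e0 / (norm v + 1 + B))"
    have e: "e > 0" "e \<le> 1" using e0 B by (auto simp: e_def add_nonneg_pos)
    have ee: "e * (norm v + 1 + B) \<le> e0"
    proof -
      have p: "norm v + 1 + B > 0" using B by (simp add: add_nonneg_pos)
      have "e * (norm v + 1 + B) \<le> e0 / (norm v + 1 + B) * (norm v + 1 + B)"
        using p by (intro mult_right_mono) (auto simp: e_def)
      thus ?thesis using p by simp
    qed
    obtain d1 where d1: "d1 > 0" "\<And>y. norm (y - p) < d1 \<Longrightarrow> norm (\<Psi> y - \<Psi> p - \<Psi>' (y - p)) \<le> e * norm (y - p)"
      using \<Psi> e unfolding has_derivative_at_alt by blast
    have p: "p \<in> cball p r" using r by simp
    have lin: "((\<lambda>t. p + t *\<^sub>R v) \<longlongrightarrow> p) (at_right 0)" by (auto intro!: tendsto_eq_intros)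
    have ev1: "\<forall>\<^sub>F t in at_right 0. norm (p + t *\<^sub>R v - p) < r / 2"
      using tendstoD[OF lin, of "r / 2"] r by (simp add: dist_norm)
    have "isCont F p" using F[OF p] by (rule has_derivative_continuous)
    hence "((\<lambda>t. sqrt (F (p + t *\<^sub>R v))) \<longlongrightarrow> sqrt (F p)) (at_right 0)"
      by (intro tendsto_real_sqrt isCont_tendsto_compose[OF _ lin])
    hence ev2: "\<forall>\<^sub>F t in at_right 0. sqrt (F (p + t *\<^sub>R v)) < \<kappa> * r / 4"
      using r by (intro order_tendstoD(2)) (auto simp: F0)
    have "((\<lambda>t. (F (p + t *\<^sub>R v) - F p) / t\<^sup>2) \<longlongrightarrow> (v \<bullet> H v) / 2) (at 0)"
      using r by (intro second_order_expansion[of "ball p r" p F G] G G0) (auto intro!: F)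
    hence "((\<lambda>t. (F (p + t *\<^sub>R v) - F p) / t\<^sup>2) \<longlongrightarrow> (v \<bullet> H v) / 2) (at_right 0)"
      by (rule tendsto_within_subset) auto
    hence ev3: "\<forall>\<^sub>F t in at_right 0. F (p + t *\<^sub>R v) / t\<^sup>2 < (e * \<kappa> / 2)\<^sup>2"
      using e r null by (intro order_tendstoD(2)) (auto simp: F0)
    have "d1 / (norm v + 1) > 0" using d1 by (simp add: add_nonneg_pos)
    from eventually_at_right_real[OF this]
    have ev4: "\<forall>\<^sub>F t in at_right 0. t \<in> {0<..<d1 / (norm v + 1)}" .
    have "\<forall>\<^sub>F t in at_right 0. norm (p + t *\<^sub>R v - p) < r / 2 \<and> sqrt (F (p + t *\<^sub>R v)) < \<kappa> * r / 4 \<and>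
        F (p + t *\<^sub>R v) / t\<^sup>2 < (e * \<kappa> / 2)\<^sup>2 \<and> t \<in> {0<..<d1 / (norm v + 1)}"
      using ev1 ev2 ev3 ev4 by eventually_elim auto
    then obtain t where t: "norm (p + t *\<^sub>R v - p) < r / 2" "sqrt (F (p + t *\<^sub>R v)) < \<kappa> * r / 4"
        "F (p + t *\<^sub>R v) / t\<^sup>2 < (e * \<kappa> / 2)\<^sup>2" "0 < t" "t < d1 / (norm v + 1)"
      using eventually_happens'[OF trivial_limit_at_right_real] by force
    obtain z where z: "z \<in> cball p r" "F z = 0" "\<kappa> / 2 * norm (z - (p + t *\<^sub>R v)) \<le> sqrt (F (p + t *\<^sub>R v))"
      using zero_set_within_gradient_distance[OF r F nonneg grad t(1,2)] by blast
    have "F (p + t *\<^sub>R v) < (e * \<kappa> / 2)\<^sup>2 * t\<^sup>2" using t(3,4) by (simp add: divide_less_eq)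
    also have "\<dots> = (e * \<kappa> / 2 * t)\<^sup>2" by (simp only: power_mult_distrib)
    finally have "sqrt (F (p + t *\<^sub>R v)) < e * \<kappa> / 2 * t"
      using e r t by (intro real_less_lsqrt) auto
    hence "\<kappa> / 2 * norm (z - (p + t *\<^sub>R v)) \<le> \<kappa> / 2 * (e * t)" using z(3) by (simp add: mult_ac)
    hence dz: "norm (z - p - t *\<^sub>R v) \<le> e * t" using r by (simp add: mult_le_cancel_left algebra_simps)
    have nz: "norm (z - p) \<le> t * (norm v + 1)"
    proof -
      have "norm (z - p) \<le> norm (z - p - t *\<^sub>R v) + norm (t *\<^sub>R v)" using norm_triangle_ineq[of "z - p - t *\<^sub>R v" "t *\<^sub>R v"] by simp
      also have "\<dots> \<le> 1 * t + t * norm v" using order.trans[OF dz mult_right_mono[of e 1 t]] e t by (intro add_mono) auto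
      finally show ?thesis by (simp add: algebra_simps)
    qed
    also have "\<dots> < d1" using t by (simp add: pos_less_divide_eq add_nonneg_pos)
    finally have "norm (\<Psi> z - \<Psi> p - \<Psi>' (z - p)) \<le> e * norm (z - p)" by (rule d1(2))
    hence 1: "\<bar>\<Psi>' (z - p)\<bar> \<le> e * (t * (norm v + 1))"
      using \<Psi>0[OF z(1,2)] \<Psi>0[OF p F0] e order.trans[OF _ mult_left_mono[OF nz, of e]] by simp
    have 2: "\<bar>\<Psi>' (z - p - t *\<^sub>R v)\<bar> \<le> e * t * B"
      by (rule order.trans[OF B(2) mult_right_mono[OF dz]]) (use B in simp)
    have "\<Psi>' (z - p - t *\<^sub>R v) = \<Psi>' (z - p) - t * \<Psi>' v"
      using bl by (simp add: bounded_linear.linear linear_diff linear_scale)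
    hence "\<bar>t * \<Psi>' v\<bar> \<le> e * (t * (norm v + 1)) + e * t * B" using 1 2 by linarith
    also have "\<dots> = t * (e * (norm v + 1 + B))" by (simp add: algebra_simps)
    finally have "t * \<bar>\<Psi>' v\<bar> \<le> t * (e * (norm v + 1 + B))" using t by (simp add: abs_mult)
    hence "\<bar>\<Psi>' v\<bar> \<le> e * (norm v + 1 + B)" using t by (simp add: mult_le_cancel_left)
    thus "\<bar>\<Psi>' v\<bar> \<le> 0 + e0" using ee by simp
  qed
  thus ?thesis by simp
qed

lemma has_derivative_vecI:
  fixes f :: "'a::euclidean_space \<Rightarrow> real^'n"
  assumes "\<And>i. ((\<lambda>x. f x $ i) has_derivative (\<lambda>h. f' h $ i)) (at p)"
  shows "(f has_derivative f') (at p)"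
  unfolding has_derivative_componentwise_within[of f]
  using assms by (auto simp: Basis_vec_def inner_axis)

lemma bounded_bilinear_matrix_vector_mult:
  "bounded_bilinear ((*v) :: real^'n^'m \<Rightarrow> real^'n \<Rightarrow> real^'m)"
proof -
  have "bilinear ((*v) :: real^'n^'m \<Rightarrow> real^'n \<Rightarrow> real^'m)"
    unfolding bilinear_def
    by (auto intro!: linearI simp: matrix_vector_right_distrib matrix_vector_mult_scaleR
        matrix_vector_mult_add_rdistrib scaleR_matrix_vector_assoc)
  thus ?thesis by (simp add: bilinear_conv_bounded_bilinear)
qed

text \<open>The second order terms at \<open>p\<close> of the two sides of the eikonal equation \<open>G \<bullet> B G = b(F)\<close>.\<close>

lemma hessian_gradient_identity:
  fixes F :: "real^'n \<Rightarrow> real" and B :: "real^'n \<Rightarrow> real^'n^'n" and H :: "real^'n^'n"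
  assumes V: "open V" "p \<in> V"
    and F: "\<And>y. y \<in> V \<Longrightarrow> (F has_derivative (\<lambda>h. G y \<bullet> h)) (at y)"
    and G: "(G has_derivative ((*v) H)) (at p)" and G0: "G p = 0" and F0: "F p = 0"
    and eik: "\<And>y. y \<in> V \<Longrightarrow> G y \<bullet> (B y *v G y) = b (F y)"
    and b: "b 0 = 0" "(b has_real_derivative \<beta>) (at 0)"
    and B: "isCont B p"
  shows "(H *v v) \<bullet> (B p *v (H *v v)) = \<beta> / 2 * (v \<bullet> (H *v v))"
proof -
  obtain c where c: "\<And>z. b z = c z * z" "isCont c 0" "c 0 = \<beta>"
    using b CARAT_DERIV[of b \<beta> 0] by auto
  have lin: "((\<lambda>t. p + t *\<^sub>R v) \<longlongrightarrow> p) (at 0)" by (auto intro!: tendsto_eq_intros)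
  have "isCont F p" using F[OF V(2)] by (rule has_derivative_continuous)
  from isCont_tendsto_compose[OF this lin]
  have "((\<lambda>t. c (F (p + t *\<^sub>R v))) \<longlongrightarrow> \<beta>) (at 0)"
    using isCont_tendsto_compose[OF c(2), of "\<lambda>t. F (p + t *\<^sub>R v)"] by (simp add: F0 c(3))
  from tendsto_mult[OF this second_order_expansion[OF V F G G0]]
  have 1: "((\<lambda>t. c (F (p + t *\<^sub>R v)) * ((F (p + t *\<^sub>R v) - F p) / t\<^sup>2)) \<longlongrightarrow> \<beta> * ((v \<bullet> (H *v v)) / 2)) (at 0)" .
  have dG: "((\<lambda>t. G (p + t *\<^sub>R v) /\<^sub>R t) \<longlongrightarrow> H *v v) (at 0)"
  proof -
    have 1: "((\<lambda>t. p + t *\<^sub>R v) has_derivative (\<lambda>s. s *\<^sub>R v)) (at 0)" by (auto intro!: derivative_eq_intros)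
    have "(G has_derivative ((*v) H)) (at (p + 0 *\<^sub>R v))" using G by simp
    from has_derivative_compose[OF 1 this]
    have "((\<lambda>t. G (p + t *\<^sub>R v)) has_derivative (\<lambda>s. s *\<^sub>R (H *v v))) (at 0)"
      by (simp add: matrix_vector_mult_scaleR)
    hence "((\<lambda>t. norm (G (p + t *\<^sub>R v) - t *\<^sub>R (H *v v)) / norm t) \<longlongrightarrow> 0) (at 0)"
      by (simp add: has_derivative_at G0)
    moreover have "\<forall>\<^sub>F t in at 0. norm (G (p + t *\<^sub>R v) - t *\<^sub>R (H *v v)) / norm t
        = norm (G (p + t *\<^sub>R v) /\<^sub>R t - H *v v)"
      unfolding eventually_at_filter
    proof (intro always_eventually allI impI)
      fix t :: real assume t: "t \<noteq> 0"
      have "G (p + t *\<^sub>R v) /\<^sub>R t - H *v v = (G (p + t *\<^sub>R v) - t *\<^sub>R (H *v v)) /\<^sub>R t"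
        using t by (simp add: scaleR_diff_right)
      thus "norm (G (p + t *\<^sub>R v) - t *\<^sub>R (H *v v)) / norm t = norm (G (p + t *\<^sub>R v) /\<^sub>R t - H *v v)"
        by (simp add: divide_inverse)
    qed
    ultimately have "((\<lambda>t. norm (G (p + t *\<^sub>R v) /\<^sub>R t - H *v v)) \<longlongrightarrow> 0) (at 0)"
      by (rule Lim_transform_eventually)
    thus ?thesis by (rule Lim_null[THEN iffD2, OF tendsto_norm_zero_cancel])
  qed
  have dB: "((\<lambda>t. B (p + t *\<^sub>R v)) \<longlongrightarrow> B p) (at 0)" by (rule isCont_tendsto_compose[OF B lin])
  have 2: "((\<lambda>t. (G (p + t *\<^sub>R v) /\<^sub>R t) \<bullet> (B (p + t *\<^sub>R v) *v (G (p + t *\<^sub>R v) /\<^sub>R t)))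
      \<longlongrightarrow> (H *v v) \<bullet> (B p *v (H *v v))) (at 0)"
    by (intro tendsto_inner dG bounded_bilinear.tendsto[OF bounded_bilinear_matrix_vector_mult] dB)
  have "\<forall>\<^sub>F t in at 0. (G (p + t *\<^sub>R v) /\<^sub>R t) \<bullet> (B (p + t *\<^sub>R v) *v (G (p + t *\<^sub>R v) /\<^sub>R t))
      = c (F (p + t *\<^sub>R v)) * ((F (p + t *\<^sub>R v) - F p) / t\<^sup>2)"
    using topological_tendstoD[OF lin V]
  proof eventually_elim
    case (elim t)
    have "(G (p + t *\<^sub>R v) /\<^sub>R t) \<bullet> (B (p + t *\<^sub>R v) *v (G (p + t *\<^sub>R v) /\<^sub>R t))
       = (G (p + t *\<^sub>R v) \<bullet> (B (p + t *\<^sub>R v) *v G (p + t *\<^sub>R v))) / t\<^sup>2"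
      by (simp add: matrix_vector_mult_scaleR power2_eq_square divide_inverse)
    also have "\<dots> = c (F (p + t *\<^sub>R v)) * (F (p + t *\<^sub>R v)) / t\<^sup>2"
      by (subst eik[OF elim]) (simp add: c(1))
    finally show ?case by (simp add: F0)
  qed
  from tendsto_cong[THEN iffD1, OF this 2] 1 show ?thesis
    using tendsto_unique[OF _ _ 1] by (metis (no_types, lifting) mult.commute times_divide_eq_right trivial_limit_at)
qed

text \<open>The Euclidean form of the eikonal equation: \<open>b(F)\<close> is comparable to \<open>F\<close> near \<open>0\<close>, and \<open>B\<close> is bounded
near \<open>p\<close>.\<close>

lemma gradient_growth_near_zero_set:
  fixes F :: "real^'n \<Rightarrow> real" and B :: "real^'n \<Rightarrow> real^'n^'n"
  assumes V: "open V" "p \<in> V"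
    and contF: "isCont F p" and F0: "F p = 0" and nonneg: "\<And>y. y \<in> V \<Longrightarrow> F y \<ge> 0"
    and eik: "\<And>y. y \<in> V \<Longrightarrow> G y \<bullet> (B y *v G y) = b (F y)"
    and b: "b 0 = 0" "(b has_real_derivative \<beta>) (at 0)" "\<beta> > 0"
    and B: "isCont B p"
  obtains r \<kappa> where "r > 0" "\<kappa> > 0" "cball p r \<subseteq> V"
    "\<And>y. y \<in> cball p r \<Longrightarrow> 4 * \<kappa>\<^sup>2 * F y \<le> (norm (G y))\<^sup>2"
proof -
  obtain K where K: "K > 0" "\<And>A x. norm (A *v x :: real^'n) \<le> norm A * norm (x::real^'n) * K"
    using bounded_bilinear.pos_bounded[OF bounded_bilinear_matrix_vector_mult] by blast
  define C where "C = (norm (B p) + 1) * K"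
  have C: "C > 0" using K by (simp add: C_def add_nonneg_pos)
  obtain c where c: "\<And>z. b z = c z * z" "isCont c 0" "c 0 = \<beta>"
    using b CARAT_DERIV[of b \<beta> 0] by auto
  have idp: "((\<lambda>y. y) \<longlongrightarrow> p) (nhds p)" by (simp add: filterlim_def)
  have "\<forall>\<^sub>F z in nhds 0. c z > \<beta> / 2"
    using c b by (intro order_tendstoD(1)[of _ \<beta>]) (auto simp: isCont_def tendsto_at_iff_tendsto_nhds)
  moreover have "filterlim F (nhds 0) (nhds p)" using contF F0 tendsto_at_iff_tendsto_nhds[of F p] by (simp add: isCont_def)
  ultimately have e1: "\<forall>\<^sub>F y in nhds p. c (F y) > \<beta> / 2" by (rule eventually_compose_filterlim)
  have "((\<lambda>y. norm (B y)) \<longlongrightarrow> norm (B p)) (nhds p)"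
    using B by (intro tendsto_norm) (simp add: isCont_def tendsto_at_iff_tendsto_nhds)
  hence e2: "\<forall>\<^sub>F y in nhds p. norm (B y) < norm (B p) + 1" by (rule order_tendstoD(2)) simp
  have e3: "\<forall>\<^sub>F y in nhds p. y \<in> V" using V by (rule eventually_nhds_in_open)
  have "\<forall>\<^sub>F y in nhds p. c (F y) > \<beta> / 2 \<and> norm (B y) < norm (B p) + 1 \<and> y \<in> V"
    using e1 e2 e3 by eventually_elim auto
  then obtain r where r: "r > 0" "\<And>y. dist y p < r \<Longrightarrow> c (F y) > \<beta> / 2 \<and> norm (B y) < norm (B p) + 1 \<and> y \<in> V"
    unfolding eventually_nhds_metric by blast
  \<comment> \<open>that is, \<open>4 \<kappa>\<^sup>2\<close> is the ratio of the lower bound \<open>\<beta> / 2\<close> for \<open>b(F) / F\<close> and the upper bound \<open>C\<close> for \<open>B\<close>\<close>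
  define \<kappa> where "\<kappa> = sqrt (\<beta> / (8 * C))"
  have kap: "\<kappa> > 0" "4 * \<kappa>\<^sup>2 = (\<beta> / 2) / C" using b C by (simp_all add: \<kappa>_def)
  show ?thesis
  proof
    show "r / 2 > 0" "\<kappa> > 0" using r kap by auto
    have *: "dist y p < r" if "y \<in> cball p (r / 2)" for y
      using that r(1) by (simp add: dist_commute)
    show "cball p (r / 2) \<subseteq> V" using r(2)[OF *] by blast
    fix y assume y: "y \<in> cball p (r / 2)"
    note ry = r(2)[OF *[OF y]]
    have "(\<beta> / 2) * F y \<le> c (F y) * F y" using ry nonneg by (intro mult_right_mono) auto
    also have "\<dots> = G y \<bullet> (B y *v G y)" using eik[of y] ry c(1) by simp
    also have "\<dots> \<le> norm (G y) * norm (B y *v G y)" by (rule norm_cauchy_schwarz)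
    also have "\<dots> \<le> norm (G y) * (norm (B y) * norm (G y) * K)" by (intro mult_left_mono K) auto
    also have "\<dots> = (norm (B y) * K) * (norm (G y))\<^sup>2" by (simp add: power2_eq_square)
    also have "\<dots> \<le> C * (norm (G y))\<^sup>2" unfolding C_def using ry K by (intro mult_right_mono) auto
    finally have "(\<beta> / 2) * F y / C \<le> (norm (G y))\<^sup>2" using C by (simp add: pos_divide_le_eq mult.commute)
    thus "4 * \<kappa>\<^sup>2 * F y \<le> (norm (G y))\<^sup>2" by (simp add: kap(2))
  qed
qed

text \<open>By \<open>hessian_gradient_identity\<close> the matrix \<open>(2 / \<beta>) B H\<close> is idempotent.  A vector in its kernel is a null
vector of \<open>H\<close>, hence tangent to the zero set, which in the coordinates \<open>T\<close> satisfies the equations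
\<open>y $ i = 0\<close> for \<open>i \<in> I\<close>.  So the trace, which is the rank, is at least the number of equations.\<close>

lemma trace_hessian_ge_codimension:
  fixes F :: "real^'n \<Rightarrow> real" and B :: "real^'n \<Rightarrow> real^'n^'n" and H D :: "real^'n^'n"
  assumes V: "open V" "p \<in> V"
    and F: "\<And>y. y \<in> V \<Longrightarrow> (F has_derivative (\<lambda>h. G y \<bullet> h)) (at y)"
    and G: "(G has_derivative ((*v) H)) (at p)" and G0: "G p = 0" and F0: "F p = 0"
    and nonneg: "\<And>y. y \<in> V \<Longrightarrow> F y \<ge> 0"
    and eik: "\<And>y. y \<in> V \<Longrightarrow> G y \<bullet> (B y *v G y) = b (F y)"
    and b: "b 0 = 0" "(b has_real_derivative \<beta>) (at 0)" "\<beta> > 0"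
    and B: "isCont B p" and Bsym: "transpose (B p) = B p"
    and Bpos: "\<And>v. v \<noteq> 0 \<Longrightarrow> v \<bullet> (B p *v v) > 0"
    and T: "(T has_derivative ((*v) D)) (at p)" "det D \<noteq> 0"
    and T0: "\<And>z i. z \<in> V \<Longrightarrow> F z = 0 \<Longrightarrow> i \<in> I \<Longrightarrow> T z $ i = (0::real)"
  shows "\<beta> / 2 * real (card I) \<le> trace (B p ** H)"
proof -
  note hg = hessian_gradient_identity[OF V F G G0 F0 eik b(1,2) B]
  have Hsym: "transpose H = H"
  proof -
    have "transpose H *v w = H *v w" for w
    proof (rule vector_eq_ldot[THEN iffD1, rule_format])
      fix v
      have "v \<bullet> (transpose H *v w) = w \<bullet> (H *v v)"
        by (metis dot_lmul_matrix inner_commute transpose_matrix_vector)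
      also have "\<dots> = v \<bullet> (H *v w)" using hessian_symmetric[OF V F G G0] by simp
      finally show "v \<bullet> (transpose H *v w) = v \<bullet> (H *v w)" .
    qed
    thus ?thesis by (simp add: matrix_eq)
  qed
  have HBH: "H ** (B p ** H) = (\<beta> / 2) *\<^sub>R H"
  proof (rule quadratic_form_determines_matrix)
    show "transpose (H ** (B p ** H)) = H ** (B p ** H)"
      by (simp add: matrix_transpose_mul Hsym Bsym matrix_mul_assoc)
    show "transpose ((\<beta> / 2) *\<^sub>R H) = (\<beta> / 2) *\<^sub>R H" using Hsym by (simp add: transpose_def vec_eq_iff)
    fix v
    have "v \<bullet> (H *v w) = (H *v v) \<bullet> w" for w
      by (metis Hsym dot_lmul_matrix transpose_matrix_vector)
    thus "v \<bullet> (H ** (B p ** H) *v v) = v \<bullet> ((\<beta> / 2) *\<^sub>R H *v v)"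
      using hg[of v] by (simp add: matrix_vector_mul_assoc[symmetric] scaleR_matrix_vector_assoc[symmetric])
  qed
  have scale: "(k *\<^sub>R X) ** Y = k *\<^sub>R (X ** Y)" "X ** (k *\<^sub>R Y) = k *\<^sub>R (X ** Y)"
    for k and X Y :: "real^'n^'n"
    by (simp_all add: vec_eq_iff matrix_matrix_mult_def sum_distrib_left mult_ac)
  define P where "P = (2 / \<beta>) *\<^sub>R (B p ** H)"
  have "P ** P = (2 / \<beta> * (2 / \<beta>)) *\<^sub>R (B p ** (H ** (B p ** H)))"
    by (simp add: P_def scale matrix_mul_assoc)
  also have "\<dots> = P" using b(3)
    by (simp add: HBH P_def scale)
  finally have PP: "P ** P = P" .
  obtain r \<kappa> where r: "r > 0" "\<kappa> > 0" "cball p r \<subseteq> V"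
    "\<And>y. y \<in> cball p r \<Longrightarrow> 4 * \<kappa>\<^sup>2 * F y \<le> (norm (G y))\<^sup>2"
    using gradient_growth_near_zero_set[OF V has_derivative_continuous[OF F[OF V(2)]] F0 nonneg eik b B] by blast
  have "real (card I) \<le> trace P"
  proof (rule trace_idempotent_ge[OF PP T(2)])
    fix v i assume v: "P *v v = 0" and i: "i \<in> I"
    have "B p *v (H *v v) = 0"
      using v b(3) by (simp add: P_def scaleR_matrix_vector_assoc[symmetric] matrix_vector_mul_assoc)
    hence "H *v v = 0" using Bpos[of "H *v v"] by auto
    hence null: "v \<bullet> (H *v v) = 0" by simp
    have d: "((\<lambda>z. T z $ i) has_derivative (\<lambda>h. (D *v h) $ i)) (at p)"
      using bounded_linear.has_derivative[OF bounded_linear_vec_nth T(1)] .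
    show "(D *v v) $ i = 0"
      by (rule hessian_null_direction_is_tangent[OF r(1,2) F G G0 F0 nonneg r(4) null d T0])
         (use r(3) i in auto)
  qed
  also have "trace P = 2 / \<beta> * trace (B p ** H)"
    by (simp add: P_def trace_def sum_distrib_left)
  finally show ?thesis using b(3) by (simp add: field_simps)
qed

section \<open>Charts and the metric\<close>

definition grad_vec :: "(real^'n \<Rightarrow> real) \<Rightarrow> real^'n \<Rightarrow> real^'n::finite" where
  "grad_vec F y = (\<chi> i. partial_deriv i F y)"

lemma grad_vec_has_derivative:
  assumes "F differentiable (at y)"
  shows "(F has_derivative (\<lambda>h. grad_vec F y \<bullet> h)) (at y)"
proof -
  let ?F' = "frechet_derivative F (at y)"
  have d: "(F has_derivative ?F') (at y)" using assms by (simp add: frechet_derivative_works)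
  have "?F' h = grad_vec F y \<bullet> h" for h
  proof -
    have "?F' h = ?F' (\<Sum>i\<in>UNIV. h $ i *\<^sub>R axis i 1)"
      using basis_expansion[of h] by (simp add: scalar_mult_eq_scaleR)
    also have "\<dots> = (\<Sum>i\<in>UNIV. h $ i *\<^sub>R ?F' (axis i 1))"
      using has_derivative_linear[OF d] by (simp add: linear_sum linear_scale)
    also have "\<dots> = grad_vec F y \<bullet> h" by (simp add: grad_vec_def partial_deriv_def inner_vec_def mult.commute)
    finally show ?thesis .
  qed
  hence "?F' = (\<lambda>h. grad_vec F y \<bullet> h)" by auto
  with d show ?thesis by simp
qed

lemma grad_vec_unique:
  assumes "(F has_derivative (\<lambda>h. w \<bullet> h)) (at y)"
  shows "grad_vec F y = w"
  using frechet_derivative_at[OF assms, symmetric]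
  by (simp add: grad_vec_def partial_deriv_def vec_eq_iff inner_axis)

lemma Ck_on_2_gradient:
  assumes "Ck_on 2 F S" "y \<in> S"
  shows "F differentiable (at y)" "(F has_derivative (\<lambda>h. grad_vec F y \<bullet> h)) (at y)"
    "\<exists>H. (grad_vec F has_derivative ((*v) H)) (at y)"
proof -
  have C: "Ck_on (Suc (Suc 0)) F S" using assms by (simp add: numeral_2_eq_2)
  show d: "F differentiable (at y)" using C assms(2) by auto
  show "(F has_derivative (\<lambda>h. grad_vec F y \<bullet> h)) (at y)" by (rule grad_vec_has_derivative[OF d])
  have "\<forall>v. (\<lambda>y. frechet_derivative F (at y) v) differentiable (at y)" using C assms(2) by auto
  then obtain D where D: "\<And>v. ((\<lambda>y. frechet_derivative F (at y) v) has_derivative D v) (at y)"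
    unfolding differentiable_def by metis
  let ?D = "\<lambda>h. (\<chi> i. D (axis i 1) h) :: real^'a"
  have "(grad_vec F has_derivative ?D) (at y)"
    by (rule has_derivative_vecI) (simp add: grad_vec_def partial_deriv_def D)
  moreover from this have "linear ?D" by (rule has_derivative_linear)
  hence "?D = (*v) (matrix ?D)" by (simp add: matrix_works fun_eq_iff)
  ultimately show "\<exists>H. (grad_vec F has_derivative ((*v) H)) (at y)" by metis
qed

lemma Ck_on_2_continuous:
  assumes "Ck_on 2 F S" shows "continuous_on S F"
  using assms
  by (auto simp: numeral_2_eq_2 intro!: continuous_at_imp_continuous_on differentiable_imp_continuous_within)

lemma differentiable_det:
  fixes M :: "'a::euclidean_space \<Rightarrow> real^'n^'n"
  assumes "\<And>i j. (\<lambda>z. M z $ i $ j) differentiable (at y)"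
  shows "(\<lambda>z. det (M z)) differentiable (at y)"
proof -
  obtain D where D: "\<And>i j. ((\<lambda>z. M z $ i $ j) has_derivative D i j) (at y)"
    using assms unfolding differentiable_def by metis
  show ?thesis unfolding det_def differentiable_def
    by (rule exI, rule has_derivative_sum, rule has_derivative_mult[OF has_derivative_const],
        rule has_derivative_prod, rule D)
qed

lemma differentiable_real_sqrt:
  fixes f :: "'a::real_normed_vector \<Rightarrow> real"
  assumes "f differentiable (at y)" "f y \<noteq> 0"
  shows "(\<lambda>z. sqrt (f z)) differentiable (at y)"
proof -
  have d: "(sqrt has_real_derivative
      (if f y > 0 then inverse (sqrt (f y)) / 2 else - inverse (sqrt (f y)) / 2)) (at (f y))"
    by (rule DERIV_real_sqrt_generic[OF assms(2)]) auto
  obtain f' where "(f has_derivative f') (at y)" using assms(1) by (auto simp: differentiable_def)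
  from has_derivative_compose[OF this d[unfolded has_field_derivative_def]]
  show ?thesis by (auto simp: differentiable_def)
qed

lemma differentiable_matrix_inv_entry:
  fixes M :: "'a::euclidean_space \<Rightarrow> real^'n^'n"
  assumes U: "open U" "y \<in> U" "\<And>z. z \<in> U \<Longrightarrow> det (M z) \<noteq> 0"
    and M: "\<And>i j. (\<lambda>z. M z $ i $ j) differentiable (at y)"
  shows "(\<lambda>z. matrix_inv (M z) $ i $ k) differentiable (at y)"
proof -
  let ?N = "\<lambda>z. \<chi> r c. if c = i then axis k 1 $ r else M z $ r $ c"
  have "(\<lambda>z. det (?N z) / det (M z)) differentiable (at y)"
  proof (rule differentiable_divide[OF differentiable_det differentiable_det[OF M]])
    show "(\<lambda>z. ?N z $ r $ c) differentiable (at y)" for r c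
      by (cases "c = i") (simp_all add: M)
    show "det (M y) \<noteq> 0" using U by auto
  qed
  then obtain D where "((\<lambda>z. det (?N z) / det (M z)) has_derivative D) (at y)"
    by (auto simp: differentiable_def)
  hence "((\<lambda>z. matrix_inv (M z) $ i $ k) has_derivative D) (at y)"
    by (rule has_derivative_transform_within_open[OF _ U(1,2)]) (simp add: matrix_inv_entry U(3))
  thus ?thesis by (auto simp: differentiable_def)
qed

lemma isCont_matrixI:
  fixes M :: "'a::euclidean_space \<Rightarrow> real^'n^'m"
  assumes "\<And>i j. isCont (\<lambda>z. M z $ i $ j) y"
  shows "isCont M y"
  using assms unfolding isCont_def by (auto intro!: vec_tendstoI)

text \<open>If \<open>S\<close> is bounded by \<open>\<kappa>\<close>, then its inverse is bounded below by \<open>1 / \<kappa>\<close>: expand the form of the inverse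
at \<open>v - S v / \<kappa>\<close>.\<close>

lemma norm_le_inverse_quadratic_form:
  fixes S :: "real^'n^'n"
  assumes sym: "transpose S = S" and pd: "\<And>v. v \<noteq> 0 \<Longrightarrow> v \<bullet> (S *v v) > 0"
    and bd: "\<And>v. v \<bullet> (S *v v) \<le> \<kappa> * (norm v)\<^sup>2" and kap: "\<kappa> > 0"
  shows "(norm v)\<^sup>2 \<le> \<kappa> * (v \<bullet> (matrix_inv S *v v))"
proof -
  note d = posdef_det_nonzero[OF pd]
  let ?B = "matrix_inv S" and ?w = "S *v v"
  have Bw: "?B *v ?w = v" using matrix_inv_works(2)[OF d] by (simp add: matrix_vector_mul_assoc)
  have Bsym: "x \<bullet> (?B *v z) = (?B *v x) \<bullet> z" for x z
    by (metis dot_lmul_matrix transpose_matrix_vector matrix_inv_symmetric[OF d sym])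
  let ?s = "1 / \<kappa>"
  let ?x = "v - ?s *\<^sub>R ?w"
  have "0 \<le> ?x \<bullet> (?B *v ?x)"
    using matrix_inv_posdef[OF pd, of ?x] by (cases "?x = 0") auto
  also have "?B *v ?x = ?B *v v - ?s *\<^sub>R v"
    by (simp add: matrix_vector_mult_diff_distrib matrix_vector_mult_scaleR Bw)
  also have "?x \<bullet> (?B *v v - ?s *\<^sub>R v)
      = v \<bullet> (?B *v v) - ?s * (v \<bullet> v) - ?s * (?w \<bullet> (?B *v v)) + ?s * (?s * (?w \<bullet> v))"
    by (simp add: inner_diff_left inner_diff_right algebra_simps)
  also have "?w \<bullet> (?B *v v) = v \<bullet> v" by (simp add: Bsym Bw)
  also have "?s * (?w \<bullet> v) \<le> v \<bullet> v"
    using bd[of v] kap by (simp add: pos_divide_le_eq inner_commute power2_norm_eq_inner mult.commute)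
  hence "?s * (?s * (?w \<bullet> v)) \<le> ?s * (v \<bullet> v)" using kap by (intro mult_left_mono) auto
  finally have "?s * (v \<bullet> v) \<le> v \<bullet> (?B *v v)" by linarith
  thus ?thesis using kap by (simp add: power2_norm_eq_inner pos_divide_le_eq mult.commute)
qed

lemma chart_coord_inv:
  assumes "y \<in> coord c ` cdom c"
  shows "coord_inv c y \<in> cdom c" "coord c (coord_inv c y) = y"
  using assms by (auto intro: inv_into_into f_inv_into_f)

lemma chart_open: "is_chart M c \<Longrightarrow> open (coord c ` cdom c)"
  by (simp add: is_chart_def)

lemma chart_sub: "is_chart M c \<Longrightarrow> cdom c \<subseteq> M"
  by (auto simp: is_chart_def dest: openin_imp_subset)

lemma chart_inv_coord:
  assumes "is_chart M c" "x \<in> cdom c"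
  shows "coord_inv c (coord c x) = x"
  using assms by (auto simp: is_chart_def homeomorphism_def)

lemma chart_image_open:
  assumes c: "is_chart M c" and U: "openin (top_of_set M) U" "U \<subseteq> cdom c"
  shows "open (coord c ` U)"
proof -
  have "openin (top_of_set (cdom c)) U"
    using U chart_sub[OF c] openin_subset_trans by blast
  hence "openin (top_of_set (coord c ` cdom c)) (coord c ` U)"
    using c homeomorphism_imp_open_map unfolding is_chart_def by blast
  thus ?thesis using chart_open[OF c] openin_open_trans by blast
qed

lemma chart_preimage_open:
  assumes c: "is_chart M c" and W: "open W" "W \<subseteq> coord c ` cdom c"
  shows "openin (top_of_set M) (coord_inv c ` W)"
proof -
  have "homeomorphism (coord c ` cdom c) (cdom c) (coord_inv c) (coord c)"
    using c by (auto simp: is_chart_def intro: homeomorphism_symD)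
  moreover have "openin (top_of_set (coord c ` cdom c)) W" using W by (simp add: open_subset)
  ultimately have "openin (top_of_set (cdom c)) (coord_inv c ` W)" by (rule homeomorphism_imp_open_map)
  thus ?thesis using c unfolding is_chart_def by (blast intro: openin_trans)
qed

locale riemannian_atlas =
  fixes M :: "'m::t2_space set" and A :: "('m, 'n::finite) chart set" and g :: "('m, 'n) metric_field"
  assumes smooth_str: "smooth_structure M A" and metric: "riemannian_metric A g"
begin

lemma chartD: "c \<in> A \<Longrightarrow> is_chart M c"
  using smooth_str by (simp add: smooth_structure_def)

lemma charts_cover: "(\<Union>c\<in>A. cdom c) = M"
  using smooth_str by (simp add: smooth_structure_def)

lemma charts_compatible: "c \<in> A \<Longrightarrow> c' \<in> A \<Longrightarrow> smooth_transition c c'"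
  using smooth_str by (simp add: smooth_structure_def compatible_def)

lemma chart_at: "x \<in> M \<Longrightarrow> chart_at A x \<in> A \<and> x \<in> cdom (chart_at A x)"
proof -
  assume "x \<in> M"
  hence "\<exists>c. c \<in> A \<and> x \<in> cdom c" using charts_cover by blast
  from someI_ex[OF this] show ?thesis by (simp add: chart_at_def)
qed

lemma metric_smooth: "c \<in> A \<Longrightarrow> smooth_on (g c) (coord c ` cdom c)"
  and metric_symmetric: "c \<in> A \<Longrightarrow> y \<in> coord c ` cdom c \<Longrightarrow> transpose (g c y) = g c y"
  and metric_positive: "c \<in> A \<Longrightarrow> y \<in> coord c ` cdom c \<Longrightarrow> v \<noteq> 0 \<Longrightarrow> v \<bullet> (g c y *v v) > 0"
  and metric_transform: "c \<in> A \<Longrightarrow> c' \<in> A \<Longrightarrow> p \<in> cdom c \<Longrightarrow> p \<in> cdom c' \<Longrightarrow>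
    g c (coord c p) = transpose (jacobian c c' p) ** g c' (coord c' p) ** jacobian c c' p"
proof -
  have m: "c \<in> A \<Longrightarrow> smooth_on (g c) (coord c ` cdom c) \<and>
        (\<forall>y\<in>coord c ` cdom c. transpose (g c y) = g c y \<and> (\<forall>v. v \<noteq> 0 \<longrightarrow> v \<bullet> (g c y *v v) > 0))" for c
    using metric unfolding riemannian_metric_def by (elim conjE) (drule (1) bspec)
  show "c \<in> A \<Longrightarrow> smooth_on (g c) (coord c ` cdom c)" by (drule m) (elim conjE)
  show "c \<in> A \<Longrightarrow> y \<in> coord c ` cdom c \<Longrightarrow> transpose (g c y) = g c y"
    by (drule m, elim conjE, drule (1) bspec, elim conjE)
  show "c \<in> A \<Longrightarrow> y \<in> coord c ` cdom c \<Longrightarrow> v \<noteq> 0 \<Longrightarrow> v \<bullet> (g c y *v v) > 0"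
    by (drule m, elim conjE, drule (1) bspec, elim conjE, drule spec, drule (1) mp)
  show "c \<in> A \<Longrightarrow> c' \<in> A \<Longrightarrow> p \<in> cdom c \<Longrightarrow> p \<in> cdom c' \<Longrightarrow>
    g c (coord c p) = transpose (jacobian c c' p) ** g c' (coord c' p) ** jacobian c c' p"
    using metric[unfolded riemannian_metric_def, THEN conjunct2, rule_format, of c c' p] by simp
qed

lemma metric_posdef:
  assumes "c \<in> A" "y \<in> coord c ` cdom c"
  shows "transpose (g c y) = g c y" "v \<noteq> 0 \<Longrightarrow> v \<bullet> (g c y *v v) > 0" "det (g c y) \<noteq> 0"
proof -
  show "transpose (g c y) = g c y" by (rule metric_symmetric[OF assms])
  show "v \<noteq> 0 \<Longrightarrow> v \<bullet> (g c y *v v) > 0" by (rule metric_positive[OF assms])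
  show "det (g c y) \<noteq> 0" by (rule posdef_det_nonzero) (rule metric_positive[OF assms])
qed

lemma metric_entry_differentiable:
  assumes "c \<in> A" "y \<in> coord c ` cdom c"
  shows "(\<lambda>z. g c z $ i $ j) differentiable (at y)"
proof -
  have "Ck_on (Suc 0) (g c) (coord c ` cdom c)"
    using metric_smooth[OF assms(1)] by (simp only: smooth_on_def)
  hence "g c differentiable (at y)" using assms by auto
  then obtain D where "(g c has_derivative D) (at y)" by (auto simp: differentiable_def)
  hence "((\<lambda>z. g c z $ i $ j) has_derivative (\<lambda>h. D h $ i $ j)) (at y)"
    by (intro bounded_linear.has_derivative[OF bounded_linear_vec_nth])
  thus ?thesis by (auto simp: differentiable_def)
qed

lemma metric_isCont: "c \<in> A \<Longrightarrow> y \<in> coord c ` cdom c \<Longrightarrow> isCont (g c) y"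
  by (intro isCont_matrixI differentiable_imp_continuous_within metric_entry_differentiable)

lemma inverse_metric_entry_differentiable:
  assumes "c \<in> A" "y \<in> coord c ` cdom c"
  shows "(\<lambda>z. matrix_inv (g c z) $ i $ j) differentiable (at y)"
  using assms chartD[OF assms(1)]
  by (intro differentiable_matrix_inv_entry[of "coord c ` cdom c"] metric_entry_differentiable)
     (auto simp: chart_open metric_posdef)

lemma inverse_metric_isCont:
  assumes "c \<in> A" "y \<in> coord c ` cdom c"
  shows "isCont (\<lambda>z. matrix_inv (g c z)) y"
  using assms
  by (intro isCont_matrixI differentiable_imp_continuous_within inverse_metric_entry_differentiable)

text \<open>The Jacobian is invertible because the transformation law of the metric exhibits it as a factor of an
invertible matrix.\<close>

lemma transition:
  assumes c: "c \<in> A" "c' \<in> A" and x: "x \<in> cdom c" "x \<in> cdom c'"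
  shows "((coord c' \<circ> coord_inv c) has_derivative ((*v) (jacobian c c' x))) (at (coord c x))"
    "det (jacobian c c' x) \<noteq> 0"
proof -
  let ?T = "coord c' \<circ> coord_inv c" and ?y = "coord c x"
  from charts_compatible[OF c] have "Ck_on (Suc 0) ?T (coord c ` (cdom c \<inter> cdom c'))" by (auto simp: smooth_transition_def smooth_on_def)
  hence "?T differentiable (at ?y)" using x by auto
  hence d: "(?T has_derivative frechet_derivative ?T (at ?y)) (at ?y)" by (simp add: frechet_derivative_works)
  hence "frechet_derivative ?T (at ?y) = (*v) (jacobian c c' x)"
    by (simp add: jacobian_def matrix_works has_derivative_linear fun_eq_iff)
  with d show "(?T has_derivative ((*v) (jacobian c c' x))) (at ?y)" by simp
  have "g c ?y = transpose (jacobian c c' x) ** g c' (coord c' x) ** jacobian c c' x"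
    using c x by (rule metric_transform)
  hence "det (g c ?y) = det (jacobian c c' x) * det (g c' (coord c' x)) * det (jacobian c c' x)"
    by (simp add: det_mul)
  moreover have "det (g c ?y) \<noteq> 0" using c x by (intro metric_posdef) auto
  ultimately show "det (jacobian c c' x) \<noteq> 0" by auto
qed

lemma smooth_fun_Ck2:
  assumes "smooth_fun A f M" "c \<in> A"
  shows "Ck_on 2 (f \<circ> coord_inv c) (coord c ` cdom c)"
proof -
  have "Ck_on 2 (f \<circ> coord_inv c) (coord c ` (cdom c \<inter> M))"
    using assms by (auto simp: smooth_fun_def Ck_fun_def)
  moreover have "cdom c \<inter> M = cdom c" using chart_sub[OF chartD[OF assms(2)]] by auto
  ultimately show ?thesis by simp
qed

lemma smooth_fun_continuous:
  assumes "smooth_fun A f M"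
  shows "continuous_on M f"
  unfolding continuous_openin_preimage_eq[of M f]
proof (intro allI impI)
  fix B :: "real set" assume B: "open B"
  have "openin (top_of_set M) (cdom c \<inter> f -` B)" if c: "c \<in> A" for c
  proof -
    note ch = chartD[OF c]
    have 1: "continuous_on (coord c ` cdom c) (f \<circ> coord_inv c)"
      by (rule Ck_on_2_continuous[OF smooth_fun_Ck2[OF assms c]])
    have "open (coord c ` cdom c \<inter> (f \<circ> coord_inv c) -` B)" (is "open ?W")
      using continuous_open_preimage[OF 1 chart_open[OF ch] B] .
    hence "openin (top_of_set M) (coord_inv c ` ?W)" by (intro chart_preimage_open[OF ch]) auto
    moreover have "coord_inv c ` ?W = cdom c \<inter> f -` B"
    proof (intro set_eqI iffI)
      fix x assume "x \<in> coord_inv c ` ?W"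
      thus "x \<in> cdom c \<inter> f -` B" by (auto simp: chart_inv_coord[OF ch])
    next
      fix x assume x: "x \<in> cdom c \<inter> f -` B"
      hence "x = coord_inv c (coord c x)" using chart_inv_coord[OF ch, of x] by simp
      moreover from this x have "coord c x \<in> ?W" by simp
      ultimately show "x \<in> coord_inv c ` ?W" by (rule image_eqI)
    qed
    ultimately show ?thesis by simp
  qed
  hence "openin (top_of_set M) (\<Union>c\<in>A. cdom c \<inter> f -` B)" by blast
  moreover have "(\<Union>c\<in>A. cdom c \<inter> f -` B) = M \<inter> f -` B"
    using charts_cover by blast
  ultimately show "openin (top_of_set M) (M \<inter> f -` B)" by simp
qed

text \<open>The defining formula of \<open>grad_norm_sq\<close> uses a chart chosen separately at each point.  Here it becomes
the eikonal expression in one fixed chart, so that it can be differentiated there.\<close>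

lemma grad_norm_in_chart:
  assumes f: "smooth_fun A f M" and c: "c \<in> A" and y: "y \<in> coord c ` cdom c"
  defines "G \<equiv> grad_vec (f \<circ> coord_inv c)"
  shows "G y \<bullet> (matrix_inv (g c y) *v G y) = grad_norm_sq A g f (coord_inv c y)"
proof -
  let ?x = "coord_inv c y" and ?F = "f \<circ> coord_inv c"
  have x: "?x \<in> cdom c" "coord c ?x = y" using chart_coord_inv[OF y] by auto
  have xM: "?x \<in> M" using x chart_sub[OF chartD[OF c]] by auto
  let ?c' = "chart_at A ?x"
  have c': "?c' \<in> A" "?x \<in> cdom ?c'" using chart_at[OF xM] by auto
  let ?F' = "f \<circ> coord_inv ?c'" and ?y' = "coord ?c' ?x" and ?J = "jacobian c ?c' ?x"
  let ?T = "coord ?c' \<circ> coord_inv c"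
  let ?D' = "grad_vec ?F' ?y'"
  have T: "(?T has_derivative ((*v) ?J)) (at y)" and J: "det ?J \<noteq> 0"
    using transition[OF c c'(1) x(1) c'(2)] x by auto
  have "(?F' has_derivative (\<lambda>h. ?D' \<bullet> h)) (at (?T y))"
    using Ck_on_2_gradient(2)[OF smooth_fun_Ck2[OF f c'(1)], of ?y'] c' by simp
  from has_derivative_compose[OF T this]
  have "((\<lambda>z. ?F' (?T z)) has_derivative (\<lambda>h. ?D' \<bullet> (?J *v h))) (at y)" .
  hence "(?F has_derivative (\<lambda>h. ?D' \<bullet> (?J *v h))) (at y)"
  proof (rule has_derivative_transform_within_open)
    show "open (coord c ` (cdom c \<inter> cdom ?c'))"
      using chartD[OF c] chartD[OF c'(1)] by (intro chart_image_open) (auto simp: is_chart_def)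
    show "y \<in> coord c ` (cdom c \<inter> cdom ?c')" using x c' by (metis IntI imageI)
    fix z assume "z \<in> coord c ` (cdom c \<inter> cdom ?c')"
    thus "?F' (?T z) = ?F z" using chart_inv_coord[OF chartD[OF c]] chart_inv_coord[OF chartD[OF c'(1)]] by auto
  qed
  hence "(?F has_derivative (\<lambda>h. (transpose ?J *v ?D') \<bullet> h)) (at y)"
    by (simp add: transpose_matrix_vector dot_lmul_matrix)
  hence Gy: "G y = transpose ?J *v ?D'" unfolding G_def by (rule grad_vec_unique)
  have y': "?y' \<in> coord ?c' ` cdom ?c'" using c' by auto
  let ?w = "matrix_inv (g ?c' ?y') *v ?D'" and ?Ji = "matrix_inv ?J"
  have gw: "g ?c' ?y' *v ?w = ?D'"
    using matrix_inv_works(1)[OF metric_posdef(3)[OF c'(1) y']] by (simp add: matrix_vector_mul_assoc)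
  have JJ: "?J *v (?Ji *v v) = v" for v using matrix_inv_works(1)[OF J] by (simp add: matrix_vector_mul_assoc)
  have gc: "g c y = transpose ?J ** g ?c' ?y' ** ?J"
    using metric_transform[OF c c'(1) x(1) c'(2)] by (simp only: x(2))
  have "g c y *v (?Ji *v ?w) = transpose ?J *v (g ?c' ?y' *v (?J *v (?Ji *v ?w)))"
    by (simp add: gc matrix_vector_mul_assoc matrix_mul_assoc)
  also have "\<dots> = G y" by (simp add: JJ gw Gy)
  finally have "matrix_inv (g c y) *v G y = (matrix_inv (g c y) ** g c y) *v (?Ji *v ?w)"
    by (simp add: matrix_vector_mul_assoc[symmetric])
  also have "\<dots> = ?Ji *v ?w" using matrix_inv_works(2)[OF metric_posdef(3)[OF c y]] by simp
  finally have "G y \<bullet> (matrix_inv (g c y) *v G y) = (transpose ?J *v ?D') \<bullet> (?Ji *v ?w)" by (simp add: Gy)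
  also have "\<dots> = ?D' \<bullet> ?w" by (simp add: transpose_matrix_vector dot_lmul_matrix JJ)
  also have "\<dots> = grad_norm_sq A g f ?x"
    by (simp add: grad_norm_sq_def Let_def grad_coord_def grad_vec_def[symmetric] gw inner_commute)
  finally show ?thesis .
qed

end

section \<open>Estimates and derivatives along lines\<close>

text \<open>The function \<open>h\<^sup>2 exp (-2 L t)\<close> is non-increasing.\<close>

lemma zero_propagates_by_gronwall:
  fixes h h' :: "real \<Rightarrow> real"
  assumes d: "\<And>t. 0 \<le> t \<Longrightarrow> t \<le> 1 \<Longrightarrow> (h has_real_derivative h' t) (at t)"
    and L: "\<And>t. 0 \<le> t \<Longrightarrow> t \<le> 1 \<Longrightarrow> \<bar>h' t\<bar> \<le> L * \<bar>h t\<bar>" and h0: "h 0 = 0"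
  shows "h 1 = 0"
proof -
  have "(h 1)\<^sup>2 * exp (- (2 * L * 1)) \<le> (h 0)\<^sup>2 * exp (- (2 * L * 0))"
  proof (rule DERIV_nonpos_imp_nonincreasing[of 0 1 "\<lambda>t. (h t)\<^sup>2 * exp (- (2 * L * t))"])
    fix t :: real assume t: "0 \<le> t" "t \<le> 1"
    have "((\<lambda>t. (h t)\<^sup>2 * exp (- (2 * L * t))) has_real_derivative
        2 * (h t * h' t - L * (h t)\<^sup>2) * exp (- (2 * L * t))) (at t)"
      by (auto intro!: derivative_eq_intros d t simp: algebra_simps power2_eq_square)
    moreover have "h t * h' t \<le> L * (h t)\<^sup>2"
    proof -
      have "h t * h' t \<le> \<bar>h t\<bar> * \<bar>h' t\<bar>" by (metis abs_ge_self abs_mult)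
      also have "\<dots> \<le> \<bar>h t\<bar> * (L * \<bar>h t\<bar>)" by (intro mult_left_mono L t) auto
      also have "\<dots> = L * (h t)\<^sup>2" by (simp add: power2_eq_square abs_mult_self_eq mult_ac)
      finally show ?thesis .
    qed
    hence "2 * (h t * h' t - L * (h t)\<^sup>2) * exp (- (2 * L * t)) \<le> 0"
      by (simp add: mult_le_0_iff)
    ultimately show "\<exists>y. ((\<lambda>t. (h t)\<^sup>2 * exp (- (2 * L * t))) has_real_derivative y) (at t) \<and> y \<le> 0" by blast
  qed simp
  thus ?thesis by (simp add: h0 mult_le_0_iff)
qed

lemma vanishes_on_ball_if_gradient_dominated:
  fixes F :: "'a::euclidean_space \<Rightarrow> real"
  assumes F: "\<And>y. y \<in> ball p r \<Longrightarrow> (F has_derivative (\<lambda>h. G y \<bullet> h)) (at y)"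
    and L: "\<And>y. y \<in> ball p r \<Longrightarrow> norm (G y) \<le> L * \<bar>F y\<bar>"
    and F0: "F p = 0" and y: "y \<in> ball p r"
  shows "F y = 0"
proof -
  let ?l = "\<lambda>t. p + t *\<^sub>R (y - p)"
  have inb: "?l t \<in> ball p r" if "0 \<le> t" "t \<le> 1" for t
  proof -
    have "norm (t *\<^sub>R (y - p)) \<le> 1 * norm (y - p)" using that by (simp add: mult_left_le_one_le)
    thus ?thesis using y by (simp add: dist_norm norm_minus_commute)
  qed
  have "(\<lambda>t. F (?l t)) 1 = 0"
  proof (rule zero_propagates_by_gronwall[of _ "\<lambda>t. G (?l t) \<bullet> (y - p)" "L * norm (y - p)"])
    fix t :: real assume t: "0 \<le> t" "t \<le> 1"
    have "((\<lambda>t. ?l t) has_derivative (\<lambda>s. s *\<^sub>R (y - p))) (at t)" by (auto intro!: derivative_eq_intros)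
    from has_derivative_compose[OF this F[OF inb[OF t]]]
    show "((\<lambda>t. F (?l t)) has_real_derivative G (?l t) \<bullet> (y - p)) (at t)"
      unfolding has_field_derivative_def by (rule has_derivative_eq_rhs) (auto simp: fun_eq_iff)
    have "\<bar>G (?l t) \<bullet> (y - p)\<bar> \<le> norm (G (?l t)) * norm (y - p)" by (rule Cauchy_Schwarz_ineq2)
    also have "\<dots> \<le> L * \<bar>F (?l t)\<bar> * norm (y - p)" by (intro mult_right_mono L inb t) auto
    finally show "\<bar>G (?l t) \<bullet> (y - p)\<bar> \<le> L * norm (y - p) * \<bar>F (?l t)\<bar>" by (simp add: mult_ac)
  qed (use F0 in simp)
  thus ?thesis by simp
qed

lemma Ck_on_2_real:
  fixes b :: "real \<Rightarrow> real"
  assumes "Ck_on 2 b UNIV"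
  shows "(b has_real_derivative deriv b t) (at t)" "(deriv b has_real_derivative deriv (deriv b) t) (at t)"
proof -
  have C: "Ck_on (Suc (Suc 0)) b UNIV" using assms by (simp add: numeral_2_eq_2)
  have d: "(b has_real_derivative frechet_derivative b (at t) 1) (at t)" for t
  proof -
    let ?D = "frechet_derivative b (at t)"
    have D: "(b has_derivative ?D) (at t)" using C by (simp add: frechet_derivative_works)
    have "?D x = ?D 1 * x" for x
      using linear_scale[OF has_derivative_linear[OF D], of x 1] by (simp add: mult.commute)
    hence "?D = (*) (?D 1)" by (rule ext)
    with D have "(b has_derivative (*) (?D 1)) (at t)" by simp
    thus ?thesis unfolding has_field_derivative_def .
  qed
  hence e: "deriv b = (\<lambda>t. frechet_derivative b (at t) 1)" by (auto intro: DERIV_imp_deriv)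
  show "(b has_real_derivative deriv b t) (at t)" using d by (simp add: e)
  have "deriv b differentiable (at t)" using C by (simp add: e)
  thus "(deriv b has_real_derivative deriv (deriv b) t) (at t)"
    using DERIV_deriv_iff_real_differentiable by blast
qed

text \<open>A local bound is enough, and it holds because the difference quotient of second order converges.\<close>

lemma second_order_bound:
  fixes b :: "real \<Rightarrow> real"
  assumes "Ck_on 2 b UNIV"
  shows "\<exists>C \<delta>. \<delta> > 0 \<and> C > 0 \<and> (\<forall>t. \<bar>t - t0\<bar> < \<delta> \<longrightarrow> \<bar>b t - b t0 - deriv b t0 * (t - t0)\<bar> \<le> C * (t - t0)\<^sup>2)"
proof -
  let ?F = "\<lambda>t. b t - deriv b t0 * t"
  let ?l = "deriv (deriv b) t0 / 2"
  have 1: "(?F has_derivative (\<lambda>h. (deriv b t - deriv b t0) \<bullet> h)) (at t)" for t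
  proof -
    have "(?F has_real_derivative deriv b t - deriv b t0) (at t)"
      by (auto intro!: derivative_eq_intros Ck_on_2_real[OF assms])
    thus ?thesis by (simp add: has_field_derivative_def)
  qed
  have 2: "((\<lambda>t. deriv b t - deriv b t0) has_derivative (\<lambda>h. deriv (deriv b) t0 * h)) (at t0)"
  proof -
    have "((\<lambda>t. deriv b t - deriv b t0) has_real_derivative deriv (deriv b) t0) (at t0)"
      by (auto intro!: derivative_eq_intros Ck_on_2_real[OF assms])
    thus ?thesis by (simp add: has_field_derivative_def)
  qed
  have "((\<lambda>s. (?F (t0 + s *\<^sub>R 1) - ?F t0) / s\<^sup>2) \<longlongrightarrow> (1 \<bullet> (deriv (deriv b) t0 * 1)) / 2) (at 0)"
    by (rule second_order_expansion[OF open_UNIV UNIV_I 1 2]) simp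
  hence "((\<lambda>s. \<bar>(?F (t0 + s) - ?F t0) / s\<^sup>2\<bar>) \<longlongrightarrow> \<bar>?l\<bar>) (at 0)" by (intro tendsto_rabs) simp
  hence "\<forall>\<^sub>F s in at 0. \<bar>(?F (t0 + s) - ?F t0) / s\<^sup>2\<bar> < \<bar>?l\<bar> + 1" by (rule order_tendstoD(2)) simp
  then obtain \<delta> where \<delta>: "\<delta> > 0" "\<And>s. s \<noteq> 0 \<Longrightarrow> \<bar>s\<bar> < \<delta> \<Longrightarrow> \<bar>(?F (t0 + s) - ?F t0) / s\<^sup>2\<bar> < \<bar>?l\<bar> + 1"
    unfolding eventually_at by (auto simp: dist_real_def)
  have "\<bar>b t - b t0 - deriv b t0 * (t - t0)\<bar> \<le> (\<bar>?l\<bar> + 1) * (t - t0)\<^sup>2" if t: "\<bar>t - t0\<bar> < \<delta>" for t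
  proof (cases "t = t0")
    case False
    have "\<bar>(?F (t0 + (t - t0)) - ?F t0) / (t - t0)\<^sup>2\<bar> < \<bar>?l\<bar> + 1" using False t by (intro \<delta>(2)) auto
    moreover have e: "?F (t0 + (t - t0)) - ?F t0 = b t - b t0 - deriv b t0 * (t - t0)" by (simp add: algebra_simps)
    ultimately have "\<bar>b t - b t0 - deriv b t0 * (t - t0)\<bar> / (t - t0)\<^sup>2 < \<bar>?l\<bar> + 1"
      unfolding e abs_divide abs_power2 by simp
    thus ?thesis using False by (simp add: pos_divide_less_eq)
  qed simp
  moreover have "\<bar>?l\<bar> + 1 > 0" by simp
  ultimately show ?thesis using \<delta>(1) by blast
qed

text \<open>A continuous map from a compact space to the reals is closed, hence a quotient map onto its image.\<close>

lemma level_function_continuous: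
  fixes f u :: "'m::t2_space \<Rightarrow> real" and \<phi> :: "real \<Rightarrow> real"
  assumes M: "compact M" and f: "continuous_on M f" and u: "continuous_on M u"
    and \<phi>: "\<And>x. x \<in> M \<Longrightarrow> \<phi> (f x) = u x"
  shows "continuous_on (f ` M) \<phi>"
proof -
  have cl: "closed (f ` M)" using compact_imp_closed[OF compact_continuous_image[OF f M]] .
  have "closed (\<phi> -` B \<inter> f ` M)" if B: "closed B" for B
  proof -
    have "closedin (top_of_set M) (M \<inter> u -` B)" using u B by (rule continuous_closedin_preimage)
    hence "compact (M \<inter> u -` B)" using closedin_compact[OF M] by blast
    moreover have "continuous_on (M \<inter> u -` B) f" by (rule continuous_on_subset[OF f]) auto
    ultimately have "closed (f ` (M \<inter> u -` B))" using compact_continuous_image compact_imp_closed by blast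
    moreover have "\<phi> -` B \<inter> f ` M = f ` (M \<inter> u -` B)" using \<phi> by auto
    ultimately show ?thesis by simp
  qed
  thus ?thesis using continuous_on_closed_vimage[OF cl, of \<phi>] by blast
qed

text \<open>\<open>\<phi> = U \<circ> h\<inverse>\<close> near \<open>h 0\<close>, and the derivative of this composition is again a quotient of differentiable
functions composed with \<open>h\<inverse>\<close>.\<close>

lemma twice_differentiable_reparametrization:
  fixes h h' U U' \<phi> :: "real \<Rightarrow> real"
  assumes \<delta>: "\<delta> > 0"
    and h: "\<And>t. \<bar>t\<bar> < \<delta> \<Longrightarrow> (h has_real_derivative h' t) (at t)"
    and hpos: "\<And>t. \<bar>t\<bar> < \<delta> \<Longrightarrow> h' t > 0"
    and U: "\<And>t. \<bar>t\<bar> < \<delta> \<Longrightarrow> (U has_real_derivative U' t) (at t)"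
    and h': "h' differentiable (at 0)" and U': "U' differentiable (at 0)"
    and \<phi>: "\<And>t. \<bar>t\<bar> < \<delta> \<Longrightarrow> \<phi> (h t) = U t"
  shows "\<exists>D. (\<forall>\<^sub>F t in nhds (h 0). (\<phi> has_real_derivative D t) (at t)) \<and> D differentiable (at (h 0))"
proof -
  let ?S = "{-\<delta><..<\<delta>}"
  have S: "open ?S" "0 \<in> ?S" using \<delta> by auto
  have inj: "inj_on h ?S"
  proof (rule linorder_inj_onI)
    fix x y assume xy: "x < y" "x \<in> ?S" "y \<in> ?S"
    have "\<exists>l. (h has_real_derivative l) (at t) \<and> 0 < l" if "x \<le> t" "t \<le> y" for t
    proof -
      have "\<bar>t\<bar> < \<delta>" using xy that by auto
      thus ?thesis using h hpos by blast
    qed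
    from DERIV_pos_imp_increasing[OF xy(1) this] show "h x \<noteq> h y" by auto
  qed auto
  define k where "k = inv_into ?S h"
  have k: "k (h t) = t" if "t \<in> ?S" for t using that inj by (simp add: k_def)
  have cont: "continuous_on ?S h"
    by (intro continuous_at_imp_continuous_on ballI DERIV_isCont[OF h]) auto
  have Oo: "open (h ` ?S)" using invariance_of_domain[OF cont S(1) inj] .
  have dk: "(k has_real_derivative inverse (h' (k t))) (at t)" if t: "t \<in> h ` ?S" for t
  proof -
    obtain r where r: "r \<in> ?S" "t = h r" using t by auto
    hence r': "\<bar>r\<bar> < \<delta>" by auto
    have "(k has_derivative (*) (inverse (h' r))) (at (h r))"
    proof (rule has_derivative_inverse_strong[OF S(1) r(1) cont k])
      show "(h has_derivative (*) (h' r)) (at r)" using h[OF r'] by (simp add: has_field_derivative_def)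
      show "(*) (h' r) \<circ> (*) (inverse (h' r)) = id" using hpos[OF r'] by (auto simp: fun_eq_iff)
    qed
    thus ?thesis using k r by (simp add: has_field_derivative_def)
  qed
  let ?D = "\<lambda>t. U' (k t) * inverse (h' (k t))"
  have kS: "\<bar>k t\<bar> < \<delta>" if "t \<in> h ` ?S" for t using that k by auto
  have "(\<phi> has_real_derivative ?D t) (at t)" if t: "t \<in> h ` ?S" for t
  proof -
    have d: "((\<lambda>t. U (k t)) has_real_derivative ?D t) (at t)"
      by (rule DERIV_chain2[OF U[OF kS[OF t]] dk[OF t]])
    have ev: "\<forall>\<^sub>F s in nhds t. U (k s) = \<phi> s"
      using eventually_nhds_in_open[OF Oo t] by eventually_elim (use \<phi> k in auto)
    show ?thesis by (rule DERIV_cong_ev[THEN iffD1, OF refl ev refl d])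
  qed
  moreover have h0: "h 0 \<in> h ` ?S" using S by blast
  ultimately have "\<forall>\<^sub>F t in nhds (h 0). (\<phi> has_real_derivative ?D t) (at t)"
    using eventually_nhds_in_open[OF Oo h0] by (auto elim: eventually_mono)
  moreover have "?D differentiable (at (h 0))"
  proof -
    have kd: "k differentiable (at (h 0))" using dk[OF h0] unfolding real_differentiable_def by blast
    have k0: "k (h 0) = 0" using k S by simp
    have "(\<lambda>t. U' (k t)) differentiable (at (h 0))" "(\<lambda>t. h' (k t)) differentiable (at (h 0))"
      using differentiable_compose[of U' k "h 0" UNIV] differentiable_compose[of h' k "h 0" UNIV] kd U' h' k0 by auto
    moreover have "h' (k (h 0)) \<noteq> 0" using hpos[of 0] \<delta> k0 by simp
    ultimately show ?thesis by (intro differentiable_mult differentiable_inverse)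
  qed
  ultimately show ?thesis by (intro exI[of _ ?D] conjI)
qed

section \<open>The Laplacian in coordinates\<close>

lemma partial_deriv_vec:
  assumes "(F has_derivative F') (at y)"
  shows "partial_deriv i F y = F' (axis i 1)"
  using frechet_derivative_at[OF assms] by (simp add: partial_deriv_def)

context riemannian_atlas
begin

text \<open>The coefficients of the Laplacian in divergence form.\<close>

abbreviation (input) vol_inv :: "('m, 'n) chart \<Rightarrow> 'n \<Rightarrow> 'n \<Rightarrow> real^'n \<Rightarrow> real" where
  "vol_inv c i k z \<equiv> sqrt (det (g c z)) * matrix_inv (g c z) $ i $ k"

lemma vol_inv_has_derivative:
  assumes "c \<in> A" "y \<in> coord c ` cdom c"
  shows "\<exists>W'. \<forall>i k. (vol_inv c i k has_derivative W' i k) (at y)"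
proof -
  have "vol_inv c i k differentiable (at y)" for i k
    using assms metric_posdef(3)[OF assms]
    by (intro differentiable_mult differentiable_real_sqrt differentiable_det
        metric_entry_differentiable inverse_metric_entry_differentiable)
  thus ?thesis
    by (intro exI[of _ "\<lambda>i k. frechet_derivative (vol_inv c i k) (at y)"])
       (simp add: frechet_derivative_works)
qed

text \<open>The divergence involves derivatives of the density \<open>sqrt (det g)\<close> and of the inverse metric.  They are
kept abstract as \<open>W'\<close>: they drop out at critical points of \<open>f\<close>, and for a function of \<open>f\<close> they occur in the
same combination as for \<open>f\<close> itself.\<close>

lemma div_coord_formula:
  assumes W': "\<And>i k. (vol_inv c i k has_derivative W' i k) (at y)"
    and G: "(grad_vec (f \<circ> coord_inv c) has_derivative G') (at y)"
  shows "div_coord g c (grad_coord g c f) y =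
    (\<Sum>i\<in>UNIV. \<Sum>k\<in>UNIV. W' i k (axis i 1) * grad_vec (f \<circ> coord_inv c) y $ k
       + vol_inv c i k y * G' (axis i 1) $ k) / sqrt (det (g c y))"
proof -
  let ?G = "grad_vec (f \<circ> coord_inv c)"
  have "(\<lambda>z. sqrt (det (g c z)) * grad_coord g c f z $ i) = (\<lambda>z. \<Sum>k\<in>UNIV. vol_inv c i k z * ?G z $ k)" for i
    by (simp add: grad_coord_def grad_vec_def[symmetric] matrix_vector_mult_def sum_distrib_left mult.assoc fun_eq_iff)
  moreover have "partial_deriv i (\<lambda>z. \<Sum>k\<in>UNIV. vol_inv c i k z * ?G z $ k) y =
      (\<Sum>k\<in>UNIV. vol_inv c i k y * G' (axis i 1) $ k + W' i k (axis i 1) * ?G y $ k)" for i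
    by (rule partial_deriv_vec)
       (intro has_derivative_sum has_derivative_mult W' bounded_linear.has_derivative[OF bounded_linear_vec_nth G])
  ultimately show ?thesis by (simp only: div_coord_def add.commute)
qed

lemma div_grad_at_critical_point:
  assumes c: "c \<in> A" "y \<in> coord c ` cdom c"
    and G: "(grad_vec (f \<circ> coord_inv c) has_derivative ((*v) H)) (at y)"
    and G0: "grad_vec (f \<circ> coord_inv c) y = 0"
  shows "div_coord g c (grad_coord g c f) y = trace (matrix_inv (g c y) ** H)"
proof -
  obtain W' where W': "\<And>i k. (vol_inv c i k has_derivative W' i k) (at y)"
    using vol_inv_has_derivative[OF c] by blast
  have "div_coord g c (grad_coord g c f) y =
     (\<Sum>i\<in>UNIV. \<Sum>k\<in>UNIV. sqrt (det (g c y)) * (matrix_inv (g c y) $ i $ k * H $ k $ i)) / sqrt (det (g c y))"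
    unfolding div_coord_formula[OF W' G] G0
    by (simp add: matrix_vector_mult_basis column_def mult.assoc)
  also have "\<dots> = trace (matrix_inv (g c y) ** H)"
    using metric_posdef(3)[OF c]
    by (simp add: trace_def matrix_matrix_mult_def flip: sum_distrib_left)
  finally show ?thesis .
qed

text \<open>The formula \<open>\<Delta> (\<phi> \<circ> f) = \<phi>'(f) \<Delta> f - \<phi>''(f) \<parallel>\<nabla>f\<parallel>\<^sup>2\<close> in one chart, with \<open>\<Delta> = - div \<nabla>\<close>.\<close>

lemma div_grad_composition:
  assumes c: "c \<in> A" "y \<in> coord c ` cdom c"
    and W: "open W" "y \<in> W" "W \<subseteq> coord c ` cdom c"
    and F: "\<And>z. z \<in> W \<Longrightarrow> ((f \<circ> coord_inv c) has_derivative (\<lambda>h. grad_vec (f \<circ> coord_inv c) z \<bullet> h)) (at z)"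
    and G: "(grad_vec (f \<circ> coord_inv c) has_derivative G') (at y)"
    and u: "\<And>z. z \<in> W \<Longrightarrow> u (coord_inv c z) = \<phi> (f (coord_inv c z))"
    and \<phi>: "\<And>z. z \<in> W \<Longrightarrow> (\<phi> has_real_derivative \<phi>' (f (coord_inv c z))) (at (f (coord_inv c z)))"
    and \<phi>': "(\<phi>' has_real_derivative \<phi>2) (at (f (coord_inv c y)))"
  defines "G \<equiv> grad_vec (f \<circ> coord_inv c)"
  shows "div_coord g c (grad_coord g c u) y =
    \<phi>' (f (coord_inv c y)) * div_coord g c (grad_coord g c f) y + \<phi>2 * (G y \<bullet> (matrix_inv (g c y) *v G y))"
proof -
  let ?F = "f \<circ> coord_inv c" and ?s = "sqrt (det (g c y))"
  let ?t = "f (coord_inv c y)"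
  have Gu: "grad_vec (u \<circ> coord_inv c) z = \<phi>' (?F z) *\<^sub>R G z" if z: "z \<in> W" for z
  proof (rule grad_vec_unique)
    have "(\<phi> has_derivative (*) (\<phi>' (?F z))) (at (?F z))"
      using \<phi>[OF z] by (simp add: has_field_derivative_def)
    from has_derivative_compose[OF F[OF z] this]
    have "((\<lambda>x. \<phi> (?F x)) has_derivative (\<lambda>h. (\<phi>' (?F z) *\<^sub>R G z) \<bullet> h)) (at z)" by (simp add: G_def)
    thus "((u \<circ> coord_inv c) has_derivative (\<lambda>h. (\<phi>' (?F z) *\<^sub>R G z) \<bullet> h)) (at z)"
      by (rule has_derivative_transform_within_open[OF _ W(1) z]) (simp add: u)
  qed
  let ?Gu' = "\<lambda>h. \<phi>' ?t *\<^sub>R G' h + (\<phi>2 * (G y \<bullet> h)) *\<^sub>R G y"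
  have dGu: "(grad_vec (u \<circ> coord_inv c) has_derivative ?Gu') (at y)"
  proof -
    have "(\<phi>' has_derivative (*) \<phi>2) (at (?F y))" using \<phi>' by (simp add: has_field_derivative_def)
    from has_derivative_compose[OF F[OF W(2)] this]
    have "((\<lambda>z. \<phi>' (?F z)) has_derivative (\<lambda>h. \<phi>2 * (G y \<bullet> h))) (at y)" by (simp add: G_def)
    from has_derivative_scaleR[OF this G[folded G_def]]
    have "((\<lambda>z. \<phi>' (?F z) *\<^sub>R G z) has_derivative ?Gu') (at y)" by simp
    thus ?thesis by (rule has_derivative_transform_within_open[OF _ W(1,2)]) (simp add: Gu)
  qed
  obtain W' where W': "\<And>i k. (vol_inv c i k has_derivative W' i k) (at y)"
    using vol_inv_has_derivative[OF c] by blast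
  have s: "?s \<noteq> 0" using metric_posdef(3)[OF c] by simp
  have "div_coord g c (grad_coord g c u) y * ?s =
     (\<Sum>i\<in>UNIV. \<Sum>k\<in>UNIV. W' i k (axis i 1) * (\<phi>' ?t * G y $ k)
       + vol_inv c i k y * (\<phi>' ?t * G' (axis i 1) $ k + \<phi>2 * G y $ i * G y $ k))"
    unfolding div_coord_formula[OF W' dGu] Gu[OF W(2)] using s by (simp add: inner_axis)
  also have "\<dots> = \<phi>' ?t * (\<Sum>i\<in>UNIV. \<Sum>k\<in>UNIV. W' i k (axis i 1) * G y $ k + vol_inv c i k y * G' (axis i 1) $ k)
      + \<phi>2 * (\<Sum>i\<in>UNIV. \<Sum>k\<in>UNIV. ?s * (matrix_inv (g c y) $ i $ k * G y $ k * G y $ i))"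
    by (simp add: sum_distrib_left sum.distrib[symmetric] algebra_simps)
  also have "(\<Sum>i\<in>UNIV. \<Sum>k\<in>UNIV. ?s * (matrix_inv (g c y) $ i $ k * G y $ k * G y $ i))
      = ?s * (G y \<bullet> (matrix_inv (g c y) *v G y))"
    by (simp add: inner_vec_def matrix_vector_mult_def sum_distrib_left mult_ac)
  also have "(\<Sum>i\<in>UNIV. \<Sum>k\<in>UNIV. W' i k (axis i 1) * G y $ k + vol_inv c i k y * G' (axis i 1) $ k)
      = div_coord g c (grad_coord g c f) y * ?s"
    unfolding div_coord_formula[OF W' G] using s by (simp add: G_def)
  finally have "div_coord g c (grad_coord g c u) y * ?s =
     (\<phi>' ?t * div_coord g c (grad_coord g c f) y + \<phi>2 * (G y \<bullet> (matrix_inv (g c y) *v G y))) * ?s"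
    by (simp add: algebra_simps)
  thus ?thesis using s by simp
qed

end

section \<open>Level sets of isoparametric functions\<close>

context riemannian_atlas
begin

lemma chart_gradient:
  assumes f: "smooth_fun A f M" and c: "c \<in> A" "y \<in> coord c ` cdom c"
  shows "((f \<circ> coord_inv c) has_derivative (\<lambda>h. grad_vec (f \<circ> coord_inv c) y \<bullet> h)) (at y)"
    "\<exists>H. (grad_vec (f \<circ> coord_inv c) has_derivative ((*v) H)) (at y)"
  using Ck_on_2_gradient(2,3)[OF smooth_fun_Ck2[OF f c(1)] c(2)] by auto

lemma metric_locally_bounded:
  assumes c: "c \<in> A" "y \<in> coord c ` cdom c"
  obtains \<kappa> where "\<kappa> > 0" "\<forall>\<^sub>F z in nhds y. \<forall>v. v \<bullet> (g c z *v v) \<le> \<kappa> * (norm v)\<^sup>2"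
proof -
  obtain K where K: "K > 0" "\<And>B x. norm (B *v x :: real^'n) \<le> norm B * norm (x::real^'n) * K"
    using bounded_bilinear.pos_bounded[OF bounded_bilinear_matrix_vector_mult] by blast
  have "((\<lambda>z. norm (g c z)) \<longlongrightarrow> norm (g c y)) (nhds y)"
    using metric_isCont[OF c] tendsto_at_iff_tendsto_nhds[of "g c" y]
    by (intro tendsto_norm) (simp add: isCont_def)
  hence "\<forall>\<^sub>F z in nhds y. norm (g c z) < norm (g c y) + 1" by (rule order_tendstoD(2)) simp
  hence "\<forall>\<^sub>F z in nhds y. \<forall>v. v \<bullet> (g c z *v v) \<le> ((norm (g c y) + 1) * K) * (norm v)\<^sup>2"
  proof eventually_elim
    case (elim z)
    show ?case
    proof
      fix v :: "real^'n"
      have "v \<bullet> (g c z *v v) \<le> norm v * norm (g c z *v v)" by (rule norm_cauchy_schwarz)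
      also have "\<dots> \<le> norm v * (norm (g c z) * norm v * K)" by (intro mult_left_mono K) auto
      also have "\<dots> = (norm (g c z) * K) * (norm v)\<^sup>2" by (simp add: power2_eq_square)
      also have "\<dots> \<le> ((norm (g c y) + 1) * K) * (norm v)\<^sup>2" using elim K by (intro mult_right_mono) auto
      finally show "v \<bullet> (g c z *v v) \<le> ((norm (g c y) + 1) * K) * (norm v)\<^sup>2" .
    qed
  qed
  moreover have "(norm (g c y) + 1) * K > 0" using K by (simp add: add_nonneg_pos)
  ultimately show ?thesis using that by blast
qed

lemma grad_norm_sq_nonneg:
  assumes f: "smooth_fun A f M" and x: "x \<in> M"
  shows "grad_norm_sq A g f x \<ge> 0"
proof -
  define c where "c = chart_at A x"
  have c: "c \<in> A" "x \<in> cdom c" using chart_at x by (auto simp: c_def)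
  have y: "coord c x \<in> coord c ` cdom c" using c by blast
  let ?G = "grad_vec (f \<circ> coord_inv c) (coord c x)"
  have "0 \<le> ?G \<bullet> (matrix_inv (g c (coord c x)) *v ?G)"
    using matrix_inv_posdef[OF metric_posdef(2)[OF c(1) y], of ?G] by (cases "?G = 0") auto
  also have "\<dots> = grad_norm_sq A g f x"
    using grad_norm_in_chart[OF f c(1) y] chart_inv_coord[OF chartD[OF c(1)] c(2)] by simp
  finally show ?thesis .
qed

text \<open>Near a point of the level set, \<open>\<parallel>\<nabla>f\<parallel>\<^sup>2 = b(f) \<le> C (f - t)\<^sup>2\<close>, so in a chart the Euclidean gradient of \<open>f - t\<close>
is dominated by \<open>\<bar>f - t\<bar>\<close>, and \<open>f - t\<close> vanishes on a ball.\<close>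

lemma degenerate_level_set_open:
  assumes f: "smooth_fun A f M" and gn: "\<And>x. x \<in> M \<Longrightarrow> grad_norm_sq A g f x = b (f x)"
    and b: "Ck_on 2 b UNIV" and t: "b t = 0" "deriv b t = 0"
  shows "openin (top_of_set M) {x\<in>M. f x = t}"
proof (subst openin_subopen, intro ballI)
  fix x assume x: "x \<in> {x\<in>M. f x = t}"
  define c where "c = chart_at A x"
  have c: "c \<in> A" "x \<in> cdom c" using chart_at x by (auto simp: c_def)
  let ?y = "coord c x" and ?V = "coord c ` cdom c" and ?F = "f \<circ> coord_inv c"
  let ?G = "grad_vec ?F"
  have y: "?y \<in> ?V" using c by blast
  have Fy: "?F ?y = t" using chart_inv_coord[OF chartD[OF c(1)] c(2)] x by simp
  obtain \<kappa> where \<kappa>: "\<kappa> > 0" "\<forall>\<^sub>F z in nhds ?y. \<forall>v. v \<bullet> (g c z *v v) \<le> \<kappa> * (norm v)\<^sup>2"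
    using metric_locally_bounded[OF c(1) y] .
  obtain C \<delta> where C: "\<delta> > 0" "C > 0" "\<And>s. \<bar>s - t\<bar> < \<delta> \<Longrightarrow> \<bar>b s\<bar> \<le> C * (s - t)\<^sup>2"
    using second_order_bound[OF b, of t] t by auto
  have "isCont ?F ?y" using chart_gradient(1)[OF f c(1) y] by (rule has_derivative_continuous)
  hence "(?F \<longlongrightarrow> t) (nhds ?y)" using tendsto_at_iff_tendsto_nhds[of ?F ?y] Fy by (simp add: isCont_def)
  from tendstoD[OF this C(1)] have e1: "\<forall>\<^sub>F z in nhds ?y. \<bar>?F z - t\<bar> < \<delta>" by (simp add: dist_real_def)
  have e2: "\<forall>\<^sub>F z in nhds ?y. z \<in> ?V" using chart_open[OF chartD[OF c(1)]] y by (rule eventually_nhds_in_open)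
  have "\<forall>\<^sub>F z in nhds ?y. \<bar>?F z - t\<bar> < \<delta> \<and> z \<in> ?V \<and> (\<forall>v. v \<bullet> (g c z *v v) \<le> \<kappa> * (norm v)\<^sup>2)"
    using e1 e2 \<kappa>(2) by eventually_elim simp
  then obtain r where r: "r > 0" "\<And>z. dist z ?y < r \<Longrightarrow>
      \<bar>?F z - t\<bar> < \<delta> \<and> z \<in> ?V \<and> (\<forall>v. v \<bullet> (g c z *v v) \<le> \<kappa> * (norm v)\<^sup>2)"
    unfolding eventually_nhds_metric by blast
  have rz: "\<bar>?F z - t\<bar> < \<delta>" "z \<in> ?V" "\<And>v. v \<bullet> (g c z *v v) \<le> \<kappa> * (norm v)\<^sup>2"
    if "z \<in> ball ?y r" for z
    using r(2)[of z] that by (auto simp: dist_commute)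
  have const: "?F z - t = 0" if z: "z \<in> ball ?y r" for z
  proof (rule vanishes_on_ball_if_gradient_dominated[of ?y r "\<lambda>z. ?F z - t" ?G "sqrt (\<kappa> * C)"])
    fix w assume w: "w \<in> ball ?y r"
    show "((\<lambda>z. ?F z - t) has_derivative (\<lambda>h. ?G w \<bullet> h)) (at w)"
      using has_derivative_diff[OF chart_gradient(1)[OF f c(1) rz(2)[OF w]] has_derivative_const[of t]] by simp
    have wM: "coord_inv c w \<in> M"
      using chart_coord_inv(1)[OF rz(2)[OF w]] chart_sub[OF chartD[OF c(1)]] by blast
    have "(norm (?G w))\<^sup>2 \<le> \<kappa> * (?G w \<bullet> (matrix_inv (g c w) *v ?G w))"
      using metric_posdef[OF c(1) rz(2)[OF w]] rz(3)[OF w] \<kappa>(1) by (intro norm_le_inverse_quadratic_form) auto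
    also have "?G w \<bullet> (matrix_inv (g c w) *v ?G w) = b (?F w)"
      using grad_norm_in_chart[OF f c(1) rz(2)[OF w]] gn[OF wM] by simp
    also have "\<kappa> * b (?F w) \<le> \<kappa> * (C * (?F w - t)\<^sup>2)"
      using C(3)[OF rz(1)[OF w]] \<kappa>(1) by (intro mult_left_mono) auto
    also have "\<dots> = (sqrt (\<kappa> * C) * \<bar>?F w - t\<bar>)\<^sup>2"
      using \<kappa> C by (simp add: power_mult_distrib)
    finally show "norm (?G w) \<le> sqrt (\<kappa> * C) * \<bar>?F w - t\<bar>"
      by (rule power2_le_imp_le) (use \<kappa> C in auto)
  qed (use Fy z in auto)
  show "\<exists>T. openin (top_of_set M) T \<and> x \<in> T \<and> T \<subseteq> {x\<in>M. f x = t}"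
  proof (intro exI conjI)
    show "openin (top_of_set M) (coord_inv c ` ball ?y r)"
      using rz(2) by (intro chart_preimage_open[OF chartD[OF c(1)]]) auto
    have "x = coord_inv c ?y" using chart_inv_coord[OF chartD[OF c(1)] c(2)] by simp
    moreover have "?y \<in> ball ?y r" using r(1) by simp
    ultimately show "x \<in> coord_inv c ` ball ?y r" by (rule image_eqI)
    show "coord_inv c ` ball ?y r \<subseteq> {x\<in>M. f x = t}"
      using const chart_coord_inv(1)[OF rz(2)] chart_sub[OF chartD[OF c(1)]] by fastforce
  qed
qed

text \<open>Otherwise the level set through \<open>p\<close> would be open and closed in the connected set \<open>M\<close>.\<close>

lemma no_degenerate_level:
  assumes M: "connected M" and f: "smooth_fun A f M" and gn: "\<And>x. x \<in> M \<Longrightarrow> grad_norm_sq A g f x = b (f x)"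
    and b: "Ck_on 2 b UNIV" and nonconst: "x1 \<in> M" "x2 \<in> M" "f x1 \<noteq> f x2" and p: "p \<in> M" "b (f p) = 0"
  shows "deriv b (f p) \<noteq> 0"
proof
  assume "deriv b (f p) = 0"
  with p have "openin (top_of_set M) {x\<in>M. f x = f p}" by (intro degenerate_level_set_open[OF f gn b]) auto
  moreover have "closedin (top_of_set M) {x\<in>M. f x = f p}"
    using continuous_closedin_preimage_constant[OF smooth_fun_continuous[OF f]] .
  ultimately have "{x\<in>M. f x = f p} = {} \<or> {x\<in>M. f x = f p} = M"
    using M unfolding connected_clopen by blast
  hence "f x1 = f p" "f x2 = f p" using p nonconst by blast+
  with nonconst show False by simp
qed

lemma extremum_gradient_zero:
  fixes \<sigma> :: real
  assumes f: "smooth_fun A f M" and c: "c \<in> A" "p \<in> cdom c"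
    and \<sigma>: "\<sigma> = 1 \<or> \<sigma> = -1" and ext: "\<And>x. x \<in> M \<Longrightarrow> \<sigma> * f p \<le> \<sigma> * f x"
  shows "grad_vec (f \<circ> coord_inv c) (coord c p) = 0"
proof -
  let ?V = "coord c ` cdom c" and ?F = "f \<circ> coord_inv c" and ?y = "coord c p"
  have y: "?y \<in> ?V" using c by blast
  note ch = chartD[OF c(1)]
  have "(\<lambda>h. grad_vec ?F ?y \<bullet> h) = (\<lambda>v. 0)"
  proof (rule differential_zero_maxmin[OF y chart_open[OF ch] chart_gradient(1)[OF f c(1) y]])
    have "\<sigma> * ?F ?y \<le> \<sigma> * ?F z" if "z \<in> ?V" for z
      using ext[of "coord_inv c z"] chart_coord_inv(1)[OF that] chart_sub[OF ch] chart_inv_coord[OF ch c(2)] by auto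
    thus "(\<forall>z\<in>?V. ?F z \<le> ?F ?y) \<or> (\<forall>z\<in>?V. ?F ?y \<le> ?F z)" using \<sigma> by auto
  qed
  from fun_cong[OF this, of "grad_vec ?F ?y"] show ?thesis by simp
qed

lemma extremum_grad_norm_zero:
  fixes \<sigma> :: real
  assumes f: "smooth_fun A f M" and p: "p \<in> M"
    and \<sigma>: "\<sigma> = 1 \<or> \<sigma> = -1" and ext: "\<And>x. x \<in> M \<Longrightarrow> \<sigma> * f p \<le> \<sigma> * f x"
  shows "grad_norm_sq A g f p = 0"
proof -
  define c where "c = chart_at A p"
  have c: "c \<in> A" "p \<in> cdom c" using chart_at p by (auto simp: c_def)
  have y: "coord c p \<in> coord c ` cdom c" using c by blast
  show ?thesis
    using grad_norm_in_chart[OF f c(1) y] extremum_gradient_zero[OF f c \<sigma> ext]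
      chart_inv_coord[OF chartD[OF c(1)] c(2)] by simp
qed

text \<open>At an extremum the Laplacian is \<open>- trace (B H)\<close> in any chart, since the derivatives of the metric are
multiplied by the vanishing gradient.  The factor \<open>\<sigma>\<close> is \<open>1\<close> at minima and \<open>-1\<close> at maxima, so that
\<open>\<sigma> (f - f p)\<close> is non-negative in both cases.  The slice chart provided by the codimension need not be the
chart in which the Laplacian at \<open>p\<close> is computed; the transition map between them plays the role of \<open>T\<close> in
\<open>trace_hessian_ge_codimension\<close>.\<close>

lemma focal_laplacian_ge_codimension:
  fixes \<sigma> :: real
  assumes f: "smooth_fun A f M" and gn: "\<And>x. x \<in> M \<Longrightarrow> grad_norm_sq A g f x = b (f x)"
    and b: "Ck_on 2 b UNIV" and p: "p \<in> M" "b (f p) = 0"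
    and \<sigma>: "\<sigma> = 1 \<or> \<sigma> = -1" and ext: "\<And>x. x \<in> M \<Longrightarrow> \<sigma> * f p \<le> \<sigma> * f x"
    and codim: "submanifold_codim_at A {x\<in>M. f x = f p} p k"
    and pos: "\<sigma> * deriv b (f p) > 0"
  shows "\<sigma> * deriv b (f p) / 2 * real k \<le> - \<sigma> * laplace_beltrami A g f p"
proof -
  define c0 where "c0 = chart_at A p"
  have c0: "c0 \<in> A" "p \<in> cdom c0" using chart_at p by (auto simp: c0_def)
  note ch0 = chartD[OF c0(1)]
  obtain c I where c: "c \<in> A" "p \<in> cdom c" and I: "card I = k"
    and slice: "coord c ` (cdom c \<inter> {x\<in>M. f x = f p}) = {y \<in> coord c ` cdom c. \<forall>i\<in>I. y $ i = 0}"
    using codim unfolding submanifold_codim_at_def by blast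
  let ?V = "coord c0 ` (cdom c0 \<inter> cdom c)" and ?Ff = "f \<circ> coord_inv c0" and ?y = "coord c0 p"
  let ?F = "\<lambda>z. \<sigma> * (?Ff z - f p)" and ?G = "\<lambda>z. \<sigma> *\<^sub>R grad_vec ?Ff z"
  have V: "open ?V" "?y \<in> ?V"
    using chartD[OF c(1)] ch0 c c0 by (auto intro!: chart_image_open simp: is_chart_def)
  have y: "?y \<in> coord c0 ` cdom c0" using c0 by blast
  have zV: "z \<in> coord c0 ` cdom c0" "coord_inv c0 z \<in> cdom c" "coord_inv c0 z \<in> M" if "z \<in> ?V" for z
    using that chart_inv_coord[OF ch0] chart_sub[OF ch0] by auto
  have py: "coord_inv c0 ?y = p" using chart_inv_coord[OF ch0 c0(2)] .
  obtain H where H: "(grad_vec ?Ff has_derivative ((*v) H)) (at ?y)" using chart_gradient(2)[OF f c0(1) y] by blast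
  have G0: "grad_vec ?Ff ?y = 0" by (rule extremum_gradient_zero[OF f c0 \<sigma> ext])
  have ss: "\<sigma> * \<sigma> = 1" using \<sigma> by auto
  have scaleH: "\<sigma> *\<^sub>R (H *v h) = (\<sigma> *\<^sub>R H) *v h" for h by (simp add: scaleR_matrix_vector_assoc)
  have "(\<sigma> * deriv b (f p)) / 2 * real (card I) \<le> trace (matrix_inv (g c0 ?y) ** (\<sigma> *\<^sub>R H))"
  proof (rule trace_hessian_ge_codimension[OF V, where F="?F" and G="?G" and b="\<lambda>s. b (f p + \<sigma> * s)"
        and T="coord c \<circ> coord_inv c0" and D="jacobian c0 c p" and B="\<lambda>z. matrix_inv (g c0 z)"])
    show "(?F has_derivative (\<lambda>h. ?G z \<bullet> h)) (at z)" if z: "z \<in> ?V" for z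
      by (rule has_derivative_eq_rhs[OF has_derivative_mult_right[OF has_derivative_diff[OF
              chart_gradient(1)[OF f c0(1) zV(1)[OF z]] has_derivative_const]]]) (simp add: fun_eq_iff)
    show "(?G has_derivative ((*v) (\<sigma> *\<^sub>R H))) (at ?y)"
      using has_derivative_scaleR_right[OF H, of \<sigma>] by (simp add: scaleH)
    show "?G ?y = 0" by (simp add: G0)
    show "?F ?y = 0" by (simp add: py)
    show "?F z \<ge> 0" if "z \<in> ?V" for z using ext[OF zV(3)[OF that]] by (simp add: algebra_simps)
    show "?G z \<bullet> (matrix_inv (g c0 z) *v ?G z) = b (f p + \<sigma> * ?F z)" if z: "z \<in> ?V" for z
    proof -
      have "?G z \<bullet> (matrix_inv (g c0 z) *v ?G z)
          = (\<sigma> * \<sigma>) * (grad_vec ?Ff z \<bullet> (matrix_inv (g c0 z) *v grad_vec ?Ff z))"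
        by (simp add: matrix_vector_mult_scaleR)
      also have "\<dots> = b (?Ff z)"
        using grad_norm_in_chart[OF f c0(1) zV(1)[OF z]] gn[OF zV(3)[OF z]] by (simp add: ss)
      also have "?Ff z = f p + \<sigma> * ?F z" using ss by (simp add: mult.assoc[symmetric])
      finally show ?thesis .
    qed
    show "b (f p + \<sigma> * 0) = 0" using p by simp
    have 1: "(b has_real_derivative deriv b (f p)) (at (f p + \<sigma> * 0))" using Ck_on_2_real(1)[OF b] by simp
    have 2: "((\<lambda>s. f p + \<sigma> * s) has_real_derivative \<sigma>) (at 0)" by (auto intro!: derivative_eq_intros)
    show "((\<lambda>s. b (f p + \<sigma> * s)) has_real_derivative \<sigma> * deriv b (f p)) (at 0)"
      using DERIV_chain2[where f=b and g="\<lambda>s. f p + \<sigma> * s", OF 1 2] by (simp only: mult.commute)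
    show "\<sigma> * deriv b (f p) > 0" by (rule pos)
    show "isCont (\<lambda>z. matrix_inv (g c0 z)) ?y" by (rule inverse_metric_isCont[OF c0(1) y])
    show "transpose (matrix_inv (g c0 ?y)) = matrix_inv (g c0 ?y)"
      using metric_posdef[OF c0(1) y] by (intro matrix_inv_symmetric) auto
    show "v \<noteq> 0 \<Longrightarrow> v \<bullet> (matrix_inv (g c0 ?y) *v v) > 0" for v
      using metric_posdef(2)[OF c0(1) y] by (rule matrix_inv_posdef)
    show "((coord c \<circ> coord_inv c0) has_derivative (*v) (jacobian c0 c p)) (at ?y)" "det (jacobian c0 c p) \<noteq> 0"
      using transition[OF c0(1) c(1) c0(2) c(2)] .
    show "(coord c \<circ> coord_inv c0) z $ i = 0" if z: "z \<in> ?V" "?F z = 0" and i: "i \<in> I" for z i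
    proof -
      have "f (coord_inv c0 z) = f p" using z(2) \<sigma> by auto
      hence "coord c (coord_inv c0 z) \<in> coord c ` (cdom c \<inter> {x\<in>M. f x = f p})" using zV[OF z(1)] by blast
      thus ?thesis using i unfolding slice by simp
    qed
  qed
  also have "trace (matrix_inv (g c0 ?y) ** (\<sigma> *\<^sub>R H)) = \<sigma> * trace (matrix_inv (g c0 ?y) ** H)"
    by (simp add: trace_def matrix_matrix_mult_def sum_distrib_left mult_ac)
  also have "trace (matrix_inv (g c0 ?y) ** H) = - laplace_beltrami A g f p"
    using div_grad_at_critical_point[OF c0(1) y H G0] by (simp add: laplace_beltrami_def Let_def c0_def)
  finally show ?thesis by (simp add: I)
qed

text \<open>Along the straight line through \<open>x0\<close> in the direction of the coordinate gradient, \<open>f\<close> is strictly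
increasing near \<open>x0\<close>, so \<open>\<phi>\<close> can be recovered from the values of \<open>u\<close> and \<open>f\<close> on this line.\<close>

lemma level_function_twice_differentiable:
  assumes f: "smooth_fun A f M" and x0: "x0 \<in> M" "f x0 \<in> J" and J: "open J"
    and gn: "grad_norm_sq A g f x0 \<noteq> 0"
    and u: "Ck_fun A 2 u {x\<in>M. f x \<in> J}" and \<phi>: "\<And>x. x \<in> M \<Longrightarrow> \<phi> (f x) = u x"
  shows "\<exists>D. (\<forall>\<^sub>F t in nhds (f x0). (\<phi> has_real_derivative D t) (at t)) \<and> D differentiable (at (f x0))"
proof -
  define c where "c = chart_at A x0"
  have c: "c \<in> A" "x0 \<in> cdom c" using chart_at x0 by (auto simp: c_def)
  note ch = chartD[OF c(1)]
  let ?V = "coord c ` cdom c" and ?y = "coord c x0"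
  let ?F = "f \<circ> coord_inv c" and ?u = "u \<circ> coord_inv c"
  have y: "?y \<in> ?V" using c by blast
  have xy: "coord_inv c ?y = x0" using chart_inv_coord[OF ch c(2)] .
  define v where "v = grad_vec ?F ?y"
  have v: "v \<noteq> 0"
    using grad_norm_in_chart[OF f c(1) y] gn by (auto simp: xy v_def)
  let ?l = "\<lambda>t::real. ?y + t *\<^sub>R v"
  have dl: "(?l has_derivative (\<lambda>s. s *\<^sub>R v)) (at t)" for t by (auto intro!: derivative_eq_intros)
  have along: "((\<lambda>t. w (?l t)) has_real_derivative grad_vec w (?l t) \<bullet> v) (at t)"
    if "(w has_derivative (\<lambda>h. grad_vec w (?l t) \<bullet> h)) (at (?l t))" for w t
    using has_derivative_compose[OF dl that]
    unfolding has_field_derivative_def by (rule has_derivative_eq_rhs) (auto simp: fun_eq_iff)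
  have along2: "(\<lambda>t. grad_vec w (?l t) \<bullet> v) differentiable (at 0)"
    if ex: "\<exists>H. (grad_vec w has_derivative ((*v) H)) (at ?y)" for w
  proof -
    obtain H where "(grad_vec w has_derivative ((*v) H)) (at ?y)" using ex by blast
    hence "(grad_vec w has_derivative ((*v) H)) (at (?l 0))" by simp
    from has_derivative_inner_left[OF has_derivative_compose[OF dl this], of v]
    show ?thesis by (auto simp: differentiable_def)
  qed
  let ?W = "coord c ` (cdom c \<inter> {x\<in>M. f x \<in> J})"
  have W: "open ?W" "?y \<in> ?W"
  proof -
    have "openin (top_of_set M) (cdom c \<inter> {x\<in>M. f x \<in> J})"
    proof (rule openin_Int)
      show "openin (top_of_set M) (cdom c)" using ch by (simp add: is_chart_def)
      have "{x\<in>M. f x \<in> J} = M \<inter> f -` J" by auto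
      thus "openin (top_of_set M) {x\<in>M. f x \<in> J}"
        using continuous_openin_preimage_gen[OF smooth_fun_continuous[OF f] J] by simp
    qed
    thus "open ?W" by (rule chart_image_open[OF ch]) auto
    show "?y \<in> ?W" using c x0 by blast
  qed
  have WV: "z \<in> ?W \<Longrightarrow> z \<in> ?V" for z by blast
  have u2: "Ck_on 2 ?u ?W" using u c(1) by (auto simp: Ck_fun_def)
  have "isCont (\<lambda>t. grad_vec ?F (?l t) \<bullet> v) 0"
    using along2[OF chart_gradient(2)[OF f c(1) y]] by (rule differentiable_imp_continuous_within)
  hence "((\<lambda>t. grad_vec ?F (?l t) \<bullet> v) \<longlongrightarrow> v \<bullet> v) (nhds 0)"
    using tendsto_at_iff_tendsto_nhds[of "\<lambda>t. grad_vec ?F (?l t) \<bullet> v" 0] by (simp add: isCont_def v_def)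
  hence e1: "\<forall>\<^sub>F t in nhds 0. grad_vec ?F (?l t) \<bullet> v > 0" using v by (intro order_tendstoD(1)) auto
  have "isCont ?l 0" by (intro continuous_intros)
  hence "(?l \<longlongrightarrow> ?l 0) (nhds 0)" using tendsto_at_iff_tendsto_nhds[of ?l 0] by (simp add: isCont_def)
  hence e2: "\<forall>\<^sub>F t in nhds 0. ?l t \<in> ?W" using W by (intro topological_tendstoD) auto
  have "\<forall>\<^sub>F t in nhds 0. grad_vec ?F (?l t) \<bullet> v > 0 \<and> ?l t \<in> ?W" using e1 e2 by eventually_elim simp
  then obtain \<delta> where \<delta>: "\<delta> > 0" "\<And>t. \<bar>t\<bar> < \<delta> \<Longrightarrow> grad_vec ?F (?l t) \<bullet> v > 0 \<and> ?l t \<in> ?W"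
    unfolding eventually_nhds_metric by (auto simp: dist_real_def)
  have "\<exists>D. (\<forall>\<^sub>F t in nhds ((\<lambda>t. ?F (?l t)) 0). (\<phi> has_real_derivative D t) (at t)) \<and> D differentiable (at ((\<lambda>t. ?F (?l t)) 0))"
  proof (rule twice_differentiable_reparametrization[OF \<delta>(1), where U="\<lambda>t. ?u (?l t)"
      and h'="\<lambda>t. grad_vec ?F (?l t) \<bullet> v" and U'="\<lambda>t. grad_vec ?u (?l t) \<bullet> v"])
    fix t :: real assume t: "\<bar>t\<bar> < \<delta>"
    note tW = conjunct2[OF \<delta>(2)[OF t]]
    show "((\<lambda>t. ?F (?l t)) has_real_derivative grad_vec ?F (?l t) \<bullet> v) (at t)"
      by (rule along[OF chart_gradient(1)[OF f c(1) WV[OF tW]]])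
    show "grad_vec ?F (?l t) \<bullet> v > 0" using \<delta>(2)[OF t] by blast
    show "((\<lambda>t. ?u (?l t)) has_real_derivative grad_vec ?u (?l t) \<bullet> v) (at t)"
      by (rule along[OF Ck_on_2_gradient(2)[OF u2 tW]])
    have "coord_inv c (?l t) \<in> M" using chart_coord_inv(1)[OF WV[OF tW]] chart_sub[OF ch] by blast
    thus "\<phi> (?F (?l t)) = ?u (?l t)" using \<phi> by simp
  next
    show "(\<lambda>t. grad_vec ?F (?l t) \<bullet> v) differentiable (at 0)" by (rule along2[OF chart_gradient(2)[OF f c(1) y]])
    show "(\<lambda>t. grad_vec ?u (?l t) \<bullet> v) differentiable (at 0)" by (rule along2[OF Ck_on_2_gradient(3)[OF u2 W(2)]])
  qed
  thus ?thesis by (simp add: xy)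
qed

lemma laplace_beltrami_composition:
  assumes f: "smooth_fun A f M" and x0: "x0 \<in> M" "f x0 \<in> J" and J: "open J"
    and u: "\<And>x. x \<in> M \<Longrightarrow> \<phi> (f x) = u x"
    and \<phi>: "\<And>t. t \<in> J \<Longrightarrow> (\<phi> has_real_derivative \<phi>' t) (at t)"
    and \<phi>': "(\<phi>' has_real_derivative \<phi>2) (at (f x0))"
  shows "laplace_beltrami A g u x0 =
    \<phi>' (f x0) * laplace_beltrami A g f x0 - \<phi>2 * grad_norm_sq A g f x0"
proof -
  define c where "c = chart_at A x0"
  have c: "c \<in> A" "x0 \<in> cdom c" using chart_at x0 by (auto simp: c_def)
  note ch = chartD[OF c(1)]
  let ?y = "coord c x0" and ?F = "f \<circ> coord_inv c"
  have y: "?y \<in> coord c ` cdom c" using c by blast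
  have xy: "coord_inv c ?y = x0" using chart_inv_coord[OF ch c(2)] .
  let ?W = "coord c ` cdom c \<inter> ?F -` J"
  have W: "open ?W"
    using continuous_open_preimage[OF Ck_on_2_continuous[OF smooth_fun_Ck2[OF f c(1)]] chart_open[OF ch] J] .
  have yW: "?y \<in> ?W" using y xy x0 by simp
  obtain H where H: "(grad_vec ?F has_derivative ((*v) H)) (at ?y)" using chart_gradient(2)[OF f c(1) y] by blast
  have "div_coord g c (grad_coord g c u) ?y = \<phi>' (f (coord_inv c ?y)) * div_coord g c (grad_coord g c f) ?y
     + \<phi>2 * (grad_vec ?F ?y \<bullet> (matrix_inv (g c ?y) *v grad_vec ?F ?y))"
  proof (rule div_grad_composition[OF c(1) y W yW _ _ H])
    fix z assume z: "z \<in> ?W"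
    show "(?F has_derivative (\<lambda>h. grad_vec ?F z \<bullet> h)) (at z)" using z by (intro chart_gradient(1)[OF f c(1)]) blast
    have "z \<in> coord c ` cdom c" using z by blast
    from chart_coord_inv(1)[OF this] have "coord_inv c z \<in> M" using chart_sub[OF ch] by blast
    thus "u (coord_inv c z) = \<phi> (f (coord_inv c z))" using u by simp
    show "(\<phi> has_real_derivative \<phi>' (f (coord_inv c z))) (at (f (coord_inv c z)))" using z by (intro \<phi>) simp
  qed (use \<phi>' xy in auto)
  also have "grad_vec ?F ?y \<bullet> (matrix_inv (g c ?y) *v grad_vec ?F ?y) = grad_norm_sq A g f x0"
    using grad_norm_in_chart[OF f c(1) y] by (simp add: xy)
  finally show ?thesis by (simp add: laplace_beltrami_def Let_def c_def[symmetric] xy)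
qed

end

section \<open>The differential inequality on the interval of values\<close>

lemma second_derivative_nonneg_at_minimum:
  fixes w w' :: "real \<Rightarrow> real"
  assumes x: "z < x" "x < s"
    and min: "\<And>y. z < y \<Longrightarrow> y < s \<Longrightarrow> w x \<le> w y"
    and w: "\<And>y. z < y \<Longrightarrow> y < s \<Longrightarrow> (w has_real_derivative w' y) (at y)"
    and w': "(w' has_real_derivative w2) (at x)"
  shows "w' x = 0" "w2 \<ge> 0"
proof -
  show 0: "w' x = 0"
    using x min by (intro DERIV_local_min[OF w[OF x], of "min (x - z) (s - x)"]) auto
  show "w2 \<ge> 0"
  proof (rule ccontr)
    assume "\<not> w2 \<ge> 0"
    then obtain d where d: "d > 0" "\<And>h. 0 < h \<Longrightarrow> h < d \<Longrightarrow> w' (x + h) < w' x"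
      using DERIV_neg_dec_right[OF w'] by force
    define h where "h = min (d / 2) ((s - x) / 2)"
    have h: "h > 0" "h < d" "x + h < s" using d x by (auto simp: h_def min_def field_simps)
    have "\<exists>y. x < y \<and> y < x + h \<and> w (x + h) - w x = (x + h - x) * w' y"
      using h x by (intro MVT2 w) auto
    then obtain y where y: "x < y" "y < x + h" "w (x + h) - w x = h * w' y" by auto
    have "w' (x + (y - x)) < w' x" using y h by (intro d(2)) auto
    hence "h * w' y < 0" using h 0 by (auto intro: mult_pos_neg)
    moreover have "w x \<le> w (x + h)" using h x by (intro min) auto
    ultimately show False using y by simp
  qed
qed

text \<open>At a negative interior minimum \<open>w' = 0\<close> and \<open>w'' \<ge> 0\<close>, against the assumption \<open>L\<close>.\<close>

lemma minimum_principle: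
  fixes w w' w'' a b :: "real \<Rightarrow> real"
  assumes "z < s" and cont: "continuous_on {z..s} w" and ends: "w z \<ge> 0" "w s \<ge> 0"
    and w: "\<And>x. z < x \<Longrightarrow> x < s \<Longrightarrow> (w has_real_derivative w' x) (at x)"
    and w': "\<And>x. z < x \<Longrightarrow> x < s \<Longrightarrow> (w' has_real_derivative w'' x) (at x)"
    and b: "\<And>x. z < x \<Longrightarrow> x < s \<Longrightarrow> b x \<ge> 0"
    and L: "\<And>x. z < x \<Longrightarrow> x < s \<Longrightarrow> w x < 0 \<Longrightarrow> b x * w'' x - a x * w' x < 0"
    and x: "z \<le> x" "x \<le> s"
  shows "w x \<ge> 0"
proof (rule ccontr)
  assume neg: "\<not> w x \<ge> 0"
  obtain y where y: "y \<in> {z..s}" "\<And>v. v \<in> {z..s} \<Longrightarrow> w y \<le> w v"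
    using continuous_attains_inf[of "{z..s}" w] cont \<open>z < s\<close> by force
  have wy: "w y < 0" using y(2)[of x] x neg by auto
  hence yi: "z < y" "y < s" using y(1) ends by (auto simp: less_le)
  have "w' y = 0" "w'' y \<ge> 0"
    using second_derivative_nonneg_at_minimum[of z y s w w' "w'' y"] yi y w w' by auto
  with L[OF yi wy] mult_nonneg_nonneg[OF b[OF yi], of "w'' y"] show False
    by simp
qed

text \<open>Hopf's lemma.  Let \<open>z\<close> be the last zero of \<open>\<phi>\<close> before a point \<open>s\<close> with \<open>\<phi> s > 0\<close>.  For large \<open>B\<close> the
function \<open>exp (B (x - z)) - 1\<close> is a subsolution, and a multiple of it lies below \<open>\<phi>\<close> on \<open>[z, s]\<close>.  Since its
slope at \<open>z\<close> is positive, so is that of \<open>\<phi>\<close>, although \<open>\<phi>\<close> has a minimum at \<open>z\<close>.\<close>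

lemma interior_zero_propagates_right:
  fixes \<phi> \<phi>' \<phi>'' a b :: "real \<Rightarrow> real"
  assumes phi: "\<And>x. t0 < x \<Longrightarrow> x < t1 \<Longrightarrow> (\<phi> has_real_derivative \<phi>' x) (at x)"
    and phi': "\<And>x. t0 < x \<Longrightarrow> x < t1 \<Longrightarrow> (\<phi>' has_real_derivative \<phi>'' x) (at x)"
    and nonneg: "\<And>x. t0 < x \<Longrightarrow> x < t1 \<Longrightarrow> \<phi> x \<ge> 0"
    and b: "\<And>x. t0 < x \<Longrightarrow> x < t1 \<Longrightarrow> b x > 0"
    and conta: "continuous_on {t0<..<t1} a" and contb: "continuous_on {t0<..<t1} b"
    and L: "\<And>x. t0 < x \<Longrightarrow> x < t1 \<Longrightarrow> b x * \<phi>'' x - a x * \<phi>' x \<le> C * \<phi> x"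
    and C: "C > 0"
    and z0: "t0 < z0" "z0 < s" "s < t1" "\<phi> z0 = 0"
  shows "\<phi> s = 0"
proof (rule ccontr)
  assume "\<phi> s \<noteq> 0"
  hence s: "\<phi> s > 0" using nonneg[of s] z0 by auto
  have contphi: "continuous_on {z0..s} \<phi>"
    using z0 by (auto intro!: continuous_at_imp_continuous_on DERIV_isCont phi)
  define Z where "Z = {x\<in>{z0..s}. \<phi> x = 0}"
  have "closed Z" unfolding Z_def
    by (rule continuous_closed_preimage_constant[OF contphi]) simp
  moreover have "Z = {z0..s} \<inter> Z" by (auto simp: Z_def)
  ultimately have "compact Z" by (metis compact_Icc compact_Int_closed)
  moreover have "z0 \<in> Z" using z0 by (simp add: Z_def)
  hence "Z \<noteq> {}" by auto
  ultimately obtain z where z: "z \<in> Z" "\<And>y. y \<in> Z \<Longrightarrow> y \<le> z" using compact_attains_sup[of Z] by blast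
  have zz: "z0 \<le> z" "z < s" "\<phi> z = 0" using z s by (auto simp: Z_def less_le)
  have "\<phi>' z = 0"
    using second_derivative_nonneg_at_minimum[of t0 z t1 \<phi> \<phi>' "\<phi>'' z"] zz z0 phi phi' nonneg by auto
  have sub: "{z..s} \<subseteq> {t0<..<t1}" using zz z0 by auto
  obtain x0 where x0: "x0 \<in> {z..s}" "\<And>y. y \<in> {z..s} \<Longrightarrow> b x0 \<le> b y"
    using continuous_attains_inf[of "{z..s}" b] continuous_on_subset[OF contb sub] zz by force
  obtain x1 where x1: "x1 \<in> {z..s}" "\<And>y. y \<in> {z..s} \<Longrightarrow> a y \<le> a x1"
    using continuous_attains_sup[of "{z..s}" a] continuous_on_subset[OF conta sub] zz by force
  define b0 where "b0 = b x0"
  define a1 where "a1 = \<bar>a x1\<bar>"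
  have b0: "b0 > 0" using b x0 sub by (auto simp: b0_def)
  \<comment> \<open>chosen so that \<open>B (B b - a) \<ge> C\<close> on \<open>[z, s]\<close>, which makes the barrier a subsolution\<close>
  define B where "B = (a1 + C) / b0 + 1"
  have B: "B > 0" "B \<ge> 1" "B * b0 \<ge> a1 + C"
    using b0 C by (auto simp: B_def a1_def field_simps)
  have Bx: "B * (B * b x - a x) \<ge> C" if "x \<in> {z..s}" for x
  proof -
    have "B * b x \<ge> B * b0" using x0 that B by (auto simp: b0_def)
    moreover have "a x \<le> a1" using x1 that by (force simp: a1_def)
    ultimately have "B * b x - a x \<ge> C" using B by linarith
    moreover from this have "B * (B * b x - a x) \<ge> 1 * (B * b x - a x)" using B C by (intro mult_right_mono) auto
    ultimately show ?thesis by (metis mult_1 order.trans)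
  qed
  define m where "m = \<phi> s / (exp (B * (s - z)) - 1)"
  have e: "exp (B * (s - z)) > 1" using B zz by simp
  have m: "m > 0" using s e by (simp add: m_def)
  define w where "w x = \<phi> x - m * (exp (B * (x - z)) - 1)" for x
  have wpos: "w x \<ge> 0" if "z \<le> x" "x \<le> s" for x
  proof (rule minimum_principle[where a=a and b=b and w=w and z=z and s=s
      and w'="\<lambda>x. \<phi>' x - m * B * exp (B * (x - z))" and w''="\<lambda>x. \<phi>'' x - m * B * B * exp (B * (x - z))"])
    show "continuous_on {z..s} w" unfolding w_def
      using zz by (auto intro!: continuous_intros continuous_on_subset[OF contphi])
    show "w z \<ge> 0" "w s \<ge> 0" using zz e by (auto simp: w_def m_def)
    fix x assume x: "z < x" "x < s"
    show "(w has_real_derivative \<phi>' x - m * B * exp (B * (x - z))) (at x)"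
      unfolding w_def using x zz z0 by (auto intro!: derivative_eq_intros phi)
    show "((\<lambda>x. \<phi>' x - m * B * exp (B * (x - z))) has_real_derivative \<phi>'' x - m * B * B * exp (B * (x - z))) (at x)"
      using x zz z0 by (auto intro!: derivative_eq_intros phi')
    show "b x \<ge> 0" using b[of x] x zz z0 by auto
    assume neg: "w x < 0"
    let ?e = "exp (B * (x - z))"
    have "C * (m * ?e) \<le> B * (B * b x - a x) * (m * ?e)"
      using Bx[of x] x m by (intro mult_right_mono) auto
    moreover have "b x * \<phi>'' x - a x * \<phi>' x \<le> C * \<phi> x" using L[of x] x zz z0 by auto
    moreover have "b x * (\<phi>'' x - m * B * B * ?e) - a x * (\<phi>' x - m * B * ?e)
        = (b x * \<phi>'' x - a x * \<phi>' x) - B * (B * b x - a x) * (m * ?e)" by (simp add: algebra_simps)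
    moreover have "C * \<phi> x - C * (m * ?e) = C * w x - C * m" by (simp add: w_def algebra_simps)
    moreover have "C * w x < 0" "C * m > 0" using C neg m by (auto simp: mult_pos_neg)
    ultimately show "b x * (\<phi>'' x - m * B * B * ?e) - a x * (\<phi>' x - m * B * ?e) < 0" by linarith
  qed (use that zz in auto)
  have "(w has_real_derivative \<phi>' z - m * B * exp (B * (z - z))) (at z)"
    unfolding w_def using zz z0 by (auto intro!: derivative_eq_intros phi)
  hence "(w has_real_derivative - (m * B)) (at z)" using \<open>\<phi>' z = 0\<close> by simp
  moreover have "- (m * B) < 0" using m B by simp
  ultimately obtain d where d: "d > 0" "\<And>h. 0 < h \<Longrightarrow> h < d \<Longrightarrow> w (z + h) < w z"
    using DERIV_neg_dec_right by blast
  define h where "h = min (d/2) (s - z)"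
  have "w (z + h) < w z" using d zz by (intro d(2)) (auto simp: h_def min_def)
  moreover have "w (z + h) \<ge> 0" using d zz by (intro wpos) (auto simp: h_def min_def)
  moreover have "w z = 0" using zz by (simp add: w_def)
  ultimately show False by simp
qed

lemma interior_zero_propagates:
  fixes \<phi> \<phi>' \<phi>'' a b :: "real \<Rightarrow> real"
  assumes phi: "\<And>x. t0 < x \<Longrightarrow> x < t1 \<Longrightarrow> (\<phi> has_real_derivative \<phi>' x) (at x)"
    and phi': "\<And>x. t0 < x \<Longrightarrow> x < t1 \<Longrightarrow> (\<phi>' has_real_derivative \<phi>'' x) (at x)"
    and nonneg: "\<And>x. t0 < x \<Longrightarrow> x < t1 \<Longrightarrow> \<phi> x \<ge> 0"
    and b: "\<And>x. t0 < x \<Longrightarrow> x < t1 \<Longrightarrow> b x > 0"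
    and conta: "continuous_on {t0<..<t1} a" and contb: "continuous_on {t0<..<t1} b"
    and L: "\<And>x. t0 < x \<Longrightarrow> x < t1 \<Longrightarrow> b x * \<phi>'' x - a x * \<phi>' x \<le> C * \<phi> x"
    and C: "C > 0"
    and z0: "t0 < z" "z < t1" "\<phi> z = 0" and s: "t0 < s" "s < t1"
  shows "\<phi> s = 0"
proof (cases z s rule: linorder_cases)
  case less
  then show ?thesis using interior_zero_propagates_right[OF phi phi' nonneg b conta contb L C] z0 s by blast
next
  case equal
  then show ?thesis using z0 by simp
next
  case greater
  have refl: "continuous_on {-t1<..<-t0} (\<lambda>x. h (-x))" if "continuous_on {t0<..<t1} h" for h :: "real \<Rightarrow> real"
    by (rule continuous_on_compose2[OF that]) (auto intro!: continuous_intros)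
  have 1: "((\<lambda>x. \<phi> (-x)) has_real_derivative - \<phi>' (-x)) (at x)" if "-t1 < x" "x < -t0" for x
  proof -
    have "(\<phi> has_real_derivative \<phi>' (-x)) (at (-x))" using that by (intro phi) auto
    thus ?thesis by (simp add: DERIV_mirror)
  qed
  have 2: "((\<lambda>x. - \<phi>' (-x)) has_real_derivative \<phi>'' (-x)) (at x)" if "-t1 < x" "x < -t0" for x
  proof -
    have "(\<phi>' has_real_derivative \<phi>'' (-x)) (at (-x))" using that by (intro phi') auto
    hence "((\<lambda>x. \<phi>' (-x)) has_real_derivative - \<phi>'' (-x)) (at x)" by (simp add: DERIV_mirror)
    from DERIV_minus[OF this] show ?thesis by simp
  qed
  have "\<phi> (- (- s)) = 0"
    using z0 s greater L[of "- x" for x]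
    by (intro interior_zero_propagates_right[of "-t1" "-t0" "\<lambda>x. \<phi> (-x)" "\<lambda>x. - \<phi>' (-x)" "\<lambda>x. \<phi>'' (-x)"
         "\<lambda>x. b (-x)" "\<lambda>x. - a (-x)" C "-z" "-s", OF 1 2 _ _ _ refl[OF contb]])
       (auto intro!: nonneg b refl conta continuous_on_minus simp: C)
  thus ?thesis by simp
qed

text \<open>Near \<open>t0\<close> the function \<open>1 + B (x - t0)\<close> is a subsolution that is positive at \<open>t0\<close>, and
\<open>G = ln (x - t0) + B' (x - t0)\<close> is a subsolution with limit \<open>- \<infinity>\<close> at \<open>t0\<close>; the latter is where
\<open>- a t0 \<ge> \<beta>\<close> is used, and the linear term of \<open>G\<close> absorbs the errors of the linearization at \<open>t0\<close>.  Adding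
\<open>\<epsilon> G\<close> makes the comparison with \<open>\<phi>\<close> trivial at \<open>t0\<close>, for every \<open>\<epsilon> > 0\<close>.  Letting \<open>\<epsilon>\<close> tend to \<open>0\<close> leaves a
positive lower bound for \<open>\<phi>\<close> up to the end point.\<close>

lemma singular_endpoint_positive:
  fixes \<phi> \<phi>' \<phi>'' a b :: "real \<Rightarrow> real"
  assumes t: "t0 < t1"
    and phi: "\<And>x. t0 < x \<Longrightarrow> x < t1 \<Longrightarrow> (\<phi> has_real_derivative \<phi>' x) (at x)"
    and phi': "\<And>x. t0 < x \<Longrightarrow> x < t1 \<Longrightarrow> (\<phi>' has_real_derivative \<phi>'' x) (at x)"
    and cont: "continuous_on {t0..<t1} \<phi>"
    and pos: "\<And>x. t0 < x \<Longrightarrow> x < t1 \<Longrightarrow> \<phi> x > 0"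
    and b: "\<And>x. t0 < x \<Longrightarrow> x < t1 \<Longrightarrow> b x \<ge> 0"
    and L: "\<And>x. t0 < x \<Longrightarrow> x < t1 \<Longrightarrow> b x * \<phi>'' x - a x * \<phi>' x \<le> C * \<phi> x"
    and C: "C > 0"
    and beta: "\<beta> > 0" "- a t0 \<ge> \<beta>"
    and b1: "\<And>x. t0 \<le> x \<Longrightarrow> x < t1 \<Longrightarrow> b x \<le> \<beta> * (x - t0) + A * (x - t0)\<^sup>2"
    and a1: "\<And>x. t0 \<le> x \<Longrightarrow> x < t1 \<Longrightarrow> \<bar>a x - a t0\<bar> \<le> A * (x - t0)"
  shows "\<phi> t0 > 0"
proof -
  have A: "A \<ge> 0"
  proof -
    have "t0 \<le> (t0 + t1) / 2" "(t0 + t1) / 2 < t1" using t by (simp_all add: field_simps)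
    from a1[OF this] have "0 \<le> A * ((t0 + t1) / 2 - t0)" by linarith
    moreover have "(t0 + t1) / 2 - t0 > 0" using t by (simp add: field_simps)
    ultimately show ?thesis by (simp add: zero_le_mult_iff)
  qed
  define B where "B = 4 * C / \<beta>"
  define B' where "B' = 4 * A / \<beta>"
  have B: "B > 0" "B' \<ge> 0" using A C beta by (auto simp: B_def B'_def)
  \<comment> \<open>small enough that \<open>- a \<ge> \<beta> / 2\<close>, \<open>B (x - t0) \<le> 1\<close> and \<open>G \<le> 0\<close> on the interval of length \<open>\<delta>\<close>\<close>
  define \<delta> where "\<delta> = Min {(t1 - t0) / 2, 1 / B, \<beta> / (2 * A + 1), 1 / 2, 1 / (2 * B' + 1)}"
  have dl: "\<delta> \<le> (t1 - t0) / 2" "\<delta> \<le> 1 / B" "\<delta> \<le> \<beta> / (2 * A + 1)" "\<delta> \<le> 1 / 2" "\<delta> \<le> 1 / (2 * B' + 1)"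
    unfolding \<delta>_def by (intro Min_le; simp)+
  have d0: "\<delta> > 0" unfolding \<delta>_def using t B A beta by auto
  have d1: "t0 + \<delta> < t1" using dl(1) t by (simp add: field_simps)
  have dB: "B * \<delta> \<le> 1" using dl(2) B by (simp add: field_simps)
  have dA: "2 * (A * \<delta>) \<le> \<beta>" using dl(3) d0 A by (simp add: field_simps)
  have dB': "B' * \<delta> \<le> 1 / 2" using dl(5) d0 B by (simp add: field_simps)
  \<comment> \<open>the factor \<open>1 / 2\<close> leaves room for \<open>1 + B \<delta> \<le> 2\<close> at the right end point\<close>
  define m where "m = \<phi> (t0 + \<delta>) / 2"
  have m: "m > 0" using pos[of "t0 + \<delta>"] d0 d1 by (auto simp: m_def)
  define G where "G x = ln (x - t0) + B' * (x - t0)" for x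
  have G: "G x \<le> 0" if "t0 < x" "x \<le> t0 + \<delta>" for x
  proof -
    have "ln (x - t0) \<le> (x - t0) - 1" using that by (intro ln_le_minus_one) auto
    moreover have "x - t0 \<le> 1/2" using that dl(4) by linarith
    moreover have "B' * (x - t0) \<le> B' * \<delta>" using that B by (intro mult_left_mono) auto
    ultimately show ?thesis using dB' unfolding G_def by linarith
  qed
  have na: "- a x \<ge> \<beta> - A * (x - t0)" "- a x \<ge> \<beta> / 2" if "t0 < x" "x \<le> t0 + \<delta>" for x
  proof -
    show 1: "- a x \<ge> \<beta> - A * (x - t0)" using a1[of x] that d1 beta by linarith
    have "A * (x - t0) \<le> A * \<delta>" using that A by (intro mult_left_mono) auto
    with 1 dA show "- a x \<ge> \<beta> / 2" by linarith
  qed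
  have LG: "b x * (- 1 / (x - t0)\<^sup>2) - a x * (1 / (x - t0) + B') \<ge> 0" if x: "t0 < x" "x \<le> t0 + \<delta>" for x
  proof -
    let ?r = "x - t0"
    have r: "?r > 0" using x by simp
    have "b x \<le> \<beta> * ?r + A * ?r\<^sup>2" using b1[of x] x d1 by auto
    hence "b x / ?r\<^sup>2 \<le> (\<beta> * ?r + A * ?r\<^sup>2) / ?r\<^sup>2" by (intro divide_right_mono) auto
    also have "\<dots> = \<beta> / ?r + A" using r by (simp add: add_divide_distrib power2_eq_square)
    finally have 1: "b x / ?r\<^sup>2 \<le> \<beta> / ?r + A" .
    have "(\<beta> - A * ?r) * (1 / ?r) \<le> (- a x) * (1 / ?r)" using na(1)[OF x] r by (intro mult_right_mono) auto
    moreover have "(\<beta> - A * ?r) * (1 / ?r) = \<beta> / ?r - A" using r by (simp add: field_simps)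
    moreover have "(\<beta> / 2) * B' \<le> (- a x) * B'" using na(2)[OF x] B by (intro mult_right_mono) auto
    moreover have "(\<beta> / 2) * B' = 2 * A" using beta by (simp add: B'_def)
    moreover have "b x * (- 1 / ?r\<^sup>2) - a x * (1 / ?r + B') = - (b x / ?r\<^sup>2) + (- a x) * (1 / ?r) + (- a x) * B'"
      by (simp add: algebra_simps)
    ultimately show ?thesis using 1 by linarith
  qed
  have main: "\<phi> x \<ge> m" if x: "t0 < x" "x < t0 + \<delta>" for x
  proof -
    have step: "\<phi> x - m * (1 + B * (x - t0)) - \<epsilon> * G x \<ge> 0" if eps: "\<epsilon> > 0" for \<epsilon>
    proof -
      have "filterlim (\<lambda>z. G z) at_bot (at_right t0)"
      proof -
        have "filterlim (\<lambda>z. z - t0) (at_right 0) (at_right t0)"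
          by (auto simp: filterlim_at eventually_at_right_less intro!: tendsto_eq_intros)
             (auto simp: eventually_at intro!: exI[of _ 1])
        from filterlim_compose[OF ln_at_0 this]
        have 1: "filterlim (\<lambda>z. ln (z - t0)) at_bot (at_right t0)" .
        have 2: "((\<lambda>z. B' * (z - t0)) \<longlongrightarrow> B' * (t0 - t0)) (at_right t0)" by (intro tendsto_intros)
        show ?thesis unfolding G_def
          using filterlim_tendsto_add_at_top[OF tendsto_minus[OF 2], of "\<lambda>z. - ln (z - t0)"] 1
          by (simp add: filterlim_uminus_at_bot add.commute)
      qed
      hence "eventually (\<lambda>z. G z \<le> - (2 * m / \<epsilon>)) (at_right t0)" by (simp add: filterlim_at_bot)
      moreover have "eventually (\<lambda>z. z \<in> {t0<..<x}) (at_right t0)" using x by (intro eventually_at_right_real) auto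
      ultimately have "eventually (\<lambda>z. G z \<le> - (2 * m / \<epsilon>) \<and> z \<in> {t0<..<x}) (at_right t0)"
        by (rule eventually_conj)
      then obtain z where z: "G z \<le> - (2 * m / \<epsilon>)" "t0 < z" "z < x"
        using eventually_happens'[OF trivial_limit_at_right_real] by force
      let ?w = "\<lambda>x. \<phi> x - m * (1 + B * (x - t0)) - \<epsilon> * G x"
      have mB: "m * (1 + B * (y - t0)) \<le> 2 * m" if "y \<le> t0 + \<delta>" for y
      proof -
        have "B * (y - t0) \<le> B * \<delta>" using that B by (intro mult_left_mono) auto
        hence "m * (1 + B * (y - t0)) \<le> m * 2" using m dB by (intro mult_left_mono) auto
        thus ?thesis by simp
      qed
      have zt: "z < t1" "z \<le> t0 + \<delta>" using z x d1 by auto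
      show ?thesis
      proof (rule minimum_principle[where a=a and b=b and w="?w" and z=z and s="t0 + \<delta>"
        and w'="\<lambda>x. \<phi>' x - m * B - \<epsilon> * (1 / (x - t0) + B')" and w''="\<lambda>x. \<phi>'' x - \<epsilon> * (- 1 / (x - t0)\<^sup>2)"])
        show "continuous_on {z..t0 + \<delta>} ?w" unfolding G_def using z d1
          by (auto intro!: continuous_intros continuous_on_subset[OF cont])
        have "\<epsilon> * G z \<le> \<epsilon> * (- (2 * m / \<epsilon>))" using z eps by (intro mult_left_mono) auto
        hence "\<epsilon> * G z \<le> - 2 * m" using eps by simp
        moreover have "\<phi> z > 0" using pos z zt by auto
        ultimately show "?w z \<ge> 0" using mB[of z] zt by linarith
        have "\<epsilon> * G (t0 + \<delta>) \<le> 0" using G[of "t0 + \<delta>"] d0 eps by (simp add: mult_le_0_iff)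
        moreover have "\<phi> (t0 + \<delta>) = 2 * m" by (simp add: m_def)
        ultimately show "?w (t0 + \<delta>) \<ge> 0" using mB[of "t0 + \<delta>"] by simp
        fix y assume y: "z < y" "y < t0 + \<delta>"
        hence y': "t0 < y" "y < t1" "y \<le> t0 + \<delta>" using z d1 by auto
        show "(?w has_real_derivative \<phi>' y - m * B - \<epsilon> * (1 / (y - t0) + B')) (at y)"
          unfolding G_def using y' by (auto intro!: derivative_eq_intros phi)
        show "((\<lambda>x. \<phi>' x - m * B - \<epsilon> * (1 / (x - t0) + B')) has_real_derivative \<phi>'' y - \<epsilon> * (- 1 / (y - t0)\<^sup>2)) (at y)"
          using y' by (auto intro!: derivative_eq_intros phi' simp: power2_eq_square)
        show "b y \<ge> 0" using b y' by auto
        assume neg: "?w y < 0"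
        have e1: "b y * (\<phi>'' y - \<epsilon> * (- 1 / (y - t0)\<^sup>2)) - a y * (\<phi>' y - m * B - \<epsilon> * (1 / (y - t0) + B'))
           = (b y * \<phi>'' y - a y * \<phi>' y) - (- a y) * (m * B)
             - \<epsilon> * (b y * (- 1 / (y - t0)\<^sup>2) - a y * (1 / (y - t0) + B'))" by (simp add: algebra_simps)
        have e2: "\<epsilon> * (b y * (- 1 / (y - t0)\<^sup>2) - a y * (1 / (y - t0) + B')) \<ge> 0"
          using LG[of y] y' eps by simp
        have "(\<beta> / 2) * (m * B) \<le> (- a y) * (m * B)" using na(2)[of y] y' m B by (intro mult_right_mono) auto
        moreover have "(\<beta> / 2) * (m * B) = C * (2 * m)" using beta by (simp add: B_def)
        moreover have "C * (m * (1 + B * (y - t0))) \<le> C * (2 * m)" using mB[of y] y' C by (intro mult_left_mono) auto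
        moreover have "C * \<phi> y < C * (m * (1 + B * (y - t0)))"
        proof -
          have "\<epsilon> * G y \<le> 0" using G[of y] y' eps by (simp add: mult_le_0_iff)
          thus ?thesis using neg C by (intro mult_strict_left_mono) auto
        qed
        ultimately show "b y * (\<phi>'' y - \<epsilon> * (- 1 / (y - t0)\<^sup>2)) - a y * (\<phi>' y - m * B - \<epsilon> * (1 / (y - t0) + B')) < 0"
          unfolding e1 using e2 L[of y] y' by linarith
      qed (use z x in auto)
    qed
    have "((\<lambda>\<epsilon>. \<phi> x - m * (1 + B * (x - t0)) - \<epsilon> * G x) \<longlongrightarrow> \<phi> x - m * (1 + B * (x - t0)) - 0 * G x) (at_right 0)"
      by (intro tendsto_intros)
    moreover have "eventually (\<lambda>\<epsilon>. \<phi> x - m * (1 + B * (x - t0)) - \<epsilon> * G x \<ge> 0) (at_right 0)"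
      using step by (auto simp: eventually_at intro!: exI[of _ 1])
    ultimately have "\<phi> x - m * (1 + B * (x - t0)) - 0 * G x \<ge> 0"
      by (rule tendsto_lowerbound) simp
    moreover have "m * (B * (x - t0)) \<ge> 0" using m B x by simp
    ultimately show ?thesis by (simp add: algebra_simps)
  qed
  have "continuous_on {t0..t0 + \<delta>} \<phi>" using d1 by (auto intro: continuous_on_subset[OF cont])
  hence "(\<phi> \<longlongrightarrow> \<phi> t0) (at_right t0)" using d0 by (intro continuous_on_Icc_at_rightD) auto
  moreover have "eventually (\<lambda>x. x \<in> {t0<..<t0 + \<delta>}) (at_right t0)" using d0 by (intro eventually_at_right_real) auto
  hence "eventually (\<lambda>x. \<phi> x \<ge> m) (at_right t0)" by eventually_elim (auto intro: main)
  ultimately have "\<phi> t0 \<ge> m" by (rule tendsto_lowerbound) simp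
  with m show ?thesis by simp
qed

text \<open>The same with estimates that are only local, in a form that is invariant under the reflection
\<open>t \<mapsto> - t\<close>.\<close>

lemma singular_endpoint_positive_local:
  fixes \<phi> \<phi>' \<phi>'' a b :: "real \<Rightarrow> real"
  assumes t: "t0 < t1"
    and phi: "\<And>x. t0 < x \<Longrightarrow> x < t1 \<Longrightarrow> (\<phi> has_real_derivative \<phi>' x) (at x)"
    and phi': "\<And>x. t0 < x \<Longrightarrow> x < t1 \<Longrightarrow> (\<phi>' has_real_derivative \<phi>'' x) (at x)"
    and cont: "continuous_on {t0..t1} \<phi>"
    and pos: "\<And>x. t0 < x \<Longrightarrow> x < t1 \<Longrightarrow> \<phi> x > 0"
    and b: "\<And>x. t0 < x \<Longrightarrow> x < t1 \<Longrightarrow> b x \<ge> 0"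
    and L: "\<And>x. t0 < x \<Longrightarrow> x < t1 \<Longrightarrow> b x * \<phi>'' x - a x * \<phi>' x \<le> C * \<phi> x"
    and C: "C > 0"
    and beta: "\<beta> > 0" "- a t0 \<ge> \<beta>"
    and b1: "\<exists>B \<delta>. \<delta> > 0 \<and> (\<forall>x. \<bar>x - t0\<bar> < \<delta> \<longrightarrow> \<bar>b x - \<beta> * (x - t0)\<bar> \<le> B * (x - t0)\<^sup>2)"
    and a1: "\<exists>B \<delta>. \<delta> > 0 \<and> (\<forall>x. \<bar>x - t0\<bar> < \<delta> \<longrightarrow> \<bar>a x - a t0\<bar> \<le> B * \<bar>x - t0\<bar>)"
  shows "\<phi> t0 > 0"
proof -
  obtain B \<delta> where B: "\<delta> > 0" "\<And>x. \<bar>x - t0\<bar> < \<delta> \<Longrightarrow> \<bar>b x - \<beta> * (x - t0)\<bar> \<le> B * (x - t0)\<^sup>2"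
    using b1 by blast
  obtain B' \<delta>' where B': "\<delta>' > 0" "\<And>x. \<bar>x - t0\<bar> < \<delta>' \<Longrightarrow> \<bar>a x - a t0\<bar> \<le> B' * \<bar>x - t0\<bar>"
    using a1 by blast
  define t2 where "t2 = min t1 (t0 + min \<delta> \<delta>')"
  define A where "A = max B B'"
  have t2: "t0 < t2" "t2 \<le> t1" using t B B' by (auto simp: t2_def)
  show ?thesis
  proof (rule singular_endpoint_positive[OF t2(1), where a=a and b=b and \<phi>'=\<phi>' and \<phi>''=\<phi>'' and C=C and \<beta>=\<beta> and A=A])
    show "continuous_on {t0..<t2} \<phi>" using t2 by (auto intro: continuous_on_subset[OF cont])
    fix x assume x: "t0 \<le> x" "x < t2"
    hence xd: "\<bar>x - t0\<bar> < \<delta>" "\<bar>x - t0\<bar> < \<delta>'" by (auto simp: t2_def)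
    have "B * (x - t0)\<^sup>2 \<le> A * (x - t0)\<^sup>2" by (intro mult_right_mono) (auto simp: A_def)
    thus "b x \<le> \<beta> * (x - t0) + A * (x - t0)\<^sup>2" using B(2)[OF xd(1)] by linarith
    have "B' * \<bar>x - t0\<bar> \<le> A * \<bar>x - t0\<bar>" by (intro mult_right_mono) (auto simp: A_def)
    thus "\<bar>a x - a t0\<bar> \<le> A * (x - t0)" using B'(2)[OF xd(2)] x by simp
  qed (use assms t2 in auto)
qed

lemma first_order_bound:
  fixes a :: "real \<Rightarrow> real"
  assumes "Ck_on 2 a UNIV"
  shows "\<exists>C \<delta>. \<delta> > 0 \<and> (\<forall>t. \<bar>t - t0\<bar> < \<delta> \<longrightarrow> \<bar>a t - a t0\<bar> \<le> C * \<bar>t - t0\<bar>)"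
proof -
  obtain C \<delta> where C: "\<delta> > 0" "C > 0" "\<And>t. \<bar>t - t0\<bar> < \<delta> \<Longrightarrow> \<bar>a t - a t0 - deriv a t0 * (t - t0)\<bar> \<le> C * (t - t0)\<^sup>2"
    using second_order_bound[OF assms, of t0] by blast
  have "\<bar>a t - a t0\<bar> \<le> (\<bar>deriv a t0\<bar> + C * \<delta>) * \<bar>t - t0\<bar>" if t: "\<bar>t - t0\<bar> < \<delta>" for t
  proof -
    have "\<bar>a t - a t0\<bar> \<le> \<bar>deriv a t0 * (t - t0)\<bar> + C * (t - t0)\<^sup>2" using C(3)[OF t] by linarith
    also have "(t - t0)\<^sup>2 = \<bar>t - t0\<bar> * \<bar>t - t0\<bar>" by (simp add: power2_eq_square)
    also have "C * (\<bar>t - t0\<bar> * \<bar>t - t0\<bar>) \<le> C * (\<delta> * \<bar>t - t0\<bar>)"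
      using t C by (intro mult_left_mono mult_right_mono) auto
    finally show ?thesis unfolding abs_mult by (simp add: distrib_right mult.assoc)
  qed
  thus ?thesis using C(1) by blast
qed

section \<open>The dichotomy\<close>

theorem theorem1p1:
  fixes M :: "'m::t2_space set"
    and A :: "('m, 'n::finite) chart set"
    and g :: "('m, 'n) metric_field"
    and f K u :: "'m \<Rightarrow> real"
    and S :: "'m set"
    and d :: "'m \<Rightarrow> real"
    and s q :: real
  assumes "closed_riemannian_manifold M A g"
    and "CARD('n) \<ge> 3"
    and "proper_isoparametric M A g f"
    and "S = focal_min M f \<union> focal_max M f"
    and "\<And>x. d x = riem_setdist M A g S x"
    and "0 < s" and "s < 2" and "q > 2"
    and "continuous_on M K" and "level_invariant M f K"
    and "continuous_on M u" and "Ck_fun A 2 u (M - S)"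
    and "\<forall>x\<in>M. u x \<ge> 0" and "level_invariant M f u"
    and "\<forall>x\<in>M - S. laplace_beltrami A g u x + K x * u x = u x powr (q - 1) / d x powr s"
  shows "(\<forall>x\<in>M. u x = 0) \<or> (\<forall>x\<in>M. u x > 0)"
proof -
  have M: "compact M" "connected M" and "riemannian_atlas M A g"
    using assms(1) by (auto simp: closed_riemannian_manifold_def riemannian_atlas_def)
  interpret riemannian_atlas M A g by fact
  have iso: "isoparametric M A g f" using assms(3) by (simp add: proper_isoparametric_def)
  have f: "smooth_fun A f M" using iso by (simp add: isoparametric_def)
  obtain x1 x2 where nonconst: "x1 \<in> M" "x2 \<in> M" "f x1 \<noteq> f x2" using iso by (auto simp: isoparametric_def)
  obtain a b where sa: "smooth_on a UNIV" and sb: "smooth_on b UNIV"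
    and gn: "\<And>x. x \<in> M \<Longrightarrow> grad_norm_sq A g f x = b (f x)"
    and lap: "\<And>x. x \<in> M \<Longrightarrow> laplace_beltrami A g f x = a (f x)"
    using iso unfolding isoparametric_def by blast
  have a2: "Ck_on 2 a UNIV" and b2: "Ck_on 2 b UNIV" using sa sb by (auto simp: smooth_on_def)
  have contf: "continuous_on M f" by (rule smooth_fun_continuous[OF f])
  have "connected (f ` M) \<and> compact (f ` M)"
    using M contf connected_continuous_image compact_continuous_image by blast
  from connected_compact_interval_1[THEN iffD1, OF this] obtain t0 t1 where fM: "f ` M = {t0..t1}" by auto
  have fin: "t0 \<le> f x" "f x \<le> t1" if "x \<in> M" for x using fM that by auto
  have ex: "\<exists>x\<in>M. f x = t" if "t0 \<le> t" "t \<le> t1" for t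
  proof -
    have "t \<in> f ` M" unfolding fM using that by simp
    thus ?thesis by auto
  qed
  have t01: "t0 < t1" using fin[OF nonconst(1)] fin[OF nonconst(2)] nonconst(3) by linarith
  have foc: "focal_min M f = {x\<in>M. f x = t0}" "focal_max M f = {x\<in>M. f x = t1}"
    using t01 by (simp_all add: focal_min_def focal_max_def fM)
  \<comment> \<open>the equation holds exactly over the open interval of non-extremal values\<close>
  have MS: "M - S = {x\<in>M. f x \<in> {t0<..<t1}}"
    using fin unfolding assms(4) foc by (auto simp: less_le)
  define \<phi> where "\<phi> t = u (SOME x. x \<in> M \<and> f x = t)" for t
  have \<phi>: "\<phi> (f x) = u x" if x: "x \<in> M" for x
  proof -
    have "\<exists>y. y \<in> M \<and> f y = f x" using x by blast
    from someI_ex[OF this] show ?thesis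
      using assms(14) x unfolding level_invariant_def \<phi>_def by blast
  qed
  have cont\<phi>: "continuous_on {t0..t1} \<phi>"
    using level_function_continuous[OF M(1) contf assms(11) \<phi>] by (simp add: fM)
  have \<phi>nonneg: "\<phi> t \<ge> 0" if "t0 \<le> t" "t \<le> t1" for t
    using ex[OF that] \<phi> assms(13) by auto
  have db: "(b has_real_derivative deriv b t) (at t)" for t by (rule Ck_on_2_real(1)[OF b2])
  have bnonneg: "b t \<ge> 0" if "t0 \<le> t" "t \<le> t1" for t
    using ex[OF that] gn grad_norm_sq_nonneg[OF f] by force
  \<comment> \<open>the three uses: \<open>b > 0\<close> between \<open>t0\<close> and \<open>t1\<close>, \<open>b'(t0) > 0\<close> and \<open>b'(t1) < 0\<close>\<close>
  have nondeg: "deriv b t \<noteq> 0" if t: "t0 \<le> t" "t \<le> t1" "b t = 0" for t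
    using ex[OF t(1,2)] no_degenerate_level[OF M(2) f gn b2 nonconst] t(3) by blast
  have bpos: "b t > 0" if t: "t0 < t" "t < t1" for t
  proof -
    have "deriv b t = 0" if "b t = 0"
      by (rule DERIV_local_min[OF db, of "min (t - t0) (t1 - t)"])
         (use t that bnonneg in \<open>auto simp: abs_if split: if_splits\<close>)
    hence "b t \<noteq> 0" using nondeg[of t] t by auto
    thus ?thesis using bnonneg[of t] t by simp
  qed
  obtain p0 p1 where p0: "p0 \<in> M" "f p0 = t0" and p1: "p1 \<in> M" "f p1 = t1" using ex t01 by (meson less_imp_le order_refl)
  have bt0: "b t0 = 0" using extremum_grad_norm_zero[OF f p0(1), of 1] fin(1) gn[OF p0(1)] p0 by simp
  have bt1: "b t1 = 0" using extremum_grad_norm_zero[OF f p1(1), of "-1"] fin(2) gn[OF p1(1)] p1 by simp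
  have db0: "deriv b t0 > 0"
  proof (rule ccontr)
    assume "\<not> deriv b t0 > 0"
    hence "deriv b t0 < 0" using nondeg[of t0] bt0 t01 by simp
    from DERIV_neg_dec_right[OF db this] obtain e where e: "e > 0" "\<And>h. h > 0 \<Longrightarrow> h < e \<Longrightarrow> b (t0 + h) < b t0" by blast
    define h where "h = min (e / 2) (t1 - t0)"
    have "h > 0" "h < e" "h \<le> t1 - t0" using e(1) t01 by (auto simp: h_def min_less_iff_disj)
    with e(2)[of h] bnonneg[of "t0 + h"] bt0 show False by simp
  qed
  have db1: "- deriv b t1 > 0"
  proof (rule ccontr)
    assume "\<not> - deriv b t1 > 0"
    hence "deriv b t1 > 0" using nondeg[of t1] bt1 t01 by simp
    from DERIV_pos_inc_left[OF db this] obtain e where e: "e > 0" "\<And>h. h > 0 \<Longrightarrow> h < e \<Longrightarrow> b (t1 - h) < b t1" by blast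
    define h where "h = min (e / 2) (t1 - t0)"
    have "h > 0" "h < e" "h \<le> t1 - t0" using e(1) t01 by (auto simp: h_def min_less_iff_disj)
    with e(2)[of h] bnonneg[of "t1 - h"] bt1 show False by simp
  qed
  have codim: "\<exists>k>1. submanifold_codim_at A {x\<in>M. f x = f p} p k" if "p \<in> M" "f p = t0 \<or> f p = t1" for p
    using that assms(3) unfolding proper_isoparametric_def foc by auto
  \<comment> \<open>this is the point at which codimension at least \<open>2\<close> is needed\<close>
  have scale: "\<beta> \<le> \<beta> / 2 * real k" if "\<beta> > 0" "k > 1" for \<beta> :: real and k :: nat
  proof -
    have "\<beta> / 2 * 2 \<le> \<beta> / 2 * real k" using that by (intro mult_left_mono) auto
    thus ?thesis by simp
  qed
  have at0: "deriv b t0 \<le> - a t0"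
  proof -
    obtain k where k: "k > 1" "submanifold_codim_at A {x\<in>M. f x = f p0} p0 k" using codim p0 by blast
    have "1 * deriv b (f p0) / 2 * real k \<le> - 1 * laplace_beltrami A g f p0"
      by (rule focal_laplacian_ge_codimension[OF f gn b2 p0(1) _ _ _ k(2)]) (use p0 fin bt0 db0 in auto)
    thus ?thesis using scale[OF db0 k(1)] lap[OF p0(1)] p0 by simp
  qed
  have at1: "- deriv b t1 \<le> a t1"
  proof -
    obtain k where k: "k > 1" "submanifold_codim_at A {x\<in>M. f x = f p1} p1 k" using codim p1 by blast
    have "- 1 * deriv b (f p1) / 2 * real k \<le> - (- 1) * laplace_beltrami A g f p1"
      by (rule focal_laplacian_ge_codimension[OF f gn b2 p1(1) _ _ _ k(2)]) (use p1 fin bt1 db1 in auto)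
    thus ?thesis using scale[OF db1 k(1)] lap[OF p1(1)] p1 by simp
  qed
  have twice: "\<exists>D. (\<forall>\<^sub>F s in nhds t. (\<phi> has_real_derivative D s) (at s)) \<and> D differentiable (at t)"
    if t: "t0 < t" "t < t1" for t
  proof -
    obtain x where x: "x \<in> M" "f x = t" using ex t by (meson less_imp_le)
    have "\<exists>D. (\<forall>\<^sub>F s in nhds (f x). (\<phi> has_real_derivative D s) (at s)) \<and> D differentiable (at (f x))"
    proof (rule level_function_twice_differentiable[OF f x(1), of "{t0<..<t1}"])
      show "Ck_fun A 2 u {x\<in>M. f x \<in> {t0<..<t1}}" using assms(12) by (simp only: MS)
      show "grad_norm_sq A g f x \<noteq> 0" using gn[OF x(1)] bpos[OF t] x by simp
    qed (use \<phi> x t in auto)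
    thus ?thesis by (simp add: x)
  qed
  have d\<phi>: "(\<phi> has_real_derivative deriv \<phi> t) (at t)" if t: "t0 < t" "t < t1" for t
    using twice[OF t] eventually_nhds_x_imp_x DERIV_imp_deriv by metis
  have d\<phi>2: "(deriv \<phi> has_real_derivative deriv (deriv \<phi>) t) (at t)" if t: "t0 < t" "t < t1" for t
  proof -
    obtain D D' where D: "\<forall>\<^sub>F s in nhds t. (\<phi> has_real_derivative D s) (at s)" "(D has_real_derivative D') (at t)"
      using twice[OF t] unfolding real_differentiable_def by blast
    have "\<forall>\<^sub>F s in nhds t. D s = deriv \<phi> s" using D(1) by eventually_elim (simp add: DERIV_imp_deriv)
    hence "(deriv \<phi> has_real_derivative D') (at t)" by (rule DERIV_cong_ev[THEN iffD1, OF refl _ refl D(2)])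
    thus ?thesis using DERIV_imp_deriv by metis
  qed
  obtain C0 where C0: "\<And>x. x \<in> M \<Longrightarrow> \<bar>K x\<bar> \<le> C0"
    using compact_imp_bounded[OF compact_continuous_image[OF assms(9) M(1)]] by (auto simp: bounded_iff)
  define C where "C = max C0 1"
  have C: "C > 0" by (simp add: C_def)
  \<comment> \<open>the right-hand side of the equation enters only through its sign\<close>
  have ineq: "b t * deriv (deriv \<phi>) t - a t * deriv \<phi> t \<le> C * \<phi> t" if t: "t0 < t" "t < t1" for t
  proof -
    obtain x where x: "x \<in> M" "f x = t" using ex t by (meson less_imp_le)
    have "laplace_beltrami A g u x = deriv \<phi> (f x) * laplace_beltrami A g f x - deriv (deriv \<phi>) (f x) * grad_norm_sq A g f x"
      by (rule laplace_beltrami_composition[OF f x(1), of "{t0<..<t1}" \<phi>])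
         (use \<phi> x t d\<phi> d\<phi>2 in auto)
    hence "laplace_beltrami A g u x = deriv \<phi> t * a t - deriv (deriv \<phi>) t * b t"
      using gn[OF x(1)] lap[OF x(1)] x by simp
    moreover have "x \<in> M - S" unfolding MS using x t by simp
    hence "laplace_beltrami A g u x + K x * u x = u x powr (q - 1) / d x powr s" using assms(15) by blast
    hence "laplace_beltrami A g u x + K x * u x \<ge> 0" by simp
    moreover have "K x * u x \<le> C * u x"
      using C0[OF x(1)] assms(13) x(1) by (intro mult_right_mono) (auto simp: C_def)
    moreover have "u x = \<phi> t" using \<phi>[OF x(1)] x by simp
    ultimately show ?thesis by (simp add: mult.commute)
  qed
  have conta: "continuous_on {t0<..<t1} a" and contb: "continuous_on {t0<..<t1} b"
    using Ck_on_2_continuous[OF a2] Ck_on_2_continuous[OF b2] by (auto intro: continuous_on_subset)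
  show ?thesis
  proof (cases "\<exists>t. t0 < t \<and> t < t1 \<and> \<phi> t = 0")
    case True
    then obtain z where z: "t0 < z" "z < t1" "\<phi> z = 0" by blast
    have zero: "\<phi> t = 0" if t: "t \<in> {t0<..<t1}" for t
      by (rule interior_zero_propagates[OF d\<phi> d\<phi>2 \<phi>nonneg bpos conta contb ineq C z]) (use t in auto)
    have cl: "closure {t0<..<t1} = {t0..t1}" using t01 by (simp add: closure_greaterThanLessThan)
    have "\<phi> t = 0" if "t \<in> {t0..t1}" for t
      using continuous_constant_on_closure[of "{t0<..<t1}" \<phi> 0 t] cont\<phi> zero that by (simp add: cl)
    hence "u x = 0" if "x \<in> M" for x using \<phi>[OF that] fin[OF that] by auto
    thus ?thesis by blast
  next
    case False
    hence pos: "\<phi> t > 0" if "t0 < t" "t < t1" for t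
      using \<phi>nonneg[of t] that by (auto simp: less_le)
    have "\<phi> t0 > 0"
    proof (rule singular_endpoint_positive_local[OF t01 d\<phi> d\<phi>2 cont\<phi> pos _ ineq C db0 at0])
      show "\<exists>B \<delta>. \<delta> > 0 \<and> (\<forall>x. \<bar>x - t0\<bar> < \<delta> \<longrightarrow> \<bar>b x - deriv b t0 * (x - t0)\<bar> \<le> B * (x - t0)\<^sup>2)"
        using second_order_bound[OF b2, of t0] bt0 by auto
    qed (use first_order_bound[OF a2] bnonneg in auto)
    \<comment> \<open>under \<open>t \<mapsto> - t\<close> the coefficient \<open>a\<close> of the first derivative changes its sign\<close>
    moreover have "\<phi> (- (- t1)) > 0"
    proof (rule singular_endpoint_positive_local[of "- t1" "- t0" "\<lambda>t. \<phi> (- t)" "\<lambda>t. - deriv \<phi> (- t)"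
          "\<lambda>t. deriv (deriv \<phi>) (- t)" "\<lambda>t. b (- t)" "\<lambda>t. - a (- t)" C "- deriv b t1"])
      show "- deriv b t1 > 0" by (rule db1)
      show "continuous_on {- t1..- t0} (\<lambda>t. \<phi> (- t))"
        by (rule continuous_on_compose2[OF cont\<phi>]) (auto intro!: continuous_intros)
      show "\<exists>B \<delta>. \<delta> > 0 \<and> (\<forall>x. \<bar>x - - t1\<bar> < \<delta> \<longrightarrow> \<bar>b (- x) - (- deriv b t1) * (x - - t1)\<bar> \<le> B * (x - - t1)\<^sup>2)"
      proof -
        obtain B \<delta> where B: "\<delta> > 0" "\<And>x. \<bar>x - t1\<bar> < \<delta> \<Longrightarrow> \<bar>b x - b t1 - deriv b t1 * (x - t1)\<bar> \<le> B * (x - t1)\<^sup>2"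
          using second_order_bound[OF b2, of t1] by blast
        have "\<bar>b (- x) - (- deriv b t1) * (x - - t1)\<bar> \<le> B * (x - - t1)\<^sup>2" if "\<bar>x - - t1\<bar> < \<delta>" for x
        proof -
          have "\<bar>- x - t1\<bar> < \<delta>" using that by simp
          moreover have "(- x - t1)\<^sup>2 = (x - - t1)\<^sup>2" by (simp add: power2_eq_square algebra_simps)
          moreover have "deriv b t1 * (- x - t1) = (- deriv b t1) * (x - - t1)" by (simp add: algebra_simps)
          ultimately show ?thesis using B(2)[of "- x"] bt1 by simp
        qed
        thus ?thesis using B(1) by blast
      qed
      show "\<exists>B \<delta>. \<delta> > 0 \<and> (\<forall>x. \<bar>x - - t1\<bar> < \<delta> \<longrightarrow> \<bar>- a (- x) - - a (- (- t1))\<bar> \<le> B * \<bar>x - - t1\<bar>)"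
      proof -
        obtain B \<delta> where B: "\<delta> > 0" "\<And>x. \<bar>x - t1\<bar> < \<delta> \<Longrightarrow> \<bar>a x - a t1\<bar> \<le> B * \<bar>x - t1\<bar>"
          using first_order_bound[OF a2, of t1] by blast
        have "\<bar>- a (- x) - - a (- (- t1))\<bar> \<le> B * \<bar>x - - t1\<bar>" if "\<bar>x - - t1\<bar> < \<delta>" for x
        proof -
          have e: "\<bar>- x - t1\<bar> = \<bar>x - - t1\<bar>" by simp
          have "\<bar>a (- x) - a t1\<bar> \<le> B * \<bar>- x - t1\<bar>" using that by (intro B(2)) simp
          thus ?thesis unfolding e by simp
        qed
        thus ?thesis using B(1) by blast
      qed
      fix x assume x: "- t1 < x" "x < - t0"
      hence x': "t0 < - x" "- x < t1" by auto
      show "((\<lambda>t. \<phi> (- t)) has_real_derivative - deriv \<phi> (- x)) (at x)"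
        using d\<phi>[OF x'] by (simp add: DERIV_mirror)
      have "((\<lambda>t. deriv \<phi> (- t)) has_real_derivative - deriv (deriv \<phi>) (- x)) (at x)"
        using d\<phi>2[OF x'] by (simp add: DERIV_mirror)
      from DERIV_minus[OF this]
      show "((\<lambda>t. - deriv \<phi> (- t)) has_real_derivative deriv (deriv \<phi>) (- x)) (at x)" by simp
      show "\<phi> (- x) > 0" using pos x' by blast
      show "b (- x) \<ge> 0" using bpos[OF x'] by simp
      show "b (- x) * deriv (deriv \<phi>) (- x) - - a (- x) * - deriv \<phi> (- x) \<le> C * \<phi> (- x)"
        using ineq[OF x'] by simp
    qed (use t01 C at1 in auto)
    ultimately have all: "\<phi> t > 0" if "t0 \<le> t" "t \<le> t1" for t
      using pos[of t] that by (cases "t = t0"; cases "t = t1") auto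
    have "u x > 0" if "x \<in> M" for x using all fin[OF that] \<phi>[OF that] by metis
    thus ?thesis by blast
  qed
qed

end
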